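(* Let $d\in\{2,3\}$. Assume that the data on $\mathcal T_h$ are locally divergence-free polynomials, that the cell and face quadratures have the properties listed in the context, and that all quadrature states and exterior boundary traces belong to $\mathcal G$. Suppose that at every interface quadrature point $a^-\le a^{-,0}$ and $a^+\ge a^{+,0}$, and that $$\lambda_K\,c_{K,\nu}\,(\alpha_{K,\nu}^{\rm PP}-a_{K,\nu}^-)<\omega_{K,\nu},\qquad K\in\mathcal T_h,\ \nu\in\mathcal I_K^\partial.$$ Suppose further that for all $1\le r\le M$ $$\eta_r(\mathbf T^\pm)\le\mathscr E_r^{\rm HLL}\ \text{ at every interface point},\qquad \eta_r(\mathbf\Xi_K)\le\mathscr E_{K,r}^{\Xi}\ \text{ in every cell }K\in\mathcal T_h.$$ Then the forward Euler cell-average update $\overline{\mathbf U}_K^{n+1}=\overline{\mathbf U}_K^n-\lambda_K\sum_{\nu}c_{K,\nu}\mathbf G_{K,\nu}$ is weakly multi-entropy stable: for every $K\in\mathcal T_h$ and every $1\le r\le M$, $$\overline{\mathbf U}_K^{n+1}\in\mathcal G,\qquad \eta_r(\overline{\mathbf U}_K^{n+1})\le\mathcal B_{K,r}^n .$$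
   Context: **States, flux, entropies.** Fix $\gamma>1$. A state is $\mathbf U=(\rho,\mathbf m^\top,\mathbf B^\top,E)^\top\in\mathbb R^8$ with $\mathbf m,\mathbf B\in\mathbb R^3$; $\mathbf v=\mathbf m/\rho$, $p=(\gamma-1)(E-\frac{|\mathbf m|^2}{2\rho}-\frac{|\mathbf B|^2}{2})$, $p_{\rm tot}=p+\frac{|\mathbf B|^2}2$. Admissible set $\mathcal G=\{\mathbf U:\rho>0,\ E-\frac{|\mathbf m|^2}{2\rho}-\frac{|\mathbf B|^2}{2}>0\}$. $\mathbf F_i(\mathbf U)=(\rho v_i,(v_i\mathbf m-B_i\mathbf B+p_{\rm tot}\mathbf e_i)^\top,(v_i\mathbf B-B_i\mathbf v)^\top,v_i(E+p_{\rm tot})-B_i(\mathbf v\cdot\mathbf B))^\top$; $\mathbf S(\mathbf U)=(0,\mathbf B^\top,\mathbf v^\top,\mathbf v\cdot\mathbf B)^\top$. Let $f_1,\dots,f_M\in C^2(\mathbb R)$ satisfy $f_r'>0$, $f_r'-\gamma f_r''>0$ on $\mathbb R$; with $s=\log p-\gamma\log\rho$, $\eta_r(\mathbf U)=-\rho f_r(s)$ on $\mathcal G$. For a unit vector $\mathbf n\in\mathbb R^d$ (identified with $(n_1,n_2,0)^\top$ when $d=2$): $\mathbf F_{\mathbf n}=\sum_{i=1}^dn_i\mathbf F_i$, $B_{\mathbf n}(\mathbf U)=\mathbf B\cdot\mathbf n$, $q_{r,\mathbf n}(\mathbf U)=\eta_r(\mathbf U)\,\mathbf v\cdot\mathbf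 n$. **Splitting speeds.** For $\mathbf U,\widetilde{\mathbf U}\in\mathcal G$ and a unit vector $\xi$: $\mathcal C(\mathbf U;\xi)=\frac1{\sqrt2}\Big[\mathcal C_s^2+\frac{|\mathbf B|^2}\rho+\sqrt{(\mathcal C_s^2+\frac{|\mathbf B|^2}\rho)^2-4\frac{\mathcal C_s^2(\xi\cdot\mathbf B)^2}{\rho}}\Big]^{1/2}$, $\mathcal C_s^2=\frac{(\gamma-1)p}{2\rho}$. With $\widehat{\mathbf v}=\frac{\sqrt\rho\mathbf v+\sqrt{\tilde\rho}\tilde{\mathbf v}}{\sqrt\rho+\sqrt{\tilde\rho}}$ and $\mathfrak b=\frac{|\mathbf B-\widetilde{\mathbf B}|}{\sqrt\rho+\sqrt{\tilde\rho}}$, $\alpha_r(\mathbf U,\widetilde{\mathbf U};\xi)=\max\{\mathbf v\cdot\xi,\widehat{\mathbf v}\cdot\xi\}+\mathcal C(\mathbf U;\xi)+\mathfrak b$, $\alpha_l(\mathbf U,\widetilde{\mathbf U};\xi)=\min\{\mathbf v\cdot\xi,\widehat{\mathbf v}\cdot\xi\}-\mathcal C(\mathbf U;\xi)-\mathfrak b$. **Mesh, data, quadrature.** $\mathcal T_h$ is a finite conforming mesh of bounded polytopal cells $K\subset\mathbb R^d$ with nonempty interiors and planar faces. On each $K$, $\mathbf U_K^n\in[\mathbb P^k(K)]^8$ (total degree $\le k$), locally divergence-free (LDF): $\sum_{i=1}^d\partial_{x_i}B_{i,K}^n=0$ in $K$. For a face $e\subset\partial K$, $\mathbf n_{K,e}$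 is the outward unit normal; a face quadrature $\{(\mathbf x_{e,q},\varpi_{e,q})\}_{q=1}^{Q_e}$, exact for face averages of $\mathbb P^k(e)$, with $\varpi_{e,q}>0$, $\sum_q\varpi_{e,q}=1$, is used, the same for both cells sharing $e$. $\mathcal I_K^\partial=\{(e,q):e\subset\partial K,1\le q\le Q_e\}$. For $\nu=(e,q)$: $c_{K,\nu}=|e|\varpi_{e,q}$, $\mathbf n_{K,\nu}=\mathbf n_{K,e}$, $\mathbf U_{K,\nu}=\mathbf U_K^n(\mathbf x_{e,q})$ (with components $\rho_{K,\nu},\mathbf v_{K,\nu},\mathbf B_{K,\nu}$), and $\mathbf U_{K,\nu}^{\rm ext}$ is the value at $\mathbf x_{e,q}$ of the polynomial of the neighboring cell across $e$ (a prescribed exterior boundary trace on the domain boundary). Each cell has a volume quadrature, exact for cell averages of $\mathbb P^k(K)$, with strictly positive weights summing to $1$, whose nodes include all face quadrature points: $\overline{\mathbf U}_K^n=\frac1{|K|}\int_K\mathbf U_K^n\,d\mathbf x=\sum_{\alpha\in\mathcal I_K^\circ}\omega_{K,\alpha}^\circ\widehat{\mathbf U}_K^{[\alpha]}+\sum_{\nu\in\mathcal I_K^\partial}\omega_{K,\nu}\mathbf U_{K,\nu}$, where $\widehat{\mathbf U}_K^{[\alpha]}$ are values of $\mathbf U_K^n$ at the remaining (interior) nodes ($\mathcal I_K^\circ$ may be empty). **Interface wave speeds and scheme.** At each interface quadrature point, with traces $\mathbf U^\mp$ and unit normal $\mathbf n$ pointing from the minus to the plus side, let $\delta B_{\mathbf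 n}=B_{\mathbf n}(\mathbf U^+)-B_{\mathbf n}(\mathbf U^-)$, $\rho^\pm=\rho(\mathbf U^\pm)$, $s_F=\max_{\varsigma=\pm}\sqrt{(\gamma p(\mathbf U^\varsigma)+|\mathbf B(\mathbf U^\varsigma)|^2)/\rho(\mathbf U^\varsigma)}$, $a^{-,0}=\min\{0,\alpha_l(\mathbf U^-,\mathbf U^+;\mathbf n)\}-\frac{|\delta B_{\mathbf n}|}{\sqrt{\rho^-}}-s_F$, $a^{+,0}=\max\{0,\alpha_r(\mathbf U^+,\mathbf U^-;\mathbf n)\}+\frac{|\delta B_{\mathbf n}|}{\sqrt{\rho^+}}+s_F$. Wave speeds $a^-<0<a^+$ are chosen, $C_F=a^+-a^-$; reversing the orientation swaps the traces and maps $\mathbf n\mapsto-\mathbf n$, $(a^-,a^+)\mapsto(-a^+,-a^-)$, so both adjacent cells share one pair. Set $\widehat{\mathbf F}_{\mathbf n}=\frac{a^+\mathbf F_{\mathbf n}(\mathbf U^-)-a^-\mathbf F_{\mathbf n}(\mathbf U^+)+a^+a^-(\mathbf U^+-\mathbf U^-)}{C_F}$, $\mathbf H=\frac{a^+\mathbf U^+-a^-\mathbf U^--\mathbf F_{\mathbf n}(\mathbf U^+)+\mathbf F_{\mathbf n}(\mathbf U^-)}{C_F}$, $\mathbf T^\pm=\mathbf H-\frac{\delta B_{\mathbf n}}{C_F}\mathbf S(\mathbf U^\pm)$, $\widehat q_r=\frac{a^+q_{r,\mathbf n}(\mathbf U^-)-a^-q_{r,\mathbf n}(\mathbf U^+)+a^+a^-[\eta_r(\mathbf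 U^+)-\eta_r(\mathbf U^-)]}{C_F}$, $\mathscr E_r^{\rm HLL}=\frac{a^+\eta_r(\mathbf U^+)-a^-\eta_r(\mathbf U^-)-q_{r,\mathbf n}(\mathbf U^+)+q_{r,\mathbf n}(\mathbf U^-)}{C_F}$. For cell $K$ and $\nu\in\mathcal I_K^\partial$, subscript $K,\nu$ denotes evaluation with $(\mathbf U^-,\mathbf U^+,\mathbf n)=(\mathbf U_{K,\nu},\mathbf U_{K,\nu}^{\rm ext},\mathbf n_{K,\nu})$, and $\mathbf G_{K,\nu}=\widehat{\mathbf F}_{K,\nu}-\frac{a_{K,\nu}^-}{a_{K,\nu}^+-a_{K,\nu}^-}\,\delta B_{K,\nu}\,\mathbf S(\mathbf U_{K,\nu})$. For a time step $\tau>0$, $\lambda_K=\tau/|K|$. **Cell coefficients and interior state.** $|\partial K|=\sum_\nu c_{K,\nu}$, $\widetilde{\mathbf v}_{K,\nu\mu}=\frac{\sqrt{\rho_{K,\nu}}\mathbf v_{K,\nu}+\sqrt{\rho_{K,\mu}}\mathbf v_{K,\mu}}{\sqrt{\rho_{K,\nu}}+\sqrt{\rho_{K,\mu}}}$, $\alpha_{K,\nu}^{\rm PP}=\max\Big\{\mathbf v_{K,\nu}\cdot\mathbf n_{K,\nu},\ \frac1{|\partial K|}\sum_{\mu}c_{K,\mu}(\mathbf n_{K,\nu}-\mathbf n_{K,\mu})\cdot\widetilde{\mathbf v}_{K,\nu\mu}\Big\}+\mathcal C(\mathbf U_{K,\nu};\mathbf n_{K,\nu})+\frac2{|\partial K|}\sum_\mu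 c_{K,\mu}\frac{|\mathbf B_{K,\nu}-\mathbf B_{K,\mu}|}{\sqrt{\rho_{K,\nu}}+\sqrt{\rho_{K,\mu}}}$ (sums over $\mu\in\mathcal I_K^\partial$). $\beta_{K,\nu}=\frac{\omega_{K,\nu}}{\lambda_Kc_{K,\nu}}+a_{K,\nu}^-$, $D_K=\sum_\nu c_{K,\nu}\beta_{K,\nu}$, $\mathbf\Xi_K=\frac1{D_K}\sum_\nu c_{K,\nu}[\beta_{K,\nu}\mathbf U_{K,\nu}-\mathbf F_{\mathbf n_{K,\nu}}(\mathbf U_{K,\nu})]$, $\mathscr E_{K,r}^{\Xi}=\frac1{D_K}\sum_\nu c_{K,\nu}[\beta_{K,\nu}\eta_r(\mathbf U_{K,\nu})-q_{r,\mathbf n_{K,\nu}}(\mathbf U_{K,\nu})]$. (Under the stated hypotheses $D_K>0$ and $\mathbf T^\pm,\mathbf\Xi_K\in\mathcal G$.) **Entropy budget.** $\mathcal B_{K,r}^n=\sum_\alpha\omega_{K,\alpha}^\circ\eta_r(\widehat{\mathbf U}_K^{[\alpha]})+\sum_\nu\omega_{K,\nu}\eta_r(\mathbf U_{K,\nu})-\lambda_K\sum_\nu c_{K,\nu}\widehat q_{K,\nu,r}$. *)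

theory Defs
  imports "HOL-Analysis.Analysis"
begin

section \<open>States, fluxes, entropies\<close>

text \<open>A state is \<open>(\<rho>, m, B, E)\<close>; the product type carries the vector space structure of \<open>\<real>\<^sup>8\<close>.\<close>

type_synonym state = "real \<times> (real^3) \<times> (real^3) \<times> real"

definition dens :: "state \<Rightarrow> real" where
  "dens U = fst U"

definition mom :: "state \<Rightarrow> real^3" where
  "mom U = fst (snd U)"

definition mag :: "state \<Rightarrow> real^3" where
  "mag U = fst (snd (snd U))"

definition ener :: "state \<Rightarrow> real" where
  "ener U = snd (snd (snd U))"

definition vel :: "state \<Rightarrow> real^3" where
  "vel U = mom U /\<^sub>R dens U"

definition int_energy :: "state \<Rightarrow> real" where
  "int_energy U = ener U - (norm (mom U))\<^sup>2 / (2 * dens U) - (norm (mag U))\<^sup>2 / 2"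

definition pres :: "real \<Rightarrow> state \<Rightarrow> real" where
  "pres \<gamma> U = (\<gamma> - 1) * int_energy U"

definition ptot :: "real \<Rightarrow> state \<Rightarrow> real" where
  "ptot \<gamma> U = pres \<gamma> U + (norm (mag U))\<^sup>2 / 2"

definition admissible :: "state set" where
  "admissible = {U. dens U > 0 \<and> int_energy U > 0}"

definition flux :: "real \<Rightarrow> 3 \<Rightarrow> state \<Rightarrow> state" where
  "flux \<gamma> i U =
    (dens U * vel U $ i,
     (vel U $ i) *\<^sub>R mom U - (mag U $ i) *\<^sub>R mag U + ptot \<gamma> U *\<^sub>R axis i 1,
     (vel U $ i) *\<^sub>R mag U - (mag U $ i) *\<^sub>R vel U,
     (vel U $ i) * (ener U + ptot \<gamma> U) - (mag U $ i) * (vel U \<bullet> mag U))"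

definition source :: "state \<Rightarrow> state" where
  "source U = (0, mag U, vel U, vel U \<bullet> mag U)"

definition spec_entropy :: "real \<Rightarrow> state \<Rightarrow> real" where
  "spec_entropy \<gamma> U = ln (pres \<gamma> U) - \<gamma> * ln (dens U)"

definition eta :: "real \<Rightarrow> (real \<Rightarrow> real) \<Rightarrow> state \<Rightarrow> real" where
  "eta \<gamma> f U = - dens U * f (spec_entropy \<gamma> U)"

text \<open>Directions are vectors of \<open>\<real>\<^sup>3\<close>; for \<open>d = 2\<close> their third component is zero, see
  \<open>emb\<close> below, so summing over three indices is the same as summing over \<open>d\<close> of them.\<close>

definition flux_dir :: "real \<Rightarrow> real^3 \<Rightarrow> state \<Rightarrow> state" where
  "flux_dir \<gamma> n U = (\<Sum>i\<in>UNIV. (n $ i) *\<^sub>R flux \<gamma> i U)"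

definition Bn :: "real^3 \<Rightarrow> state \<Rightarrow> real" where
  "Bn n U = mag U \<bullet> n"

definition qn :: "real \<Rightarrow> (real \<Rightarrow> real) \<Rightarrow> real^3 \<Rightarrow> state \<Rightarrow> real" where
  "qn \<gamma> f n U = eta \<gamma> f U * (vel U \<bullet> n)"

definition entropy_generator :: "real \<Rightarrow> (real \<Rightarrow> real) \<Rightarrow> bool" where
  "entropy_generator \<gamma> f \<longleftrightarrow>
    f C1_differentiable_on UNIV \<and> deriv f C1_differentiable_on UNIV \<and>
    (\<forall>s. deriv f s > 0 \<and> deriv f s - \<gamma> * deriv (deriv f) s > 0)"

section \<open>Splitting speeds\<close>

definition Cs2 :: "real \<Rightarrow> state \<Rightarrow> real" where
  "Cs2 \<gamma> U = (\<gamma> - 1) * pres \<gamma> U / (2 * dens U)"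

definition Cspeed :: "real \<Rightarrow> state \<Rightarrow> real^3 \<Rightarrow> real" where
  "Cspeed \<gamma> U \<xi> = 1 / sqrt 2 *
    sqrt (Cs2 \<gamma> U + (norm (mag U))\<^sup>2 / dens U +
      sqrt ((Cs2 \<gamma> U + (norm (mag U))\<^sup>2 / dens U)\<^sup>2 - 4 * (Cs2 \<gamma> U * (\<xi> \<bullet> mag U)\<^sup>2 / dens U)))"

definition roe_vel :: "state \<Rightarrow> state \<Rightarrow> real^3" where
  "roe_vel U V =
    (sqrt (dens U) *\<^sub>R vel U + sqrt (dens V) *\<^sub>R vel V) /\<^sub>R (sqrt (dens U) + sqrt (dens V))"

definition mag_jump :: "state \<Rightarrow> state \<Rightarrow> real" where
  "mag_jump U V = norm (mag U - mag V) / (sqrt (dens U) + sqrt (dens V))"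

definition alpha_r :: "real \<Rightarrow> state \<Rightarrow> state \<Rightarrow> real^3 \<Rightarrow> real" where
  "alpha_r \<gamma> U V \<xi> = max (vel U \<bullet> \<xi>) (roe_vel U V \<bullet> \<xi>) + Cspeed \<gamma> U \<xi> + mag_jump U V"

definition alpha_l :: "real \<Rightarrow> state \<Rightarrow> state \<Rightarrow> real^3 \<Rightarrow> real" where
  "alpha_l \<gamma> U V \<xi> = min (vel U \<bullet> \<xi>) (roe_vel U V \<bullet> \<xi>) - Cspeed \<gamma> U \<xi> - mag_jump U V"

section \<open>Interface quantities\<close>

text \<open>\<open>Um\<close>, \<open>Up\<close> are the traces on the minus and plus side, \<open>n\<close> points from minus to plus,
  and \<open>am\<close>, \<open>ap\<close> are the wave speeds \<open>a\<^sup>-\<close>, \<open>a\<^sup>+\<close>.\<close>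

definition dB :: "state \<Rightarrow> state \<Rightarrow> real^3 \<Rightarrow> real" where
  "dB Um Up n = Bn n Up - Bn n Um"

definition s_fast :: "real \<Rightarrow> state \<Rightarrow> state \<Rightarrow> real" where
  "s_fast \<gamma> Um Up =
    max (sqrt ((\<gamma> * pres \<gamma> Um + (norm (mag Um))\<^sup>2) / dens Um))
        (sqrt ((\<gamma> * pres \<gamma> Up + (norm (mag Up))\<^sup>2) / dens Up))"

definition am0 :: "real \<Rightarrow> state \<Rightarrow> state \<Rightarrow> real^3 \<Rightarrow> real" where
  "am0 \<gamma> Um Up n =
    min 0 (alpha_l \<gamma> Um Up n) - \<bar>dB Um Up n\<bar> / sqrt (dens Um) - s_fast \<gamma> Um Up"

definition ap0 :: "real \<Rightarrow> state \<Rightarrow> state \<Rightarrow> real^3 \<Rightarrow> real" where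
  "ap0 \<gamma> Um Up n =
    max 0 (alpha_r \<gamma> Up Um n) + \<bar>dB Um Up n\<bar> / sqrt (dens Up) + s_fast \<gamma> Um Up"

definition hll_flux :: "real \<Rightarrow> state \<Rightarrow> state \<Rightarrow> real^3 \<Rightarrow> real \<Rightarrow> real \<Rightarrow> state" where
  "hll_flux \<gamma> Um Up n am ap =
    (ap *\<^sub>R flux_dir \<gamma> n Um - am *\<^sub>R flux_dir \<gamma> n Up + (ap * am) *\<^sub>R (Up - Um)) /\<^sub>R (ap - am)"

definition hll_state :: "real \<Rightarrow> state \<Rightarrow> state \<Rightarrow> real^3 \<Rightarrow> real \<Rightarrow> real \<Rightarrow> state" where
  "hll_state \<gamma> Um Up n am ap =
    (ap *\<^sub>R Up - am *\<^sub>R Um - flux_dir \<gamma> n Up + flux_dir \<gamma> n Um) /\<^sub>R (ap - am)"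

definition T_minus :: "real \<Rightarrow> state \<Rightarrow> state \<Rightarrow> real^3 \<Rightarrow> real \<Rightarrow> real \<Rightarrow> state" where
  "T_minus \<gamma> Um Up n am ap =
    hll_state \<gamma> Um Up n am ap - (dB Um Up n / (ap - am)) *\<^sub>R source Um"

definition T_plus :: "real \<Rightarrow> state \<Rightarrow> state \<Rightarrow> real^3 \<Rightarrow> real \<Rightarrow> real \<Rightarrow> state" where
  "T_plus \<gamma> Um Up n am ap =
    hll_state \<gamma> Um Up n am ap - (dB Um Up n / (ap - am)) *\<^sub>R source Up"

definition hll_qflux ::
  "real \<Rightarrow> (real \<Rightarrow> real) \<Rightarrow> state \<Rightarrow> state \<Rightarrow> real^3 \<Rightarrow> real \<Rightarrow> real \<Rightarrow> real" where
  "hll_qflux \<gamma> f Um Up n am ap =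
    (ap * qn \<gamma> f n Um - am * qn \<gamma> f n Up + ap * am * (eta \<gamma> f Up - eta \<gamma> f Um)) / (ap - am)"

definition hll_entropy ::
  "real \<Rightarrow> (real \<Rightarrow> real) \<Rightarrow> state \<Rightarrow> state \<Rightarrow> real^3 \<Rightarrow> real \<Rightarrow> real \<Rightarrow> real" where
  "hll_entropy \<gamma> f Um Up n am ap =
    (ap * eta \<gamma> f Up - am * eta \<gamma> f Um - qn \<gamma> f n Up + qn \<gamma> f n Um) / (ap - am)"

definition num_flux :: "real \<Rightarrow> state \<Rightarrow> state \<Rightarrow> real^3 \<Rightarrow> real \<Rightarrow> real \<Rightarrow> state" where
  "num_flux \<gamma> Um Up n am ap =
    hll_flux \<gamma> Um Up n am ap - (am / (ap - am) * dB Um Up n) *\<^sub>R source Um"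

section \<open>Polynomials, polytopal sets, surface integrals\<close>

definition poly_deg :: "nat \<Rightarrow> (real^'d \<Rightarrow> real) \<Rightarrow> bool" where
  "poly_deg k g \<longleftrightarrow>
    (\<exists>c :: ('d \<Rightarrow> nat) \<Rightarrow> real.
      \<forall>x. g x = (\<Sum>a\<in>{a. (\<Sum>i\<in>UNIV. a i) \<le> k}. c a * (\<Prod>i\<in>UNIV. (x $ i) ^ a i)))"

definition state_poly :: "nat \<Rightarrow> (real^'d \<Rightarrow> state) \<Rightarrow> bool" where
  "state_poly k u \<longleftrightarrow> (\<forall>b\<in>Basis. poly_deg k (\<lambda>x. u x \<bullet> b))"

text \<open>The library's \<open>polytope\<close> is a convex polytope. Cells of a polytopal mesh and their faces
  need not be convex, so they are finite unions of convex polytopes of one dimension \<open>j\<close>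
  (\<open>j = d\<close> for cells, which gives a nonempty interior, and \<open>j = d - 1\<close> for faces).\<close>

definition polytopal :: "int \<Rightarrow> (real^'d) set \<Rightarrow> bool" where
  "polytopal j S \<longleftrightarrow>
    (\<exists>P. finite P \<and> P \<noteq> {} \<and> (\<forall>p\<in>P. polytope p \<and> aff_dim p = j) \<and> S = \<Union>P)"

text \<open>Outward unit normal of \<open>K\<close> on the planar face \<open>e\<close>: near each relative interior point of
  \<open>e\<close> the cell is the half ball opposite to \<open>n\<close>.\<close>

definition outward_unit_normal :: "(real^'d) set \<Rightarrow> (real^'d) set \<Rightarrow> real^'d \<Rightarrow> bool" where
  "outward_unit_normal K e n \<longleftrightarrow>
    norm n = 1 \<and> (\<exists>c. \<forall>x\<in>e. n \<bullet> x = c) \<and>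
    (\<forall>x\<in>rel_interior e. \<exists>\<epsilon>>0. K \<inter> ball x \<epsilon> = {y \<in> ball x \<epsilon>. n \<bullet> (y - x) \<le> 0})"

text \<open>\<open>Fs\<close> is the set of faces of the cell \<open>K\<close>, with outward unit normals \<open>N\<close>.\<close>

definition polytopal_cell ::
  "(real^'d) set \<Rightarrow> (real^'d) set set \<Rightarrow> ((real^'d) set \<Rightarrow> real^'d) \<Rightarrow> bool" where
  "polytopal_cell K Fs N \<longleftrightarrow>
    polytopal (int CARD('d)) K \<and> finite Fs \<and> \<Union>Fs = frontier K \<and>
    (\<forall>e\<in>Fs. polytopal (int CARD('d) - 1) e \<and> outward_unit_normal K e (N e)) \<and>
    (\<forall>e\<in>Fs. \<forall>e'\<in>Fs. e \<noteq> e' \<longrightarrow> rel_interior e \<inter> rel_interior e' = {})"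

text \<open>For a set \<open>e\<close> in a hyperplane with unit normal \<open>n\<close>, the \<open>(d-1)\<close>-dimensional measure of
  \<open>e\<close> is the \<open>d\<close>-dimensional measure of the prism of height one over \<open>e\<close>, and the surface
  integral of \<open>g\<close> is the integral over that prism of \<open>g\<close> extended constantly along \<open>n\<close>
  (\<open>closest_point (affine hull e)\<close> is the orthogonal projection onto the hyperplane).
  Replacing \<open>n\<close> by \<open>-n\<close> does not change either quantity.\<close>

definition prism :: "real^'d \<Rightarrow> (real^'d) set \<Rightarrow> (real^'d) set" where
  "prism n e = {y + t *\<^sub>R n | y t. y \<in> e \<and> 0 \<le> t \<and> t \<le> 1}"

definition face_area :: "real^'d \<Rightarrow> (real^'d) set \<Rightarrow> real" where
  "face_area n e = measure lebesgue (prism n e)"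

definition face_integral :: "real^'d \<Rightarrow> (real^'d) set \<Rightarrow> (real^'d \<Rightarrow> real) \<Rightarrow> real" where
  "face_integral n e g = integral (prism n e) (\<lambda>x. g (closest_point (affine hull e) x))"

definition cell_volume :: "(real^'d) set \<Rightarrow> real" where
  "cell_volume K = measure lebesgue K"

definition cell_avg :: "(real^'d) set \<Rightarrow> (real^'d \<Rightarrow> 'v::euclidean_space) \<Rightarrow> 'v" where
  "cell_avg K u = integral K u /\<^sub>R cell_volume K"

section \<open>Mesh, data, quadrature\<close>

text \<open>A face is shared by two cells exactly when it belongs to the face sets of both. Face
  quadratures depend on the face only, so both cells use the same one. Quadrature points on
  the boundary of a cell are indexed by pairs \<open>(e, q)\<close>.

  \<^item> \<open>coord\<close>: numbers the \<open>d\<close> space coordinates inside \<open>{1, 2, 3}\<close>;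
  \<^item> \<open>cells\<close>, \<open>faces\<close>, \<open>normal\<close>: the mesh, the faces of each cell, \<open>n\<^bsub>K,e\<^esub>\<close>;
  \<^item> \<open>fnum e\<close>, \<open>fnode e q\<close>, \<open>fweight e q\<close>: \<open>Q\<^sub>e\<close>, nodes and weights of the face quadrature;
  \<^item> \<open>inum K\<close>, \<open>inode K \<alpha>\<close>, \<open>iweight K \<alpha>\<close>: the remaining nodes of the volume quadrature and
    their weights \<open>\<omega>\<^sup>\<circ>\<close>;
  \<^item> \<open>bweight K (e, q)\<close>: the volume quadrature weight \<open>\<omega>\<^bsub>K,\<nu>\<^esub>\<close> of a face point;
  \<^item> \<open>sol K\<close>: the polynomial \<open>U\<^sub>K\<close>; \<open>bdry e q\<close>: the prescribed exterior trace on boundary faces;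
  \<^item> \<open>speed_m\<close>, \<open>speed_p\<close>: \<open>a\<^sup>-\<^bsub>K,\<nu>\<^esub>\<close> and \<open>a\<^sup>+\<^bsub>K,\<nu>\<^esub>\<close>; \<open>tstep\<close>: the time step \<open>\<tau>\<close>.\<close>

record ('d::finite) dg_scheme =
  coord :: "'d \<Rightarrow> 3"
  cells :: "(real^'d) set set"
  faces :: "(real^'d) set \<Rightarrow> (real^'d) set set"
  normal :: "(real^'d) set \<Rightarrow> (real^'d) set \<Rightarrow> real^'d"
  fnum :: "(real^'d) set \<Rightarrow> nat"
  fnode :: "(real^'d) set \<Rightarrow> nat \<Rightarrow> real^'d"
  fweight :: "(real^'d) set \<Rightarrow> nat \<Rightarrow> real"
  inum :: "(real^'d) set \<Rightarrow> nat"
  inode :: "(real^'d) set \<Rightarrow> nat \<Rightarrow> real^'d"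
  iweight :: "(real^'d) set \<Rightarrow> nat \<Rightarrow> real"
  bweight :: "(real^'d) set \<Rightarrow> (real^'d) set \<times> nat \<Rightarrow> real"
  sol :: "(real^'d) set \<Rightarrow> real^'d \<Rightarrow> state"
  bdry :: "(real^'d) set \<Rightarrow> nat \<Rightarrow> state"
  speed_m :: "(real^'d) set \<Rightarrow> (real^'d) set \<times> nat \<Rightarrow> real"
  speed_p :: "(real^'d) set \<Rightarrow> (real^'d) set \<times> nat \<Rightarrow> real"
  tstep :: real

text \<open>For \<open>d = 2\<close> the two space coordinates are the first two of the three components of the
  velocity and magnetic field, i.e. \<open>(n\<^sub>1, n\<^sub>2)\<close> is identified with \<open>(n\<^sub>1, n\<^sub>2, 0)\<close>.\<close>

definition coordinate_numbering :: "('d::finite \<Rightarrow> 3) \<Rightarrow> bool" where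
  "coordinate_numbering \<iota> \<longleftrightarrow> inj \<iota> \<and> (CARD('d) = 2 \<longrightarrow> range \<iota> = {1, 2})"

definition emb :: "('d::finite \<Rightarrow> 3) \<Rightarrow> real^'d \<Rightarrow> real^3" where
  "emb \<iota> n = (\<Sum>i\<in>UNIV. (n $ i) *\<^sub>R axis (\<iota> i) 1)"

definition locally_div_free :: "('d::finite) dg_scheme \<Rightarrow> bool" where
  "locally_div_free D \<longleftrightarrow>
    (\<forall>K\<in>cells D. \<forall>x\<in>K.
      (\<Sum>i\<in>UNIV. frechet_derivative (\<lambda>y. mag (sol D K y) $ coord D i) (at x) (axis i 1)) = 0)"

text \<open>Conformity: faces of different cells are equal or do not overlap.\<close>

definition conforming_mesh :: "('d::finite) dg_scheme \<Rightarrow> bool" where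
  "conforming_mesh D \<longleftrightarrow>
    finite (cells D) \<and>
    (\<forall>K\<in>cells D. polytopal_cell K (faces D K) (normal D K)) \<and>
    (\<forall>K\<in>cells D. \<forall>K'\<in>cells D. K \<noteq> K' \<longrightarrow>
      interior K \<inter> interior K' = {} \<and>
      (\<forall>e\<in>faces D K. \<forall>e'\<in>faces D K'. e \<noteq> e' \<longrightarrow> rel_interior e \<inter> rel_interior e' = {}))"

definition bindex :: "('d::finite) dg_scheme \<Rightarrow> (real^'d) set \<Rightarrow> ((real^'d) set \<times> nat) set" where
  "bindex D K = (SIGMA e:faces D K. {1..fnum D e})"

definition bnode :: "('d::finite) dg_scheme \<Rightarrow> (real^'d) set \<times> nat \<Rightarrow> real^'d" where
  "bnode D \<nu> = fnode D (fst \<nu>) (snd \<nu>)"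

definition face_quadratures :: "nat \<Rightarrow> ('d::finite) dg_scheme \<Rightarrow> bool" where
  "face_quadratures k D \<longleftrightarrow>
    (\<forall>K\<in>cells D. \<forall>e\<in>faces D K.
      (\<forall>q\<in>{1..fnum D e}. fnode D e q \<in> e \<and> fweight D e q > 0) \<and>
      (\<Sum>q\<in>{1..fnum D e}. fweight D e q) = 1 \<and>
      (\<forall>g. poly_deg k g \<longrightarrow>
        face_integral (normal D K e) e g / face_area (normal D K e) e =
        (\<Sum>q\<in>{1..fnum D e}. fweight D e q * g (fnode D e q))))"

definition cell_quadratures :: "nat \<Rightarrow> ('d::finite) dg_scheme \<Rightarrow> bool" where
  "cell_quadratures k D \<longleftrightarrow>
    (\<forall>K\<in>cells D.
      (\<forall>\<alpha>\<in>{1..inum D K}. inode D K \<alpha> \<in> K \<and> iweight D K \<alpha> > 0) \<and>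
      (\<forall>\<nu>\<in>bindex D K. bweight D K \<nu> > 0) \<and>
      (\<Sum>\<alpha>\<in>{1..inum D K}. iweight D K \<alpha>) + (\<Sum>\<nu>\<in>bindex D K. bweight D K \<nu>) = 1 \<and>
      (\<forall>g. poly_deg k g \<longrightarrow>
        cell_avg K g =
        (\<Sum>\<alpha>\<in>{1..inum D K}. iweight D K \<alpha> * g (inode D K \<alpha>)) +
        (\<Sum>\<nu>\<in>bindex D K. bweight D K \<nu> * g (bnode D \<nu>))))"

text \<open>In a conforming mesh \<open>neighbours D K e\<close> has at most one element; it is empty exactly when
  \<open>e\<close> lies on the domain boundary.\<close>

definition neighbours ::
  "('d::finite) dg_scheme \<Rightarrow> (real^'d) set \<Rightarrow> (real^'d) set \<Rightarrow> (real^'d) set set" where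
  "neighbours D K e = {K' \<in> cells D. K' \<noteq> K \<and> e \<in> faces D K'}"

definition trace_in :: "('d::finite) dg_scheme \<Rightarrow> (real^'d) set \<Rightarrow> (real^'d) set \<times> nat \<Rightarrow> state" where
  "trace_in D K \<nu> = sol D K (bnode D \<nu>)"

definition trace_ext :: "('d::finite) dg_scheme \<Rightarrow> (real^'d) set \<Rightarrow> (real^'d) set \<times> nat \<Rightarrow> state" where
  "trace_ext D K \<nu> =
    (if neighbours D K (fst \<nu>) = {} then bdry D (fst \<nu>) (snd \<nu>)
     else sol D (SOME K'. K' \<in> neighbours D K (fst \<nu>)) (bnode D \<nu>))"

definition states_admissible :: "('d::finite) dg_scheme \<Rightarrow> bool" where
  "states_admissible D \<longleftrightarrow>
    (\<forall>K\<in>cells D.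
      (\<forall>\<alpha>\<in>{1..inum D K}. sol D K (inode D K \<alpha>) \<in> admissible) \<and>
      (\<forall>\<nu>\<in>bindex D K. trace_in D K \<nu> \<in> admissible) \<and>
      (\<forall>\<nu>\<in>bindex D K. neighbours D K (fst \<nu>) = {} \<longrightarrow> bdry D (fst \<nu>) (snd \<nu>) \<in> admissible))"

text \<open>Both cells adjacent to a face share one pair of wave speeds: the orientation of the
  neighbour sees \<open>(-a\<^sup>+, -a\<^sup>-)\<close>.\<close>

definition wave_speeds :: "('d::finite) dg_scheme \<Rightarrow> bool" where
  "wave_speeds D \<longleftrightarrow>
    (\<forall>K\<in>cells D. \<forall>\<nu>\<in>bindex D K.
      speed_m D K \<nu> < 0 \<and> 0 < speed_p D K \<nu> \<and>
      (\<forall>K'\<in>neighbours D K (fst \<nu>).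
        speed_m D K' \<nu> = - speed_p D K \<nu> \<and> speed_p D K' \<nu> = - speed_m D K \<nu>))"

section \<open>Cell coefficients and the scheme\<close>

definition lam :: "('d::finite) dg_scheme \<Rightarrow> (real^'d) set \<Rightarrow> real" where
  "lam D K = tstep D / cell_volume K"

definition bcoef :: "('d::finite) dg_scheme \<Rightarrow> (real^'d) set \<Rightarrow> (real^'d) set \<times> nat \<Rightarrow> real" where
  "bcoef D K \<nu> = face_area (normal D K (fst \<nu>)) (fst \<nu>) * fweight D (fst \<nu>) (snd \<nu>)"

definition bnormal :: "('d::finite) dg_scheme \<Rightarrow> (real^'d) set \<Rightarrow> (real^'d) set \<times> nat \<Rightarrow> real^3" where
  "bnormal D K \<nu> = emb (coord D) (normal D K (fst \<nu>))"

text \<open>\<open>at_point D K \<nu> \<Phi>\<close> evaluates an interface quantity with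
  \<open>(U\<^sup>-, U\<^sup>+, n) = (U\<^bsub>K,\<nu>\<^esub>, U\<^sup>e\<^sup>x\<^sup>t\<^bsub>K,\<nu>\<^esub>, n\<^bsub>K,\<nu>\<^esub>)\<close> and the wave speeds chosen there.\<close>

definition at_point ::
  "('d::finite) dg_scheme \<Rightarrow> (real^'d) set \<Rightarrow> (real^'d) set \<times> nat \<Rightarrow>
    (state \<Rightarrow> state \<Rightarrow> real^3 \<Rightarrow> real \<Rightarrow> real \<Rightarrow> 'v) \<Rightarrow> 'v" where
  "at_point D K \<nu> \<Phi> =
    \<Phi> (trace_in D K \<nu>) (trace_ext D K \<nu>) (bnormal D K \<nu>) (speed_m D K \<nu>) (speed_p D K \<nu>)"

definition perimeter :: "('d::finite) dg_scheme \<Rightarrow> (real^'d) set \<Rightarrow> real" where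
  "perimeter D K = (\<Sum>\<nu>\<in>bindex D K. bcoef D K \<nu>)"

definition alpha_PP ::
  "real \<Rightarrow> ('d::finite) dg_scheme \<Rightarrow> (real^'d) set \<Rightarrow> (real^'d) set \<times> nat \<Rightarrow> real" where
  "alpha_PP \<gamma> D K \<nu> =
    max (vel (trace_in D K \<nu>) \<bullet> bnormal D K \<nu>)
        (1 / perimeter D K *
          (\<Sum>\<mu>\<in>bindex D K. bcoef D K \<mu> *
            ((bnormal D K \<nu> - bnormal D K \<mu>) \<bullet> roe_vel (trace_in D K \<nu>) (trace_in D K \<mu>))))
    + Cspeed \<gamma> (trace_in D K \<nu>) (bnormal D K \<nu>)
    + 2 / perimeter D K *
        (\<Sum>\<mu>\<in>bindex D K. bcoef D K \<mu> * mag_jump (trace_in D K \<nu>) (trace_in D K \<mu>))"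

definition beta :: "('d::finite) dg_scheme \<Rightarrow> (real^'d) set \<Rightarrow> (real^'d) set \<times> nat \<Rightarrow> real" where
  "beta D K \<nu> = bweight D K \<nu> / (lam D K * bcoef D K \<nu>) + speed_m D K \<nu>"

definition DK :: "('d::finite) dg_scheme \<Rightarrow> (real^'d) set \<Rightarrow> real" where
  "DK D K = (\<Sum>\<nu>\<in>bindex D K. bcoef D K \<nu> * beta D K \<nu>)"

definition Xi :: "real \<Rightarrow> ('d::finite) dg_scheme \<Rightarrow> (real^'d) set \<Rightarrow> state" where
  "Xi \<gamma> D K =
    (\<Sum>\<nu>\<in>bindex D K. bcoef D K \<nu> *\<^sub>R
      (beta D K \<nu> *\<^sub>R trace_in D K \<nu> - flux_dir \<gamma> (bnormal D K \<nu>) (trace_in D K \<nu>))) /\<^sub>R DK D K"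

definition Xi_entropy :: "real \<Rightarrow> (real \<Rightarrow> real) \<Rightarrow> ('d::finite) dg_scheme \<Rightarrow> (real^'d) set \<Rightarrow> real" where
  "Xi_entropy \<gamma> f D K =
    (\<Sum>\<nu>\<in>bindex D K. bcoef D K \<nu> *
      (beta D K \<nu> * eta \<gamma> f (trace_in D K \<nu>) - qn \<gamma> f (bnormal D K \<nu>) (trace_in D K \<nu>))) / DK D K"

definition cell_update :: "real \<Rightarrow> ('d::finite) dg_scheme \<Rightarrow> (real^'d) set \<Rightarrow> state" where
  "cell_update \<gamma> D K =
    cell_avg K (sol D K) -
    lam D K *\<^sub>R (\<Sum>\<nu>\<in>bindex D K. bcoef D K \<nu> *\<^sub>R at_point D K \<nu> (num_flux \<gamma>))"

definition entropy_budget ::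
  "real \<Rightarrow> (real \<Rightarrow> real) \<Rightarrow> ('d::finite) dg_scheme \<Rightarrow> (real^'d) set \<Rightarrow> real" where
  "entropy_budget \<gamma> f D K =
    (\<Sum>\<alpha>\<in>{1..inum D K}. iweight D K \<alpha> * eta \<gamma> f (sol D K (inode D K \<alpha>))) +
    (\<Sum>\<nu>\<in>bindex D K. bweight D K \<nu> * eta \<gamma> f (trace_in D K \<nu>)) -
    lam D K * (\<Sum>\<nu>\<in>bindex D K. bcoef D K \<nu> * at_point D K \<nu> (hll_qflux \<gamma> f))"

end

theory Submission
  imports Defs
begin

text \<open>
  Writing every flux as \<open>F(U) + a\<^sup>- (T\<^sup>- - U)\<close> shows that the updated cell average is a convex combination
  of the interior nodal values, of the states \<open>T\<^sup>-\<close> with weights \<open>- \<lambda> c a\<^sup>-\<close>, and of \<open>\<Xi>\<close> with weight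
  \<open>\<lambda> D\<^sub>K\<close>. The same identity holds for the numerical entropy fluxes, so the claim is Jensen's inequality
  for the convex functions \<open>\<eta>\<^sub>r\<close>, once \<open>T\<^sup>-\<close> and \<open>\<Xi>\<close> are known to be admissible.

  Admissibility is linear in the state after introducing free auxiliary variables \<open>v, b\<close> (geometric
  quasilinearization): \<open>U\<close> is admissible iff its density is positive and
  \<open>U \<cdot> (|v|\<^sup>2/2, -v, -b, 1) + |b|\<^sup>2/2 > 0\<close> for all \<open>v, b\<close>. In the resulting estimate for \<open>T\<^sup>-\<close> the term
  \<open>\<delta>B (v \<cdot> b)\<close> is cancelled by the source; for \<open>\<Xi>\<close> the corresponding sum vanishes because the discrete fluxes
  of the constants and of the locally divergence-free field through the boundary of the cell are zero.

  The latter is the divergence theorem on a polytopal cell. Almost everywhere,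
  \<open>1\<^sub>K(x) - 1\<^sub>K(x + tu)\<close> is the signed sum of the indicators of the oblique prisms swept out by the faces
  under the translations by \<open>-su\<close>, \<open>0 \<le> s \<le> t\<close>. Integrating a function against this identity, dividing by
  \<open>t\<close> and letting \<open>t \<rightarrow> 0\<close> gives the theorem.
\<close>

section \<open>Geometric quasilinearization\<close>

text \<open>Positivity of \<open>gqlQ v b\<close> is needed for all \<open>v\<close> and
  \<open>b\<close>, and this shapes the first half. In a single flux the term (v . n) |B - b|^2 / 2
  is cubic in the free variables, so no speed times the quadratic \<open>gqlQ\<close> dominates it.
  Only differences of it between two states can be controlled: replacing v by the density-weighted
  average \<open>roe_vel\<close> leaves an error that the square-root weights make quadratic, at the
  price of \<open>mag_jump\<close>. Across an interface the two traces form such a pair. Within a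
  cell the closure relation sum c n = 0 creates the pairs, by comparing every boundary point with
  every other; the averages in \<open>alpha_PP\<close> come from this.

  In the second half cells and faces need not be convex, and surface integrals are integrals over
  right prisms of height one. Oblique prisms suit this definition because they are affine images of
  the right ones. The points on lines that meet the relative boundary of a face form a null set, so
  no decomposition of the cell has to be matched along common facets.\<close>

lemma dens_simps [simp]:
  "dens (U + V) = dens U + dens V" "dens (U - V) = dens U - dens V" "dens (c *\<^sub>R U) = c * dens U"
  by (simp_all add: dens_def)

lemma mom_simps [simp]:
  "mom (U + V) = mom U + mom V" "mom (U - V) = mom U - mom V" "mom (c *\<^sub>R U) = c *\<^sub>R mom U"
  by (simp_all add: mom_def)

lemma mag_simps [simp]:
  "mag (U + V) = mag U + mag V" "mag (U - V) = mag U - mag V" "mag (c *\<^sub>R U) = c *\<^sub>R mag U"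
  by (simp_all add: mag_def)

lemma ener_simps [simp]:
  "ener (U + V) = ener U + ener V" "ener (U - V) = ener U - ener V" "ener (c *\<^sub>R U) = c * ener U"
  by (simp_all add: ener_def)

lemma linear_dens: "linear dens"
  by (rule linearI) simp_all

text \<open>\<open>gql v b U\<close> is the inner product of \<open>U\<close> with \<open>(|v|\<^sup>2/2, -v, -b, 1)\<close>.\<close>

definition gql :: "real^3 \<Rightarrow> real^3 \<Rightarrow> state \<Rightarrow> real" where
  "gql v b U = dens U * (norm v)\<^sup>2 / 2 - mom U \<bullet> v - mag U \<bullet> b + ener U"

text \<open>The constant stays outside \<open>gql\<close> so that \<open>gql\<close> is linear and
  can be applied to fluxes and sources, which are not states.\<close>

definition gqlQ :: "real^3 \<Rightarrow> real^3 \<Rightarrow> state \<Rightarrow> real" where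
  "gqlQ v b U = gql v b U + (norm b)\<^sup>2 / 2"

lemma linear_gql: "linear (gql v b)"
  by (rule linearI) (simp_all add: gql_def algebra_simps add_divide_distrib)

lemma norm_diff_power2:
  fixes x y :: "'a::real_inner"
  shows "(norm (x - y))\<^sup>2 = (norm x)\<^sup>2 - 2 * (x \<bullet> y) + (norm y)\<^sup>2"
  by (simp only: power2_norm_eq_inner inner_diff_left inner_diff_right inner_commute[of y x])

text \<open>Completing both squares: over all \<open>v\<close> and \<open>b\<close> the minimum is
  attained at the velocity and field of the state itself, and its value is the internal energy. For
  positive density, positivity for all \<open>v\<close>, \<open>b\<close> is therefore the same as
  admissibility.\<close>

lemma gqlQ_eq:
  assumes "dens U > 0"
  shows "gqlQ v b U =
    dens U * (norm (vel U - v))\<^sup>2 / 2 + (norm (mag U - b))\<^sup>2 / 2 + int_energy U"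
proof -
  have m: "mom U = dens U *\<^sub>R vel U" using assms by (simp add: vel_def)
  have m2: "(norm (mom U))\<^sup>2 / (2 * dens U) = dens U * (norm (vel U))\<^sup>2 / 2"
    using assms unfolding m by (simp add: power2_eq_square)
  have mv: "mom U \<bullet> v = dens U * (vel U \<bullet> v)"
    using m by (metis inner_scaleR_left)
  show ?thesis
    unfolding gqlQ_def gql_def int_energy_def m2 mv norm_diff_power2
    by (simp add: field_simps)
qed

lemma gqlQ_pos:
  assumes "U \<in> admissible"
  shows "gqlQ v b U > 0"
  using assms by (auto simp: admissible_def gqlQ_eq intro!: add_nonneg_pos)

lemma int_energy_le_gqlQ:
  assumes "dens U > 0"
  shows "int_energy U \<le> gqlQ v b U"
  using assms by (simp add: gqlQ_eq)

lemma int_energy_eq_gqlQ: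
  assumes "dens U > 0"
  shows "int_energy U = gqlQ (vel U) (mag U) U"
  using assms by (simp add: gqlQ_eq)

lemma admissible_iff_gqlQ:
  "U \<in> admissible \<longleftrightarrow> dens U > 0 \<and> (\<forall>v b. gqlQ v b U > 0)"
  using gqlQ_pos int_energy_eq_gqlQ unfolding admissible_def by fastforce

lemma dens_flux_dir: "dens (flux_dir \<gamma> n U) = dens U * (vel U \<bullet> n)"
  unfolding flux_dir_def linear_sum[OF linear_dens]
  by (simp add: flux_def inner_vec_def sum_distrib_left dens_def algebra_simps)

lemma gql_flux_dir:
  "gql v b (flux_dir \<gamma> n U) =
    (vel U \<bullet> n) * (dens U * (norm v)\<^sup>2 / 2 - mom U \<bullet> v - mag U \<bullet> b + ener U + ptot \<gamma> U)
    + (mag U \<bullet> n) * (mag U \<bullet> v + vel U \<bullet> b - vel U \<bullet> mag U) - ptot \<gamma> U * (v \<bullet> n)"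
proof -
  define P R where "P = dens U * (norm v)\<^sup>2 / 2 - mom U \<bullet> v - mag U \<bullet> b + ener U + ptot \<gamma> U"
    and "R = mag U \<bullet> v + vel U \<bullet> b - vel U \<bullet> mag U"
  have c: "gql v b (flux \<gamma> i U) = vel U $ i * P + mag U $ i * R - ptot \<gamma> U * v $ i" for i
    by (simp add: gql_def flux_def dens_def[of "(_,_)"] mom_def[of "(_,_)"] mag_def[of "(_,_)"]
        ener_def[of "(_,_)"] inner_diff_left inner_add_left inner_axis' P_def R_def algebra_simps)
  show ?thesis
    unfolding flux_dir_def linear_sum[OF linear_gql] linear_scale[OF linear_gql] c
      P_def[symmetric] R_def[symmetric]
    by (simp add: inner_vec_def sum_distrib_left sum_distrib_right algebra_simps
        sum.distrib sum_subtractf)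
qed

text \<open>The regrouping isolates - v . b, the only part that is not a product of deviations.
  Multiplied by \<open>dB\<close> it cancels the difference of the terms (B . n)(v . b) of the two
  fluxes.\<close>

lemma gql_source:
  "gql v b (source U) = (vel U - v) \<bullet> (mag U - b) - v \<bullet> b"
  by (simp add: gql_def source_def dens_def[of "(_,_)"] mom_def[of "(_,_)"] mag_def[of "(_,_)"]
        ener_def[of "(_,_)"] inner_diff inner_commute)

text \<open>Sorted by how each group is treated later: two transport terms, whose weights are
  nonnegative on admissible states and add up to \<open>gqlQ\<close>; a bracket each of whose terms
  contains a deviation and which \<open>Cspeed\<close> bounds; and two last terms that cancel
  between states.\<close>

lemma gql_flux_dir_eq:
  "gql v b (flux_dir \<gamma> n U) =
    (vel U \<bullet> n) * (gqlQ v b U - (norm (mag U - b))\<^sup>2 / 2) + (v \<bullet> n) * (norm (mag U - b))\<^sup>2 / 2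
    + (pres \<gamma> U * ((vel U - v) \<bullet> n) + ((vel U - v) \<bullet> n) * (mag U \<bullet> (mag U - b))
       - (mag U \<bullet> n) * ((vel U - v) \<bullet> (mag U - b)))
    - (v \<bullet> n) * (norm b)\<^sup>2 / 2 + (mag U \<bullet> n) * (v \<bullet> b)"
proof -
  have P: "dens U * (norm v)\<^sup>2 / 2 - mom U \<bullet> v - mag U \<bullet> b + ener U = gqlQ v b U - (norm b)\<^sup>2 / 2"
    by (simp add: gqlQ_def gql_def)
  show ?thesis
    unfolding gql_flux_dir ptot_def P norm_diff_power2 inner_diff_left inner_diff_right
      inner_commute[of v "mag U"] dot_square_norm
    by (simp add: field_simps)
qed

text \<open>A root of the characteristic polynomial of a symmetric 2 by 2 matrix that lies above
  both diagonal entries is the largest eigenvalue. The defect is then bounded below by the square of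
  p |x| - q |y|.\<close>

lemma quadratic_form_le:
  fixes x y a11 a12 a22 l :: real
  assumes "l \<ge> a11" "l \<ge> a22" "(l - a11) * (l - a22) = a12\<^sup>2"
  shows "a11 * x\<^sup>2 + 2 * a12 * x * y + a22 * y\<^sup>2 \<le> l * (x\<^sup>2 + y\<^sup>2)"
proof -
  define p where "p = sqrt (l - a11)"
  define q where "q = sqrt (l - a22)"
  have p2: "p\<^sup>2 = l - a11" "q\<^sup>2 = l - a22" using assms by (auto simp: p_def q_def)
  have pq: "\<bar>a12\<bar> = p * q"
    using assms(3) p2 by (metis p_def q_def real_sqrt_abs real_sqrt_mult)
  have "2 * a12 * x * y \<le> 2 * \<bar>a12\<bar> * \<bar>x\<bar> * \<bar>y\<bar>"
    using abs_ge_self[of "a12 * x * y"] by (simp add: abs_mult mult.assoc)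
  also have "\<dots> \<le> (p * \<bar>x\<bar>)\<^sup>2 + (q * \<bar>y\<bar>)\<^sup>2"
    using sum_squares_bound[of "p * \<bar>x\<bar>" "q * \<bar>y\<bar>"] by (simp add: pq mult_ac)
  finally show ?thesis by (simp add: power_mult_distrib p2 algebra_simps)
qed

text \<open>L is the larger root of L^2 - (c^2 + |B|^2) L + c^2 (n . B)^2 = 0, the squared fast
  magnetoacoustic speed for sound speed c and unit density. Here x, y, z stand for scaled velocity,
  magnetic and thermal deviations. Cauchy-Schwarz in x reduces the claim to a 2 by 2 eigenvalue
  problem in the tangential part of y and in z.\<close>

lemma fast_speed_bound:
  fixes n x y B :: "real^3" and c z :: real
  assumes n: "norm n = 1"
    and L: "L = (c\<^sup>2 + (norm B)\<^sup>2 + sqrt ((c\<^sup>2 + (norm B)\<^sup>2)\<^sup>2 - 4 * (c\<^sup>2 * (n \<bullet> B)\<^sup>2))) / 2"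
  shows "\<bar>c * z * (x \<bullet> n) + (x \<bullet> n) * (B \<bullet> y) - (B \<bullet> n) * (x \<bullet> y)\<bar>
    \<le> sqrt L * ((norm x)\<^sup>2 + (norm y)\<^sup>2 + z\<^sup>2) / 2"
proof -
  define \<beta> where "\<beta> = B \<bullet> n"
  define yn where "yn = y \<bullet> n"
  define Bt where "Bt = B - \<beta> *\<^sub>R n"
  define yt where "yt = y - yn *\<^sub>R n"
  have nn: "n \<bullet> n = 1" using n by (simp add: norm_eq_1)
  have tn: "n \<bullet> Bt = 0" "n \<bullet> yt = 0" "Bt \<bullet> n = 0" "yt \<bullet> n = 0"
    by (simp_all add: Bt_def yt_def inner_diff nn \<beta>_def yn_def inner_commute)
  have Bd: "B = \<beta> *\<^sub>R n + Bt" and yd: "y = yn *\<^sub>R n + yt" by (simp_all add: Bt_def yt_def)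
  have B2: "(norm B)\<^sup>2 = \<beta>\<^sup>2 + (norm Bt)\<^sup>2" and y2: "(norm y)\<^sup>2 = yn\<^sup>2 + (norm yt)\<^sup>2"
    unfolding power2_norm_eq_inner by (subst Bd yd, simp add: inner_add tn nn power2_eq_square)+
  define T where "T = c\<^sup>2 + (norm B)\<^sup>2"
  \<comment> \<open>Written as a sum of squares, the discriminant dominates the square of |B|^2 -
    c^2, which places L above both |B|^2 and c^2.\<close>
  have dsc: "T\<^sup>2 - 4 * (c\<^sup>2 * \<beta>\<^sup>2) = (\<beta>\<^sup>2 + (norm Bt)\<^sup>2 - c\<^sup>2)\<^sup>2 + 4 * c\<^sup>2 * (norm Bt)\<^sup>2"
    unfolding T_def B2 by (simp add: power2_eq_square algebra_simps)
  define R where "R = sqrt (T\<^sup>2 - 4 * (c\<^sup>2 * \<beta>\<^sup>2))"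
  have R2: "R\<^sup>2 = (\<beta>\<^sup>2 + (norm Bt)\<^sup>2 - c\<^sup>2)\<^sup>2 + 4 * c\<^sup>2 * (norm Bt)\<^sup>2" "R \<ge> 0"
    unfolding R_def dsc by (simp_all)
  have RL: "2 * L = T + R" using L by (simp add: T_def R_def \<beta>_def inner_commute)
  have Rge: "R \<ge> \<bar>\<beta>\<^sup>2 + (norm Bt)\<^sup>2 - c\<^sup>2\<bar>"
    by (rule power2_le_imp_le) (simp_all add: R2)
  have L1: "L \<ge> \<beta>\<^sup>2 + (norm Bt)\<^sup>2" and L2: "L \<ge> c\<^sup>2"
    using Rge RL unfolding T_def B2 by linarith+
  have L3: "(L - (\<beta>\<^sup>2 + (norm Bt)\<^sup>2)) * (L - c\<^sup>2) = (c * norm Bt)\<^sup>2"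
  proof -
    have l: "L = (c\<^sup>2 + (\<beta>\<^sup>2 + (norm Bt)\<^sup>2) + R) / 2" using RL unfolding T_def B2 by simp
    have "4 * ((L - s) * (L - c\<^sup>2)) = R\<^sup>2 - (s - c\<^sup>2)\<^sup>2" if "L = (c\<^sup>2 + s + R) / 2" for s
      unfolding that by (simp add: power2_eq_square field_simps)
    from this[OF l] show ?thesis by (simp add: R2 power_mult_distrib)
  qed
  have Lnn: "L \<ge> 0" using L2 by (meson order_trans zero_le_power2)
  \<comment> \<open>The product of the normal parts of B and y occurs in both magnetic terms and
    cancels, so only the tangential part of y is left.\<close>
  define g where "g = (c * z + Bt \<bullet> yt) *\<^sub>R n - \<beta> *\<^sub>R yt"
  have eq: "c * z * (x \<bullet> n) + (x \<bullet> n) * (B \<bullet> y) - (B \<bullet> n) * (x \<bullet> y) = x \<bullet> g"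
  proof -
    have By: "B \<bullet> y = \<beta> * yn + Bt \<bullet> yt"
      using tn nn by (simp add: Bt_def yt_def inner_diff \<beta>_def yn_def inner_commute)
    have xy: "x \<bullet> y = yn * (x \<bullet> n) + x \<bullet> yt"
      by (simp add: yt_def inner_diff)
    show ?thesis
      unfolding \<beta>_def[symmetric] By xy g_def inner_diff_right inner_scaleR_right
      by (simp add: algebra_simps)
  qed
  have cs: "\<bar>x \<bullet> g\<bar> \<le> norm x * norm g" by (rule Cauchy_Schwarz_ineq2)
  have g2: "(norm g)\<^sup>2 \<le> L * ((norm y)\<^sup>2 + z\<^sup>2)"
  proof -
    have "\<bar>c * z + Bt \<bullet> yt\<bar> \<le> \<bar>c\<bar> * \<bar>z\<bar> + norm Bt * norm yt"
      using Cauchy_Schwarz_ineq2[of Bt yt] abs_triangle_ineq[of "c * z" "Bt \<bullet> yt"]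
      by (simp add: abs_mult)
    then have le: "(c * z + Bt \<bullet> yt)\<^sup>2 \<le> (\<bar>c\<bar> * \<bar>z\<bar> + norm Bt * norm yt)\<^sup>2"
      by (metis abs_ge_zero power2_abs power_mono)
    have "(norm g)\<^sup>2 = (c * z + Bt \<bullet> yt)\<^sup>2 + \<beta>\<^sup>2 * (norm yt)\<^sup>2"
      unfolding power2_norm_eq_inner unfolding power2_eq_square
      unfolding g_def inner_diff_left inner_diff_right inner_scaleR_left
        inner_scaleR_right tn nn by (simp del: dot_square_norm)
    also have "\<dots> \<le> (\<bar>c\<bar> * \<bar>z\<bar> + norm Bt * norm yt)\<^sup>2 + \<beta>\<^sup>2 * (norm yt)\<^sup>2"
      using le by simp
    also have "\<dots> =
      (\<beta>\<^sup>2 + (norm Bt)\<^sup>2) * (norm yt)\<^sup>2 + 2 * (\<bar>c\<bar> * norm Bt) * norm yt * \<bar>z\<bar> + c\<^sup>2 * \<bar>z\<bar>\<^sup>2"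
      unfolding power2_sum power_mult_distrib power2_abs by algebra
    \<comment> \<open>The matrix has diagonal entries |B|^2 and c^2 and off-diagonal entry |c| |Bt|;
      \<open>L3\<close> is its characteristic equation at L.\<close>
    also have "\<dots> \<le> L * ((norm yt)\<^sup>2 + \<bar>z\<bar>\<^sup>2)"
      by (rule quadratic_form_le) (use L1 L2 L3 in \<open>simp_all only: power_mult_distrib power2_abs\<close>)
    also have "\<dots> \<le> L * ((norm y)\<^sup>2 + z\<^sup>2)"
      using Lnn by (intro mult_left_mono) (auto simp: y2)
    finally show ?thesis by simp
  qed
  have bd: "norm x * norm g \<le> sqrt L * ((norm x)\<^sup>2 + (norm y)\<^sup>2 + z\<^sup>2) / 2"
  proof -
    define h where "h = sqrt ((norm y)\<^sup>2 + z\<^sup>2)"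
    have h2: "h\<^sup>2 = (norm y)\<^sup>2 + z\<^sup>2" by (simp add: h_def)
    have "norm g \<le> sqrt L * h"
      using real_sqrt_le_mono[OF g2] by (simp add: h_def real_sqrt_mult)
    then have "norm x * norm g \<le> sqrt L * (norm x * h)"
      by (metis mult.left_commute mult_left_mono norm_ge_zero)
    moreover have "norm x * h \<le> ((norm x)\<^sup>2 + h\<^sup>2) / 2"
      using sum_squares_bound[of "norm x" h] by simp
    then have "sqrt L * (norm x * h) \<le> sqrt L * (((norm x)\<^sup>2 + h\<^sup>2) / 2)"
      using Lnn by (intro mult_left_mono) auto
    ultimately show ?thesis by (simp add: h2 add.assoc)
  qed
  show ?thesis
    unfolding eq using cs bd by (rule order_trans)
qed

section \<open>Flux bounds in terms of the splitting speed\<close>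

lemma Cs2_nonneg: "\<gamma> > 1 \<Longrightarrow> U \<in> admissible \<Longrightarrow> Cs2 \<gamma> U \<ge> 0"
  by (auto simp: Cs2_def pres_def admissible_def intro!: divide_nonneg_pos mult_nonneg_nonneg)

text \<open>With s = sqrt \<rho>, scale the velocity deviation by s and the field by 1 / s, and let
  z^2 be twice the internal energy; then \<open>gqlQ\<close> is half the sum of the three squares.
  Writing the pressure as c z s forces c^2 = (\<gamma> - 1) p / (2 \<rho>), which is the origin of
  \<open>Cs2\<close>.\<close>

lemma gql_flux_perturbation_le:
  assumes g: "\<gamma> > 1" and U: "U \<in> admissible" and n: "norm n = 1"
  shows "\<bar>pres \<gamma> U * ((vel U - v) \<bullet> n) + ((vel U - v) \<bullet> n) * (mag U \<bullet> (mag U - b))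
       - (mag U \<bullet> n) * ((vel U - v) \<bullet> (mag U - b))\<bar> \<le> Cspeed \<gamma> U n * gqlQ v b U"
proof -
  have r: "dens U > 0" and e: "int_energy U > 0" using U by (auto simp: admissible_def)
  define s where "s = sqrt (dens U)"
  have s: "s > 0" "s\<^sup>2 = dens U" using r by (auto simp: s_def)
  define c where "c = sqrt (Cs2 \<gamma> U)"
  define z where "z = sqrt (2 * int_energy U)"
  have c2: "c\<^sup>2 = Cs2 \<gamma> U" using Cs2_nonneg[OF g U] by (simp add: c_def)
  have z2: "z\<^sup>2 = 2 * int_energy U" using e by (simp add: z_def)
  have csz: "c * z * s = pres \<gamma> U"
  proof (rule power2_eq_imp_eq)
    show "(c * z * s)\<^sup>2 = (pres \<gamma> U)\<^sup>2"
      unfolding power_mult_distrib c2 z2 s Cs2_def using r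
      by (simp add: pres_def power2_eq_square field_simps)
    show "0 \<le> c * z * s"
      using Cs2_nonneg[OF g U] e s by (simp add: c_def z_def)
    show "0 \<le> pres \<gamma> U" using g e by (simp add: pres_def)
  qed
  have nB: "(norm (mag U /\<^sub>R s))\<^sup>2 = (norm (mag U))\<^sup>2 / dens U"
    using s by (simp add: power_mult_distrib power_inverse field_simps)
  have xB: "Cs2 \<gamma> U * (n \<bullet> (mag U /\<^sub>R s))\<^sup>2 = Cs2 \<gamma> U * (n \<bullet> mag U)\<^sup>2 / dens U"
    unfolding inner_scaleR_right power_mult_distrib power_inverse s by (simp add: field_simps)
  define L where "L = (c\<^sup>2 + (norm (mag U /\<^sub>R s))\<^sup>2 + sqrt ((c\<^sup>2 + (norm (mag U /\<^sub>R s))\<^sup>2)\<^sup>2 -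
    4 * (c\<^sup>2 * (n \<bullet> (mag U /\<^sub>R s))\<^sup>2))) / 2"
  have L: "sqrt L = Cspeed \<gamma> U n"
    unfolding L_def Cspeed_def nB c2 xB by (simp add: real_sqrt_divide)
  have "\<bar>c * z * ((s *\<^sub>R (vel U - v)) \<bullet> n) + ((s *\<^sub>R (vel U - v)) \<bullet> n) * ((mag U /\<^sub>R s) \<bullet> (mag U - b))
      - ((mag U /\<^sub>R s) \<bullet> n) * ((s *\<^sub>R (vel U - v)) \<bullet> (mag U - b))\<bar>
    \<le> sqrt L * ((norm (s *\<^sub>R (vel U - v)))\<^sup>2 + (norm (mag U - b))\<^sup>2 + z\<^sup>2) / 2"
    by (rule fast_speed_bound[OF n L_def])
  moreover have "((norm (s *\<^sub>R (vel U - v)))\<^sup>2 + (norm (mag U - b))\<^sup>2 + z\<^sup>2) / 2 = gqlQ v b U"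
    unfolding gqlQ_eq[OF r] z2 norm_scaleR power_mult_distrib power2_abs s by simp
  moreover have "c * z * ((s *\<^sub>R (vel U - v)) \<bullet> n) + ((s *\<^sub>R (vel U - v)) \<bullet> n) * ((mag U /\<^sub>R s) \<bullet> (mag U - b))
      - ((mag U /\<^sub>R s) \<bullet> n) * ((s *\<^sub>R (vel U - v)) \<bullet> (mag U - b)) =
      pres \<gamma> U * ((vel U - v) \<bullet> n) + ((vel U - v) \<bullet> n) * (mag U \<bullet> (mag U - b))
       - (mag U \<bullet> n) * ((vel U - v) \<bullet> (mag U - b))"
    unfolding inner_scaleR_left csz[symmetric] using s(1) by (simp add: field_simps)
  ultimately show ?thesis unfolding L by simp
qed

lemma gql_flux_bounds:
  assumes "\<gamma> > 1" "U \<in> admissible" "norm n = 1"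
  shows "gql v b (flux_dir \<gamma> n U) \<le>
      (vel U \<bullet> n) * (gqlQ v b U - (norm (mag U - b))\<^sup>2 / 2) + (v \<bullet> n) * (norm (mag U - b))\<^sup>2 / 2
      + Cspeed \<gamma> U n * gqlQ v b U - (v \<bullet> n) * (norm b)\<^sup>2 / 2 + (mag U \<bullet> n) * (v \<bullet> b)"
    and "gql v b (flux_dir \<gamma> n U) \<ge>
      (vel U \<bullet> n) * (gqlQ v b U - (norm (mag U - b))\<^sup>2 / 2) + (v \<bullet> n) * (norm (mag U - b))\<^sup>2 / 2
      - Cspeed \<gamma> U n * gqlQ v b U - (v \<bullet> n) * (norm b)\<^sup>2 / 2 + (mag U \<bullet> n) * (v \<bullet> b)"
  using gql_flux_perturbation_le[OF assms, of v b] unfolding gql_flux_dir_eq by linarith+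

lemma gqlQ_ge_quadratic:
  assumes "U \<in> admissible"
  shows "dens U * (norm (vel U - v))\<^sup>2 / 2 + (norm (mag U - b))\<^sup>2 / 2 \<le> gqlQ v b U"
  using assms by (auto simp: gqlQ_eq admissible_def)

lemma mag_jump_nonneg: "dens U \<ge> 0 \<Longrightarrow> dens V \<ge> 0 \<Longrightarrow> mag_jump U V \<ge> 0"
  by (simp add: mag_jump_def)

text \<open>Read off from the bound of an absolute value by \<open>Cspeed\<close> times a positive
  number, without inspecting the nested roots.\<close>

lemma Cspeed_nonneg:
  assumes "\<gamma> > 1" "U \<in> admissible" and n: "norm n = 1"
  shows "Cspeed \<gamma> U n \<ge> 0"
proof -
  have "gqlQ 0 0 U > 0" using gqlQ_pos[OF assms(2)] .
  then show ?thesis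
    using gql_flux_perturbation_le[OF assms, of 0 0] by (smt (verit) zero_le_mult_iff)
qed

text \<open>The Roe-type average makes \<open>roe_vel U V - v\<close> a combination of the two velocity deviations with
  weights proportional to \<open>sqrt \<rho>\<close>, so that this cubic term is dominated by quadratic ones.\<close>

lemma roe_vel_swap_error:
  assumes U: "U \<in> admissible" and V: "V \<in> admissible"
  shows "\<bar>((roe_vel U V - v) \<bullet> X) * ((norm (mag U - b))\<^sup>2 - (norm (mag V - b))\<^sup>2) / 2\<bar>
    \<le> norm X * mag_jump U V * (gqlQ v b U + gqlQ v b V)"
proof -
  have r: "dens U > 0" "dens V > 0" using U V by (auto simp: admissible_def)
  define s t where "s = sqrt (dens U)" and "t = sqrt (dens V)"
  have s: "s > 0" "s\<^sup>2 = dens U" and t: "t > 0" "t\<^sup>2 = dens V" using r by (auto simp: s_def t_def)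
  let ?x = "s * norm (vel U - v)" and ?y = "t * norm (vel V - v)"
  let ?p = "norm (mag U - b)" and ?q = "norm (mag V - b)"
  have "roe_vel U V - v = (s *\<^sub>R (vel U - v) + t *\<^sub>R (vel V - v)) /\<^sub>R (s + t)"
  proof -
    have "v = ((s + t) *\<^sub>R v) /\<^sub>R (s + t)" using s t by simp
    then show ?thesis
      unfolding roe_vel_def s_def[symmetric] t_def[symmetric]
      by (metis (no_types) add_diff_add scaleR_diff_right scaleR_left_distrib)
  qed
  then have "norm (roe_vel U V - v) = norm (s *\<^sub>R (vel U - v) + t *\<^sub>R (vel V - v)) / (s + t)"
    using s t by (simp add: divide_inverse_commute)
  also have "\<dots> \<le> (?x + ?y) / (s + t)"
    using s t norm_triangle_ineq[of "s *\<^sub>R (vel U - v)" "t *\<^sub>R (vel V - v)"]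
    by (intro divide_right_mono) auto
  finally have rv: "norm (roe_vel U V - v) \<le> (?x + ?y) / (s + t)" .
  have A: "\<bar>(roe_vel U V - v) \<bullet> X\<bar> \<le> (?x + ?y) / (s + t) * norm X"
    using Cauchy_Schwarz_ineq2[of "roe_vel U V - v" X] mult_right_mono[OF rv norm_ge_zero[of X]]
    by linarith
  \<comment> \<open>Difference of squares: one factor is the jump of the fields, which is free of b
    and produces \<open>mag_jump\<close>; the other is linear in the deviations.\<close>
  have "?p\<^sup>2 - ?q\<^sup>2 = (mag U - mag V) \<bullet> ((mag U - b) + (mag V - b))"
    unfolding norm_diff_power2 inner_diff_left inner_diff_right inner_add_right
      inner_commute[of "mag V" "mag U"] dot_square_norm by simp
  then have "\<bar>?p\<^sup>2 - ?q\<^sup>2\<bar> \<le> norm (mag U - mag V) * norm ((mag U - b) + (mag V - b))"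
    by (metis Cauchy_Schwarz_ineq2)
  also have "\<dots> \<le> norm (mag U - mag V) * (?p + ?q)"
    by (intro mult_left_mono norm_triangle_ineq) simp
  finally have B: "\<bar>?p\<^sup>2 - ?q\<^sup>2\<bar> \<le> norm (mag U - mag V) * (?p + ?q)" .
  have C: "(?x + ?y) * (?p + ?q) / 2 \<le> gqlQ v b U + gqlQ v b V"
  proof -
    have "(x + y) * (p + q) \<le> x\<^sup>2 + y\<^sup>2 + p\<^sup>2 + q\<^sup>2" for x y p q :: real
      using sum_squares_bound[of x p] sum_squares_bound[of x q] sum_squares_bound[of y p]
        sum_squares_bound[of y q] by (simp add: algebra_simps)
    from this[of ?x ?y ?p ?q] show ?thesis
      using gqlQ_ge_quadratic[OF U, of v b] gqlQ_ge_quadratic[OF V, of v b]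
      by (simp add: power_mult_distrib s t)
  qed
  have "\<bar>((roe_vel U V - v) \<bullet> X) * (?p\<^sup>2 - ?q\<^sup>2) / 2\<bar>
    = \<bar>(roe_vel U V - v) \<bullet> X\<bar> * \<bar>?p\<^sup>2 - ?q\<^sup>2\<bar> / 2"
    by (simp add: abs_mult)
  also have "\<dots> \<le> ((?x + ?y) / (s + t) * norm X) * (norm (mag U - mag V) * (?p + ?q)) / 2"
    using A B s t by (intro divide_right_mono mult_mono) auto
  also have "\<dots> = norm X * mag_jump U V * ((?x + ?y) * (?p + ?q) / 2)"
    unfolding mag_jump_def s_def[symmetric] t_def[symmetric] by simp
  also have "\<dots> \<le> norm X * mag_jump U V * (gqlQ v b U + gqlQ v b V)"
    using r by (intro mult_left_mono C mult_nonneg_nonneg mag_jump_nonneg) auto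
  finally show ?thesis .
qed

section \<open>Admissibility of the intermediate states\<close>

lemma weighted_le_max:
  fixes x y p q :: real
  assumes "0 \<le> p" "0 \<le> q"
  shows "x * p + y * q \<le> max x y * (p + q)" "min x y * (p + q) \<le> x * p + y * q"
  using assms mult_right_mono[of x "max x y" p] mult_right_mono[of y "max x y" q]
    mult_right_mono[of "min x y" x p] mult_right_mono[of "min x y" y q]
  by (simp_all add: distrib_left)

lemma half_norm_le_gqlQ:
  assumes "U \<in> admissible"
  shows "0 \<le> gqlQ v b U - (norm (mag U - b))\<^sup>2 / 2"
  using gqlQ_ge_quadratic[OF assms, of v b] assms
  by (smt (verit) admissible_def divide_nonneg_nonneg mem_Collect_eq mult_nonneg_nonneg zero_le_power2)

text \<open>Each summand of the speed bounds pays for one error: the maximum or minimum of the two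
  velocities for the transport terms, \<open>Cspeed\<close> for the bracket in
  \<open>gql_flux_dir_eq\<close>, \<open>mag_jump\<close> for exchanging v with
  \<open>roe_vel\<close>, the \<open>dB\<close> term on the minus side for the source, and the
  positive \<open>s_fast\<close> makes the inequality strict.\<close>

lemma T_minus_admissible:
  assumes g: "\<gamma> > 1" and Um: "Um \<in> admissible" and Up: "Up \<in> admissible" and n: "norm n = 1"
    and a: "am < 0" "0 < ap" and am: "am \<le> am0 \<gamma> Um Up n" and ap: "ap \<ge> ap0 \<gamma> Um Up n"
  shows "T_minus \<gamma> Um Up n am ap \<in> admissible"
proof -
  have rm: "dens Um > 0" and rp: "dens Up > 0" using Um Up by (auto simp: admissible_def)
  let ?d = "dB Um Up n"
  let ?k = "mag_jump Um Up"
  define sF where "sF = s_fast \<gamma> Um Up"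
  have sF: "sF > 0"
  proof -
    have "(\<gamma> * pres \<gamma> Um + (norm (mag Um))\<^sup>2) / dens Um > 0"
      using g Um by (auto simp: admissible_def pres_def intro!: divide_pos_pos add_pos_nonneg mult_pos_pos)
    then show ?thesis by (auto simp: sF_def s_fast_def less_max_iff_disj)
  qed
  have jc: "mag_jump Up Um = ?k" "roe_vel Up Um = roe_vel Um Up"
    by (simp_all add: mag_jump_def roe_vel_def norm_minus_commute add.commute)
  have am': "am \<le> min (vel Um \<bullet> n) (roe_vel Um Up \<bullet> n) - Cspeed \<gamma> Um n - ?k - \<bar>?d\<bar> / sqrt (dens Um) - sF"
    using am by (simp add: am0_def alpha_l_def sF_def)
  have ap': "ap \<ge> max (vel Up \<bullet> n) (roe_vel Um Up \<bullet> n) + Cspeed \<gamma> Up n + ?k + sF"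
  proof -
    have "\<bar>?d\<bar> / sqrt (dens Up) \<ge> 0" using rp by simp
    then show ?thesis
      using ap max.cobounded2[of "alpha_r \<gamma> Up Um n" 0]
      unfolding ap0_def sF_def alpha_r_def jc by linarith
  qed
  have nn: "?k \<ge> 0" "Cspeed \<gamma> Um n \<ge> 0" "Cspeed \<gamma> Up n \<ge> 0" "\<bar>?d\<bar> / sqrt (dens Um) \<ge> 0"
    using mag_jump_nonneg Cspeed_nonneg g Um Up n rm rp by auto
  have C: "ap - am > 0" using a by simp
  define W where "W = ap *\<^sub>R Up - am *\<^sub>R Um - flux_dir \<gamma> n Up + flux_dir \<gamma> n Um - ?d *\<^sub>R source Um"
  have T: "T_minus \<gamma> Um Up n am ap = W /\<^sub>R (ap - am)"
    by (simp add: T_minus_def hll_state_def W_def scaleR_diff_right divide_inverse_commute)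
  have "dens W = dens Up * (ap - vel Up \<bullet> n) + dens Um * (vel Um \<bullet> n - am)"
    by (simp add: W_def dens_flux_dir source_def dens_def[of "(_,_)"] algebra_simps)
  also have "\<dots> > 0"
  proof -
    have "vel Up \<bullet> n < ap" "am < vel Um \<bullet> n"
      using am' ap' nn sF max.cobounded1[of "vel Up \<bullet> n" "roe_vel Um Up \<bullet> n"]
        min.cobounded1[of "vel Um \<bullet> n" "roe_vel Um Up \<bullet> n"] by linarith+
    then show ?thesis using rm rp by (intro add_pos_pos mult_pos_pos) auto
  qed
  finally have dW: "dens W > 0" .
  have "gqlQ v b (W /\<^sub>R (ap - am)) > 0" for v b
  proof -
    define Qm Qp where "Qm = gqlQ v b Um" and "Qp = gqlQ v b Up"
    let ?bm = "(norm (mag Um - b))\<^sup>2" and ?bp = "(norm (mag Up - b))\<^sup>2"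
    have Q: "Qm > 0" "Qp > 0" using gqlQ_pos Um Up by (auto simp: Qm_def Qp_def)
    have "gql v b W = ap * gql v b Up - am * gql v b Um - gql v b (flux_dir \<gamma> n Up)
        + gql v b (flux_dir \<gamma> n Um) - ?d * gql v b (source Um)"
      by (simp add: W_def linear_add[OF linear_gql] linear_diff[OF linear_gql] linear_scale[OF linear_gql])
    also have "\<dots> = ap * (Qp - (norm b)\<^sup>2 / 2) - am * (Qm - (norm b)\<^sup>2 / 2) - gql v b (flux_dir \<gamma> n Up)
        + gql v b (flux_dir \<gamma> n Um) - ?d * ((vel Um - v) \<bullet> (mag Um - b)) + ?d * (v \<bullet> b)"
      by (simp add: Qm_def Qp_def gqlQ_def gql_source algebra_simps)
    finally have W: "gql v b W + (ap - am) * ((norm b)\<^sup>2 / 2) = ap * Qp - am * Qm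
      - gql v b (flux_dir \<gamma> n Up) + gql v b (flux_dir \<gamma> n Um)
      - ?d * ((vel Um - v) \<bullet> (mag Um - b)) + ?d * (v \<bullet> b)"
      by (simp add: algebra_simps diff_divide_distrib)
    have d: "?d * (v \<bullet> b) = (mag Up \<bullet> n) * (v \<bullet> b) - (mag Um \<bullet> n) * (v \<bullet> b)"
      by (simp add: dB_def Bn_def algebra_simps)
    \<comment> \<open>Cauchy-Schwarz and Young's inequality, with weight sqrt \<rho> on the velocity
      deviation; the division by sqrt \<rho> in \<open>am0\<close> comes from this weight.\<close>
    have wb: "?d * ((vel Um - v) \<bullet> (mag Um - b)) \<le> \<bar>?d\<bar> / sqrt (dens Um) * Qm"
    proof -
      let ?s = "sqrt (dens Um)"
      have "?s * \<bar>(vel Um - v) \<bullet> (mag Um - b)\<bar> \<le> (?s * norm (vel Um - v)) * norm (mag Um - b)"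
        using Cauchy_Schwarz_ineq2[of "vel Um - v" "mag Um - b"] rm by (simp add: mult.assoc)
      also have "\<dots> \<le> ((?s * norm (vel Um - v))\<^sup>2 + ?bm) / 2"
        using sum_squares_bound[of "?s * norm (vel Um - v)" "norm (mag Um - b)"] by simp
      also have "\<dots> \<le> Qm"
        using gqlQ_ge_quadratic[OF Um, of v b] rm by (simp add: Qm_def power_mult_distrib)
      finally have "\<bar>(vel Um - v) \<bullet> (mag Um - b)\<bar> \<le> Qm / ?s"
        using rm by (simp add: field_simps)
      then have "\<bar>?d\<bar> * \<bar>(vel Um - v) \<bullet> (mag Um - b)\<bar> \<le> \<bar>?d\<bar> * (Qm / ?s)"
        by (intro mult_left_mono) auto
      then show ?thesis using abs_ge_self[of "?d * ((vel Um - v) \<bullet> (mag Um - b))"]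
        by (simp add: abs_mult)
    qed
    \<comment> \<open>The free v multiplies only a difference of two squares here, so it may be
      exchanged for the average velocity. The cost is shared by both sides, which is why
      \<open>mag_jump\<close> enters both speeds.\<close>
    have sw: "(v \<bullet> n) * (?bm - ?bp) / 2 \<ge> (roe_vel Um Up \<bullet> n) * (?bm - ?bp) / 2 - ?k * (Qm + Qp)"
    proof -
      have "(roe_vel Um Up \<bullet> n) * (?bm - ?bp) / 2 - (v \<bullet> n) * (?bm - ?bp) / 2
        = ((roe_vel Um Up - v) \<bullet> n) * (?bm - ?bp) / 2"
        by (simp add: inner_diff_left left_diff_distrib diff_divide_distrib)
      also have "\<dots> \<le> ?k * (Qm + Qp)"
        using roe_vel_swap_error[OF Um Up, of v n b] n unfolding Qm_def Qp_def by simp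
      finally show ?thesis by simp
    qed
    note F = gql_flux_bounds(1)[OF g Up n, of v b] gql_flux_bounds(2)[OF g Um n, of v b]
    note P = weighted_le_max(1)[OF half_norm_le_gqlQ[OF Up, of v b], of "?bp / 2" "vel Up \<bullet> n" "roe_vel Um Up \<bullet> n"]
      weighted_le_max(2)[OF half_norm_le_gqlQ[OF Um, of v b], of "?bm / 2" "vel Um \<bullet> n" "roe_vel Um Up \<bullet> n"]
    have "ap * Qp \<ge> (max (vel Up \<bullet> n) (roe_vel Um Up \<bullet> n) + Cspeed \<gamma> Up n + ?k + sF) * Qp"
      using ap' Q by (intro mult_right_mono) auto
    moreover have "am * Qm \<le> (min (vel Um \<bullet> n) (roe_vel Um Up \<bullet> n) - Cspeed \<gamma> Um n - ?k - \<bar>?d\<bar> / sqrt (dens Um) - sF) * Qm"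
      using am' Q by (intro mult_right_mono) auto
    moreover have "sF * Qm > 0" "sF * Qp > 0" using sF Q by auto
    moreover note F[folded Qm_def Qp_def] P[folded Qm_def Qp_def] sw wb
    ultimately have "gql v b W + (ap - am) * ((norm b)\<^sup>2 / 2) > 0"
      unfolding W d by (simp add: algebra_simps diff_divide_distrib)
    then have "(gql v b W + (ap - am) * ((norm b)\<^sup>2 / 2)) / (ap - am) > 0"
      using C by simp
    also have "(gql v b W + (ap - am) * ((norm b)\<^sup>2 / 2)) / (ap - am) = gqlQ v b (W /\<^sub>R (ap - am))"
      using C unfolding gqlQ_def linear_scale[OF linear_gql] by (simp add: field_simps)
    finally show ?thesis .
  qed
  moreover have "dens (W /\<^sub>R (ap - am)) > 0" using dW C by simp
  ultimately show ?thesis unfolding T admissible_iff_gqlQ by blast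
qed

text \<open>Since sum c n = 0 removes the mixed terms, P times the sum of c (v . n) |B - b|^2 / 2 is
  half of a double sum, weighted by c c, in which v . (n \<nu> - n \<mu>) multiplies the difference
  of the two |B - b|^2 / 2. Each pair then admits the exchange of v for \<open>roe_vel\<close>, and
  collecting the result by \<nu> gives the averages A and J.\<close>

lemma interior_state_admissible:
  fixes I :: "'i set" and \<gamma> :: real and c \<beta> :: "'i \<Rightarrow> real" and n :: "'i \<Rightarrow> real^3" and U :: "'i \<Rightarrow> state"
  defines "P \<equiv> (\<Sum>\<nu>\<in>I. c \<nu>)"
  defines "A \<equiv> \<lambda>\<nu>. 1 / P * (\<Sum>\<mu>\<in>I. c \<mu> * ((n \<nu> - n \<mu>) \<bullet> roe_vel (U \<nu>) (U \<mu>)))"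
  defines "J \<equiv> \<lambda>\<nu>. 2 / P * (\<Sum>\<mu>\<in>I. c \<mu> * mag_jump (U \<nu>) (U \<mu>))"
  defines "\<alpha> \<equiv> \<lambda>\<nu>. max (vel (U \<nu>) \<bullet> n \<nu>) (A \<nu>) + Cspeed \<gamma> (U \<nu>) (n \<nu>) + J \<nu>"
  defines "D \<equiv> (\<Sum>\<nu>\<in>I. c \<nu> * \<beta> \<nu>)"
  assumes g: "\<gamma> > 1" and fin: "finite I" and ne: "I \<noteq> {}"
    and c: "\<And>\<nu>. \<nu> \<in> I \<Longrightarrow> c \<nu> > 0" and U: "\<And>\<nu>. \<nu> \<in> I \<Longrightarrow> U \<nu> \<in> admissible"
    and n: "\<And>\<nu>. \<nu> \<in> I \<Longrightarrow> norm (n \<nu>) = 1"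
    and cn: "(\<Sum>\<nu>\<in>I. c \<nu> *\<^sub>R n \<nu>) = 0"
    and cB: "(\<Sum>\<nu>\<in>I. c \<nu> * (mag (U \<nu>) \<bullet> n \<nu>)) = 0"
    and \<beta>: "\<And>\<nu>. \<nu> \<in> I \<Longrightarrow> \<beta> \<nu> > \<alpha> \<nu>"
  shows "D > 0"
    and "(\<Sum>\<nu>\<in>I. c \<nu> *\<^sub>R (\<beta> \<nu> *\<^sub>R U \<nu> - flux_dir \<gamma> (n \<nu>) (U \<nu>))) /\<^sub>R D \<in> admissible"
proof -
  have P: "P > 0" unfolding P_def using fin ne c by (rule sum_pos)
  have r: "dens (U \<nu>) > 0" if "\<nu> \<in> I" for \<nu> using U[OF that] by (simp add: admissible_def)
  have cc: "c \<nu> * c \<mu> > 0" if "\<nu> \<in> I" "\<mu> \<in> I" for \<nu> \<mu> using c that by simp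
  have Jnn: "J \<nu> \<ge> 0" if "\<nu> \<in> I" for \<nu>
    unfolding J_def using P c r that
    by (intro mult_nonneg_nonneg sum_nonneg mag_jump_nonneg divide_nonneg_pos) (auto simp: less_imp_le)
  have Cnn: "Cspeed \<gamma> (U \<nu>) (n \<nu>) \<ge> 0" if "\<nu> \<in> I" for \<nu>
    using Cspeed_nonneg g U n that by blast
  have antisym: "(\<Sum>\<nu>\<in>I. \<Sum>\<mu>\<in>I. F \<nu> \<mu>) = 0" if "\<And>\<nu> \<mu>. F \<mu> \<nu> = - F \<nu> \<mu>" for F :: "'i \<Rightarrow> 'i \<Rightarrow> real"
  proof -
    have "(\<Sum>\<nu>\<in>I. \<Sum>\<mu>\<in>I. F \<nu> \<mu>) = (\<Sum>\<nu>\<in>I. \<Sum>\<mu>\<in>I. F \<mu> \<nu>)" by (rule sum.swap)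
    also have "\<dots> = - (\<Sum>\<nu>\<in>I. \<Sum>\<mu>\<in>I. F \<nu> \<mu>)"
      unfolding sum_negf[symmetric] by (intro sum.cong refl that)
    finally show ?thesis by simp
  qed
  have roe_sym: "roe_vel V W = roe_vel W V" and jump_sym: "mag_jump V W = mag_jump W V" for V W
    by (simp_all add: roe_vel_def mag_jump_def add.commute norm_minus_commute)
  \<comment> \<open>Exchanging \<nu> and \<mu> flips the sign of the summands of A, so the
    c-weighted sum of A vanishes, while every \<beta> exceeds its A.\<close>
  show D: "D > 0"
  proof -
    have "(\<Sum>\<nu>\<in>I. c \<nu> * A \<nu>) = 1 / P * (\<Sum>\<nu>\<in>I. \<Sum>\<mu>\<in>I. c \<nu> * c \<mu> * ((n \<nu> - n \<mu>) \<bullet> roe_vel (U \<nu>) (U \<mu>)))"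
      by (simp add: A_def sum_distrib_left mult_ac)
    also have "(\<Sum>\<nu>\<in>I. \<Sum>\<mu>\<in>I. c \<nu> * c \<mu> * ((n \<nu> - n \<mu>) \<bullet> roe_vel (U \<nu>) (U \<mu>))) = 0"
      by (rule antisym) (simp add: roe_sym inner_diff_left algebra_simps)
    finally have "0 = (\<Sum>\<nu>\<in>I. c \<nu> * A \<nu>)" by simp
    also have "\<dots> < (\<Sum>\<nu>\<in>I. c \<nu> * \<beta> \<nu>)"
    proof (rule sum_strict_mono[OF fin ne])
      fix \<nu> assume i: "\<nu> \<in> I"
      have "A \<nu> < \<beta> \<nu>" using \<beta>[OF i] Jnn[OF i] Cnn[OF i] unfolding \<alpha>_def by linarith
      then show "c \<nu> * A \<nu> < c \<nu> * \<beta> \<nu>" using c[OF i] by simp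
    qed
    finally show ?thesis by (simp add: D_def)
  qed
  define W where "W = (\<Sum>\<nu>\<in>I. c \<nu> *\<^sub>R (\<beta> \<nu> *\<^sub>R U \<nu> - flux_dir \<gamma> (n \<nu>) (U \<nu>)))"
  have "dens W = (\<Sum>\<nu>\<in>I. c \<nu> * (dens (U \<nu>) * (\<beta> \<nu> - vel (U \<nu>) \<bullet> n \<nu>)))"
    unfolding W_def linear_sum[OF linear_dens] by (simp add: dens_flux_dir algebra_simps)
  also have "\<dots> > 0"
  proof (rule sum_pos[OF fin ne])
    fix \<nu> assume i: "\<nu> \<in> I"
    have "vel (U \<nu>) \<bullet> n \<nu> < \<beta> \<nu>" using \<beta>[OF i] Jnn[OF i] Cnn[OF i] unfolding \<alpha>_def by linarith
    then show "0 < c \<nu> * (dens (U \<nu>) * (\<beta> \<nu> - vel (U \<nu>) \<bullet> n \<nu>))" using c[OF i] r[OF i] by simp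
  qed
  finally have dW: "dens W > 0" .
  have "gqlQ v b (W /\<^sub>R D) > 0" for v b
  proof -
    define Q where "Q = (\<lambda>\<nu>. gqlQ v b (U \<nu>))"
    define B2 where "B2 = (\<lambda>\<nu>. (norm (mag (U \<nu>) - b))\<^sup>2)"
    have Qp: "Q \<nu> > 0" if "\<nu> \<in> I" for \<nu> using gqlQ_pos U that by (simp add: Q_def)
    have cv: "(\<Sum>\<nu>\<in>I. c \<nu> * (v \<bullet> n \<nu>)) = 0"
    proof -
      have "(\<Sum>\<nu>\<in>I. c \<nu> * (v \<bullet> n \<nu>)) = v \<bullet> (\<Sum>\<nu>\<in>I. c \<nu> *\<^sub>R n \<nu>)" by (simp add: inner_sum_right)
      then show ?thesis by (simp add: cn)
    qed
    let ?S = "\<lambda>F. (\<Sum>\<nu>\<in>I. \<Sum>\<mu>\<in>I. c \<nu> * c \<mu> * F \<nu> \<mu>)"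
    have cubic: "(\<Sum>\<nu>\<in>I. c \<nu> * ((v \<bullet> n \<nu>) * B2 \<nu> / 2)) \<le> (\<Sum>\<nu>\<in>I. c \<nu> * (A \<nu> * B2 \<nu> / 2 + J \<nu> * Q \<nu>))"
    proof -
      have e1: "?S (\<lambda>\<nu> \<mu>. (v \<bullet> n \<nu>) * B2 \<nu> / 2) = P * (\<Sum>\<nu>\<in>I. c \<nu> * ((v \<bullet> n \<nu>) * B2 \<nu> / 2))"
        unfolding P_def sum_product by (subst sum.swap) (simp add: mult_ac)
      have e2: "?S (\<lambda>\<nu> \<mu>. (v \<bullet> n \<nu>) * B2 \<mu> / 2) = 0"
      proof -
        have "?S (\<lambda>\<nu> \<mu>. (v \<bullet> n \<nu>) * B2 \<mu> / 2) = (\<Sum>\<nu>\<in>I. c \<nu> * (v \<bullet> n \<nu>)) * (\<Sum>\<mu>\<in>I. c \<mu> * B2 \<mu> / 2)"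
          unfolding sum_product by (simp add: mult_ac)
        then show ?thesis by (simp add: cv)
      qed
      have e3: "?S (\<lambda>\<nu> \<mu>. F \<mu> \<nu>) = ?S F" for F :: "'i \<Rightarrow> 'i \<Rightarrow> real"
        by (subst sum.swap) (simp add: mult_ac)
      have "?S (\<lambda>\<nu> \<mu>. (v \<bullet> (n \<nu> - n \<mu>)) * (B2 \<nu> - B2 \<mu>) / 2) =
        ?S (\<lambda>\<nu> \<mu>. (v \<bullet> n \<nu>) * B2 \<nu> / 2) + ?S (\<lambda>\<nu> \<mu>. (v \<bullet> n \<mu>) * B2 \<mu> / 2)
        - ?S (\<lambda>\<nu> \<mu>. (v \<bullet> n \<nu>) * B2 \<mu> / 2) - ?S (\<lambda>\<nu> \<mu>. (v \<bullet> n \<mu>) * B2 \<nu> / 2)"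
        unfolding sum.distrib[symmetric] sum_subtractf[symmetric]
        by (intro sum.cong refl) (simp add: inner_diff_right field_simps)
      also have "\<dots> = 2 * (P * (\<Sum>\<nu>\<in>I. c \<nu> * ((v \<bullet> n \<nu>) * B2 \<nu> / 2)))"
        using e3[of "\<lambda>\<nu> \<mu>. (v \<bullet> n \<nu>) * B2 \<nu> / 2"] e3[of "\<lambda>\<nu> \<mu>. (v \<bullet> n \<nu>) * B2 \<mu> / 2"] e1 e2 by simp
      finally have L: "2 * P * (\<Sum>\<nu>\<in>I. c \<nu> * ((v \<bullet> n \<nu>) * B2 \<nu> / 2)) =
        ?S (\<lambda>\<nu> \<mu>. (v \<bullet> (n \<nu> - n \<mu>)) * (B2 \<nu> - B2 \<mu>) / 2)" by simp
      also have "\<dots> \<le> ?S (\<lambda>\<nu> \<mu>. (roe_vel (U \<nu>) (U \<mu>) \<bullet> (n \<nu> - n \<mu>)) * (B2 \<nu> - B2 \<mu>) / 2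
          + 2 * mag_jump (U \<nu>) (U \<mu>) * (Q \<nu> + Q \<mu>))"
      proof (intro sum_mono mult_left_mono)
        fix \<nu> \<mu> assume i: "\<nu> \<in> I" "\<mu> \<in> I"
        have k: "mag_jump (U \<nu>) (U \<mu>) \<ge> 0" using r i by (intro mag_jump_nonneg) (auto simp: less_imp_le)
        \<comment> \<open>Two unit normals are at most 2 apart, whence the factor 2 in J.\<close>
        have "norm (n \<nu> - n \<mu>) \<le> 2" using norm_triangle_ineq4[of "n \<nu>" "n \<mu>"] n i by simp
        then have "norm (n \<nu> - n \<mu>) * (mag_jump (U \<nu>) (U \<mu>) * (Q \<nu> + Q \<mu>)) \<le> 2 * (mag_jump (U \<nu>) (U \<mu>) * (Q \<nu> + Q \<mu>))"
          using k Qp[OF i(1)] Qp[OF i(2)] by (intro mult_right_mono mult_nonneg_nonneg) auto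
        then have "\<bar>((roe_vel (U \<nu>) (U \<mu>) - v) \<bullet> (n \<nu> - n \<mu>)) * (B2 \<nu> - B2 \<mu>) / 2\<bar> \<le> 2 * mag_jump (U \<nu>) (U \<mu>) * (Q \<nu> + Q \<mu>)"
          using roe_vel_swap_error[OF U[OF i(1)] U[OF i(2)], of v "n \<nu> - n \<mu>" b]
          unfolding Q_def B2_def mult.assoc by linarith
        then show "(v \<bullet> (n \<nu> - n \<mu>)) * (B2 \<nu> - B2 \<mu>) / 2 \<le> (roe_vel (U \<nu>) (U \<mu>) \<bullet> (n \<nu> - n \<mu>)) * (B2 \<nu> - B2 \<mu>) / 2
          + 2 * mag_jump (U \<nu>) (U \<mu>) * (Q \<nu> + Q \<mu>)"
          unfolding inner_diff_left[of _ v] left_diff_distrib[of _ "v \<bullet> _"] diff_divide_distrib by linarith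
      qed (use cc in \<open>auto simp: less_imp_le\<close>)
      \<comment> \<open>As \<open>roe_vel\<close> and \<open>mag_jump\<close> are symmetric, each
        pair splits into two halves that an exchange of the indices maps to each other.\<close>
      also have "\<dots> = ?S (\<lambda>\<nu> \<mu>. ((n \<nu> - n \<mu>) \<bullet> roe_vel (U \<nu>) (U \<mu>)) * B2 \<nu> / 2 + 2 * mag_jump (U \<nu>) (U \<mu>) * Q \<nu>)
        + ?S (\<lambda>\<nu> \<mu>. ((n \<mu> - n \<nu>) \<bullet> roe_vel (U \<mu>) (U \<nu>)) * B2 \<mu> / 2 + 2 * mag_jump (U \<mu>) (U \<nu>) * Q \<mu>)"
        unfolding sum.distrib[symmetric]
      proof (intro sum.cong refl)
        fix \<nu> \<mu>
        define X where "X = (n \<nu> - n \<mu>) \<bullet> roe_vel (U \<nu>) (U \<mu>)"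
        define k where "k = mag_jump (U \<nu>) (U \<mu>)"
        have "roe_vel (U \<nu>) (U \<mu>) \<bullet> (n \<nu> - n \<mu>) = X" "(n \<mu> - n \<nu>) \<bullet> roe_vel (U \<mu>) (U \<nu>) = - X"
          "mag_jump (U \<mu>) (U \<nu>) = k"
          by (simp_all add: X_def k_def inner_commute inner_diff_left inner_diff_right roe_sym[of "U \<mu>"] jump_sym[of "U \<mu>"])
        then show "c \<nu> * c \<mu> * ((roe_vel (U \<nu>) (U \<mu>) \<bullet> (n \<nu> - n \<mu>)) * (B2 \<nu> - B2 \<mu>) / 2
          + 2 * mag_jump (U \<nu>) (U \<mu>) * (Q \<nu> + Q \<mu>)) =
          c \<nu> * c \<mu> * (((n \<nu> - n \<mu>) \<bullet> roe_vel (U \<nu>) (U \<mu>)) * B2 \<nu> / 2 + 2 * mag_jump (U \<nu>) (U \<mu>) * Q \<nu>)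
          + c \<nu> * c \<mu> * (((n \<mu> - n \<nu>) \<bullet> roe_vel (U \<mu>) (U \<nu>)) * B2 \<mu> / 2 + 2 * mag_jump (U \<mu>) (U \<nu>) * Q \<mu>)"
          unfolding X_def[symmetric] k_def[symmetric] by (simp add: field_simps)
      qed
      also have "\<dots> = 2 * ?S (\<lambda>\<nu> \<mu>. ((n \<nu> - n \<mu>) \<bullet> roe_vel (U \<nu>) (U \<mu>)) * B2 \<nu> / 2 + 2 * mag_jump (U \<nu>) (U \<mu>) * Q \<nu>)"
        using e3[of "\<lambda>\<nu> \<mu>. ((n \<nu> - n \<mu>) \<bullet> roe_vel (U \<nu>) (U \<mu>)) * B2 \<nu> / 2 + 2 * mag_jump (U \<nu>) (U \<mu>) * Q \<nu>"]
        by simp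
      also have "\<dots> = 2 * P * (\<Sum>\<nu>\<in>I. c \<nu> * (A \<nu> * B2 \<nu> / 2 + J \<nu> * Q \<nu>))"
      proof -
        have "(\<Sum>\<mu>\<in>I. c \<nu> * c \<mu> * (((n \<nu> - n \<mu>) \<bullet> roe_vel (U \<nu>) (U \<mu>)) * B2 \<nu> / 2 + 2 * mag_jump (U \<nu>) (U \<mu>) * Q \<nu>))
          = P * (c \<nu> * (A \<nu> * B2 \<nu> / 2 + J \<nu> * Q \<nu>))" for \<nu>
        proof -
          have "P * A \<nu> = (\<Sum>\<mu>\<in>I. c \<mu> * ((n \<nu> - n \<mu>) \<bullet> roe_vel (U \<nu>) (U \<mu>)))"
            "P * J \<nu> = (\<Sum>\<mu>\<in>I. 2 * (c \<mu> * mag_jump (U \<nu>) (U \<mu>)))"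
            using P by (simp_all add: A_def J_def sum_distrib_left[symmetric])
          moreover have "P * (c \<nu> * (A \<nu> * B2 \<nu> / 2 + J \<nu> * Q \<nu>)) =
             c \<nu> * B2 \<nu> / 2 * (P * A \<nu>) + c \<nu> * Q \<nu> * (P * J \<nu>)"
            by (simp add: algebra_simps)
          ultimately have "P * (c \<nu> * (A \<nu> * B2 \<nu> / 2 + J \<nu> * Q \<nu>)) =
             c \<nu> * B2 \<nu> / 2 * (\<Sum>\<mu>\<in>I. c \<mu> * ((n \<nu> - n \<mu>) \<bullet> roe_vel (U \<nu>) (U \<mu>)))
            + c \<nu> * Q \<nu> * (\<Sum>\<mu>\<in>I. 2 * (c \<mu> * mag_jump (U \<nu>) (U \<mu>)))"
            by simp
          also have "\<dots> = (\<Sum>\<mu>\<in>I. c \<nu> * c \<mu> * (((n \<nu> - n \<mu>) \<bullet> roe_vel (U \<nu>) (U \<mu>)) * B2 \<nu> / 2 + 2 * mag_jump (U \<nu>) (U \<mu>) * Q \<nu>))"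
            unfolding sum_distrib_left sum.distrib[symmetric]
            by (intro sum.cong refl) (simp add: field_simps)
          finally show ?thesis by simp
        qed
        then show ?thesis by (simp add: sum_distrib_left mult.assoc)
      qed
      finally show ?thesis using P by simp
    qed
    have pt: "c \<nu> * (gql v b (flux_dir \<gamma> (n \<nu>) (U \<nu>))) \<le> c \<nu> * ((vel (U \<nu>) \<bullet> n \<nu>) * (Q \<nu> - B2 \<nu> / 2)
      + Cspeed \<gamma> (U \<nu>) (n \<nu>) * Q \<nu>) + c \<nu> * ((v \<bullet> n \<nu>) * B2 \<nu> / 2) - c \<nu> * (v \<bullet> n \<nu>) * ((norm b)\<^sup>2 / 2)
      + c \<nu> * (mag (U \<nu>) \<bullet> n \<nu>) * (v \<bullet> b)" if i: "\<nu> \<in> I" for \<nu>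
      using mult_left_mono[OF gql_flux_bounds(1)[OF g U[OF i] n[OF i], of v b] less_imp_le[OF c[OF i]]]
      unfolding Q_def[symmetric] B2_def[symmetric] by (simp add: B2_def Q_def algebra_simps)
    have "(\<Sum>\<nu>\<in>I. c \<nu> * gql v b (flux_dir \<gamma> (n \<nu>) (U \<nu>))) \<le>
      (\<Sum>\<nu>\<in>I. c \<nu> * ((vel (U \<nu>) \<bullet> n \<nu>) * (Q \<nu> - B2 \<nu> / 2) + Cspeed \<gamma> (U \<nu>) (n \<nu>) * Q \<nu>))
      + (\<Sum>\<nu>\<in>I. c \<nu> * ((v \<bullet> n \<nu>) * B2 \<nu> / 2)) - (\<Sum>\<nu>\<in>I. c \<nu> * (v \<bullet> n \<nu>)) * ((norm b)\<^sup>2 / 2)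
      + (\<Sum>\<nu>\<in>I. c \<nu> * (mag (U \<nu>) \<bullet> n \<nu>)) * (v \<bullet> b)"
      unfolding sum_distrib_right sum.distrib[symmetric] sum_subtractf[symmetric]
      using pt by (rule sum_mono)
    also have "\<dots> \<le> (\<Sum>\<nu>\<in>I. c \<nu> * ((vel (U \<nu>) \<bullet> n \<nu>) * (Q \<nu> - B2 \<nu> / 2) + Cspeed \<gamma> (U \<nu>) (n \<nu>) * Q \<nu>))
      + (\<Sum>\<nu>\<in>I. c \<nu> * (A \<nu> * B2 \<nu> / 2 + J \<nu> * Q \<nu>))"
      using cubic unfolding cv cB by simp
    also have "\<dots> < (\<Sum>\<nu>\<in>I. c \<nu> * (\<beta> \<nu> * Q \<nu>))"
      unfolding sum.distrib[symmetric]
    proof (rule sum_strict_mono[OF fin ne])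
      fix \<nu> assume i: "\<nu> \<in> I"
      \<comment> \<open>The weights Q - B2 / 2 and B2 / 2 are nonnegative and add up to Q, hence the
        maximum in \<alpha>.\<close>
      have "(vel (U \<nu>) \<bullet> n \<nu>) * (Q \<nu> - B2 \<nu> / 2) + A \<nu> * (B2 \<nu> / 2) \<le> max (vel (U \<nu>) \<bullet> n \<nu>) (A \<nu>) * (Q \<nu> - B2 \<nu> / 2 + B2 \<nu> / 2)"
        using half_norm_le_gqlQ[OF U[OF i], of v b] unfolding Q_def B2_def by (intro weighted_le_max) auto
      moreover have "\<alpha> \<nu> * Q \<nu> < \<beta> \<nu> * Q \<nu>" using \<beta>[OF i] Qp[OF i] by simp
      ultimately have "(vel (U \<nu>) \<bullet> n \<nu>) * (Q \<nu> - B2 \<nu> / 2) + Cspeed \<gamma> (U \<nu>) (n \<nu>) * Q \<nu> + (A \<nu> * B2 \<nu> / 2 + J \<nu> * Q \<nu>) < \<beta> \<nu> * Q \<nu>"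
        unfolding \<alpha>_def by (simp add: algebra_simps)
      then have "c \<nu> * ((vel (U \<nu>) \<bullet> n \<nu>) * (Q \<nu> - B2 \<nu> / 2) + Cspeed \<gamma> (U \<nu>) (n \<nu>) * Q \<nu> + (A \<nu> * B2 \<nu> / 2 + J \<nu> * Q \<nu>)) < c \<nu> * (\<beta> \<nu> * Q \<nu>)"
        using c[OF i] by simp
      then show "c \<nu> * ((vel (U \<nu>) \<bullet> n \<nu>) * (Q \<nu> - B2 \<nu> / 2) + Cspeed \<gamma> (U \<nu>) (n \<nu>) * Q \<nu>) + c \<nu> * (A \<nu> * B2 \<nu> / 2 + J \<nu> * Q \<nu>) < c \<nu> * (\<beta> \<nu> * Q \<nu>)"
        by (simp add: distrib_left)
    qed
    finally have lt: "(\<Sum>\<nu>\<in>I. c \<nu> * gql v b (flux_dir \<gamma> (n \<nu>) (U \<nu>))) < (\<Sum>\<nu>\<in>I. c \<nu> * (\<beta> \<nu> * Q \<nu>))" .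
    have "gql v b W = (\<Sum>\<nu>\<in>I. c \<nu> * (\<beta> \<nu> * Q \<nu>) - c \<nu> * \<beta> \<nu> * ((norm b)\<^sup>2 / 2) - c \<nu> * gql v b (flux_dir \<gamma> (n \<nu>) (U \<nu>)))"
      unfolding W_def linear_sum[OF linear_gql]
      by (intro sum.cong refl) (simp add: linear_diff[OF linear_gql] linear_scale[OF linear_gql] Q_def gqlQ_def algebra_simps)
    also have "\<dots> = (\<Sum>\<nu>\<in>I. c \<nu> * (\<beta> \<nu> * Q \<nu>)) - D * ((norm b)\<^sup>2 / 2) - (\<Sum>\<nu>\<in>I. c \<nu> * gql v b (flux_dir \<gamma> (n \<nu>) (U \<nu>)))"
      by (simp only: sum_subtractf sum_distrib_right[symmetric] D_def)
    finally have "gql v b W + D * ((norm b)\<^sup>2 / 2) > 0" using lt by simp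
    then have "(gql v b W + D * ((norm b)\<^sup>2 / 2)) / D > 0" using D by simp
    also have "(gql v b W + D * ((norm b)\<^sup>2 / 2)) / D = gqlQ v b (W /\<^sub>R D)"
      using D unfolding gqlQ_def linear_scale[OF linear_gql] by (simp add: field_simps)
    finally show ?thesis .
  qed
  moreover have "dens (W /\<^sub>R D) > 0" using dW D by simp
  ultimately show "(\<Sum>\<nu>\<in>I. c \<nu> *\<^sub>R (\<beta> \<nu> *\<^sub>R U \<nu> - flux_dir \<gamma> (n \<nu>) (U \<nu>))) /\<^sub>R D \<in> admissible"
    unfolding W_def[symmetric] admissible_iff_gqlQ by blast
qed

section \<open>Convexity of the admissible set and of the entropies\<close>

lemma gqlQ_convex_combination:
  assumes "u + w = 1"
  shows "gqlQ v b (u *\<^sub>R U + w *\<^sub>R V) = u * gqlQ v b U + w * gqlQ v b V"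
proof -
  have "(u + w) * ((norm b)\<^sup>2 / 2) = (norm b)\<^sup>2 / 2" using assms by simp
  then show ?thesis
    by (simp add: gqlQ_def linear_add[OF linear_gql] linear_scale[OF linear_gql] algebra_simps)
qed

text \<open>The internal energy is a minimum of the affine functions \<open>gqlQ v b\<close>;
  evaluating them at the velocity and field of the combination gives concavity.\<close>

lemma int_energy_concave:
  assumes U: "dens U > 0" and V: "dens V > 0" and u: "u \<ge> 0" "w \<ge> 0" "u + w = 1"
  shows "dens (u *\<^sub>R U + w *\<^sub>R V) > 0"
    and "u * int_energy U + w * int_energy V \<le> int_energy (u *\<^sub>R U + w *\<^sub>R V)"
proof -
  show d: "dens (u *\<^sub>R U + w *\<^sub>R V) > 0"
    using assms by (cases "u = 0") (auto intro!: add_pos_nonneg)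
  let ?W = "u *\<^sub>R U + w *\<^sub>R V"
  show "u * int_energy U + w * int_energy V \<le> int_energy ?W"
    unfolding int_energy_eq_gqlQ[OF d] gqlQ_convex_combination[OF u(3)]
    using u by (intro add_mono mult_left_mono int_energy_le_gqlQ U V) auto
qed

lemma convex_admissible: "convex admissible"
proof (rule convexI)
  fix U V :: state and u w :: real
  assume UV: "U \<in> admissible" "V \<in> admissible" and u: "0 \<le> u" "0 \<le> w" "u + w = 1"
  have "u * int_energy U + w * int_energy V > 0"
    using UV u by (cases "u = 0") (auto simp: admissible_def intro!: add_pos_nonneg)
  with int_energy_concave[of U V u w] UV u
  show "u *\<^sub>R U + w *\<^sub>R V \<in> admissible"
    by (force simp: admissible_def simp del: dens_simps)
qed

lemma entropy_generatorD:
  assumes "entropy_generator \<gamma> f"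
  shows "(f has_real_derivative deriv f x) (at x)"
    and "(deriv f has_real_derivative deriv (deriv f) x) (at x)"
    and "deriv f x > 0" and "deriv f x - \<gamma> * deriv (deriv f) x > 0"
proof -
  have "g differentiable at x" if "g C1_differentiable_on UNIV" for g :: "real \<Rightarrow> real"
    using that by (auto simp: C1_differentiable_on_eq)
  then show "(f has_real_derivative deriv f x) (at x)"
    "(deriv f has_real_derivative deriv (deriv f) x) (at x)"
    using assms by (auto simp: entropy_generator_def DERIV_deriv_iff_real_differentiable)
  show "deriv f x > 0" "deriv f x - \<gamma> * deriv (deriv f) x > 0"
    using assms by (auto simp: entropy_generator_def)
qed

text \<open>The second derivative is \<gamma> (f' - \<gamma> f'') / z^2, so the second inequality in
  \<open>entropy_generator\<close> is convexity of this profile, just as f' > 0 makes it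
  decreasing.\<close>

lemma convex_entropy_profile:
  assumes g: "\<gamma> > 1" and f: "entropy_generator \<gamma> f"
  shows "convex_on {0<..} (\<lambda>z. - f (\<gamma> * ln z))"
proof (rule f''_ge0_imp_convex)
  fix z :: real assume z: "z \<in> {0<..}"
  note [derivative_intros] = DERIV_chain2[OF entropy_generatorD(1)[OF f]] DERIV_chain2[OF entropy_generatorD(2)[OF f]]
  show "((\<lambda>z. - f (\<gamma> * ln z)) has_real_derivative - (deriv f (\<gamma> * ln z) * (\<gamma> / z))) (at z)"
    using z by (auto intro!: derivative_eq_intros)
  show "((\<lambda>z. - (deriv f (\<gamma> * ln z) * (\<gamma> / z))) has_real_derivative
    \<gamma> * (deriv f (\<gamma> * ln z) - \<gamma> * deriv (deriv f) (\<gamma> * ln z)) / z\<^sup>2) (at z)"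
    using z by (auto intro!: derivative_eq_intros simp: power2_eq_square field_simps)
  show "0 \<le> \<gamma> * (deriv f (\<gamma> * ln z) - \<gamma> * deriv (deriv f) (\<gamma> * ln z)) / z\<^sup>2"
    using g entropy_generatorD(4)[OF f, of "\<gamma> * ln z"] by (intro divide_nonneg_nonneg mult_nonneg_nonneg) auto
qed simp

lemma entropy_profile_antimono:
  assumes g: "\<gamma> > 1" and f: "entropy_generator \<gamma> f" and z: "0 < z" "z \<le> z'"
  shows "- f (\<gamma> * ln z') \<le> - f (\<gamma> * ln z)"
proof -
  have "f x \<le> f y" if "x \<le> y" for x y
    using that entropy_generatorD(1,3)[OF f] by (intro DERIV_nonneg_imp_nondecreasing[of x y f]) (auto intro: less_imp_le)
  then show ?thesis using z g by auto
qed

lemma powr_concave: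
  fixes a :: real
  assumes "0 \<le> a" "a \<le> 1"
  shows "concave_on {0<..} (\<lambda>x. x powr a)"
proof (rule f''_le0_imp_concave)
  fix x :: real assume x: "x \<in> {0<..}"
  show "((\<lambda>x. x powr a) has_real_derivative a * x powr (a - 1)) (at x)"
    using x by (auto intro!: derivative_eq_intros)
  show "((\<lambda>x. a * x powr (a - 1)) has_real_derivative a * ((a - 1) * x powr (a - 1 - 1))) (at x)"
    using x by (auto intro!: derivative_eq_intros)
  show "a * ((a - 1) * x powr (a - 1 - 1)) \<le> 0"
    using assms by (simp add: mult_nonneg_nonpos mult_nonpos_nonneg)
qed simp

text \<open>With \<open>z = p powr (1 / \<gamma>)\<close>, which is concave in the state, \<open>eta\<close> is the perspective
  \<open>\<rho> \<phi>(z / \<rho>)\<close> of the convex decreasing function \<open>\<phi>(x) = - f (\<gamma> ln x)\<close>.\<close>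

lemma convex_on_eta:
  assumes g: "\<gamma> > 1" and f: "entropy_generator \<gamma> f"
  shows "convex_on admissible (eta \<gamma> f)"
proof (rule convex_onI)
  define \<phi> where "\<phi> = (\<lambda>x. - f (\<gamma> * ln x))"
  define z where "z = (\<lambda>U. pres \<gamma> U powr (1 / \<gamma>))"
  have zp: "z U > 0" if "U \<in> admissible" for U
    using that g by (auto simp: z_def pres_def admissible_def)
  have eta: "eta \<gamma> f U = dens U * \<phi> (z U / dens U)" if "U \<in> admissible" for U
  proof -
    have "pres \<gamma> U > 0" "dens U > 0" using that g by (auto simp: pres_def admissible_def)
    then have "\<gamma> * ln (z U / dens U) = spec_entropy \<gamma> U"
      using g by (simp add: z_def ln_div ln_powr spec_entropy_def right_diff_distrib)
    then show ?thesis by (simp add: eta_def \<phi>_def)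
  qed
  fix t :: real and U V assume t: "0 < t" "t < 1" and U: "U \<in> admissible" and V: "V \<in> admissible"
  let ?W = "(1 - t) *\<^sub>R U + t *\<^sub>R V"
  have W: "?W \<in> admissible"
    using convexD[OF convex_admissible U V, of "1 - t" t] t by simp
  have r: "dens U > 0" "dens V > 0" "dens ?W > 0" using U V W unfolding admissible_def by blast+
  have pr: "pres \<gamma> U > 0" "pres \<gamma> V > 0" using U V g by (auto simp: pres_def admissible_def)
  have p: "(1 - t) * pres \<gamma> U + t * pres \<gamma> V \<le> pres \<gamma> ?W"
  proof -
    have "(\<gamma> - 1) * ((1 - t) * int_energy U + t * int_energy V) \<le> (\<gamma> - 1) * int_energy ?W"
      using g t r by (intro mult_left_mono int_energy_concave(2)) auto
    then show ?thesis by (simp add: pres_def algebra_simps)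
  qed
  have pc: "(1 - t) * pres \<gamma> U + t * pres \<gamma> V > 0" using t pr by (intro add_pos_pos mult_pos_pos) auto
  have "(1 - t) * z U + t * z V \<le> ((1 - t) * pres \<gamma> U + t * pres \<gamma> V) powr (1 / \<gamma>)"
    using concave_onD[OF powr_concave[of "1 / \<gamma>"], of t "pres \<gamma> U" "pres \<gamma> V"] t pr g
    by (simp add: z_def)
  also have "\<dots> \<le> z ?W" unfolding z_def using p pc g by (intro powr_mono2) auto
  finally have z: "(1 - t) * z U + t * z V \<le> z ?W" .
  have zc: "(1 - t) * z U + t * z V > 0" using t zp[OF U] zp[OF V] by (intro add_pos_pos mult_pos_pos) auto
  \<comment> \<open>In a perspective the ratios z / \<rho> are mixed by shares of density instead of
    by t; \<open>s\<close> is the share of V.\<close>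
  define s where "s = t * dens V / dens ?W"
  have s1: "1 - s = (1 - t) * dens U / dens ?W" using r(3) by (simp add: s_def field_simps)
  have s: "0 \<le> s" "s \<le> 1" using s1 r t by (simp_all add: s_def divide_le_eq)
  have split: "((1 - t) * z U + t * z V) / dens ?W = (1 - s) * (z U / dens U) + s * (z V / dens V)"
    unfolding s1 unfolding s_def using r by (simp add: add_divide_distrib del: dens_simps)
  have "\<phi> (z ?W / dens ?W) \<le> \<phi> (((1 - t) * z U + t * z V) / dens ?W)"
    unfolding \<phi>_def using z zc r
    by (intro entropy_profile_antimono[OF g f] divide_pos_pos divide_right_mono) auto
  also have "\<dots> \<le> (1 - s) * \<phi> (z U / dens U) + s * \<phi> (z V / dens V)"
    unfolding split \<phi>_def
    using convex_onD[OF convex_entropy_profile[OF g f], of s "z U / dens U" "z V / dens V"] s zp[OF U] zp[OF V] r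
    by simp
  finally have "dens ?W * \<phi> (z ?W / dens ?W) \<le> dens ?W * ((1 - s) * \<phi> (z U / dens U) + s * \<phi> (z V / dens V))"
    using r(3) by (intro mult_left_mono) auto
  also have "\<dots> = (1 - t) * (dens U * \<phi> (z U / dens U)) + t * (dens V * \<phi> (z V / dens V))"
    unfolding s1 unfolding s_def using r(3) by (simp add: distrib_left del: dens_simps)
  finally show "eta \<gamma> f ?W \<le> (1 - t) * eta \<gamma> f U + t * eta \<gamma> f V"
    unfolding eta[OF U] eta[OF V] eta[OF W] .
qed (rule convex_admissible)

section \<open>Linear change of variables in dimensions two and three\<close>

lemma linear_imp_continuous_on:
  fixes h :: "'a::euclidean_space \<Rightarrow> 'b::real_normed_vector"
  shows "linear h \<Longrightarrow> continuous_on A h"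
  using linear_continuous_on by (auto simp: linear_conv_bounded_linear)

lemma continuous_imp_integrable_on_compact:
  fixes f :: "'a::euclidean_space \<Rightarrow> 'b::euclidean_space"
  assumes "compact S" "continuous_on S f"
  shows "set_integrable lborel S f" "f integrable_on S" "(LINT x:S|lborel. f x) = integral S f"
proof -
  show *: "set_integrable lborel S f"
    using borel_integrable_compact[OF assms] by (simp add: set_integrable_def)
  show "f integrable_on S" "(LINT x:S|lborel. f x) = integral S f"
    using set_borel_integral_eq_integral[OF *] by auto
qed

lemma integral_measure_preserving_image:
  fixes T :: "'a::euclidean_space \<Rightarrow> 'b::euclidean_space" and f :: "'b \<Rightarrow> real"
  assumes T: "distr lborel borel T = lborel" "continuous_on UNIV T" "inj T"
    and S: "compact S" "continuous_on (T ` S) f"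
  shows "integral (T ` S) f = integral S (\<lambda>x. f (T x))"
proof -
  have cS: "compact (T ` S)" using S T by (meson compact_continuous_image continuous_on_subset subset_UNIV)
  have cf: "continuous_on S (\<lambda>x. f (T x))"
    by (rule continuous_on_compose2[OF S(2) continuous_on_subset[OF T(2)]]) auto
  have Tm: "T \<in> borel_measurable lborel"
    using borel_measurable_continuous_onI[OF T(2)] by simp
  have fm: "(\<lambda>x. indicator (T ` S) x *\<^sub>R f x) \<in> borel_measurable borel"
    using borel_measurable_integrable[OF borel_integrable_compact[OF cS S(2)]] by simp
  have "integral (T ` S) f = (LINT x|lborel. indicator (T ` S) x *\<^sub>R f x)"
    using continuous_imp_integrable_on_compact(3)[OF cS S(2)] by (simp add: set_lebesgue_integral_def)
  also have "\<dots> = (LINT x|distr lborel borel T. indicator (T ` S) x *\<^sub>R f x)"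
    by (simp add: T(1))
  also have "\<dots> = (LINT x|lborel. indicator (T ` S) (T x) *\<^sub>R f (T x))"
    by (rule integral_distr[OF Tm fm])
  also have "\<dots> = (LINT x:S|lborel. f (T x))"
    unfolding set_lebesgue_integral_def using T(3)
    by (intro Bochner_Integration.integral_cong) (auto simp: indicator_def inj_image_mem_iff)
  also have "\<dots> = integral S (\<lambda>x. f (T x))"
    by (rule continuous_imp_integrable_on_compact(3)[OF S(1) cf])
  finally show ?thesis .
qed

lemma integral_translate_image:
  fixes f :: "'a::euclidean_space \<Rightarrow> real"
  assumes "compact S" "continuous_on ((+) a ` S) f"
  shows "integral ((+) a ` S) f = integral S (\<lambda>x. f (a + x))"
  by (rule integral_measure_preserving_image) (use assms in \<open>auto intro!: lborel_distr_plus continuous_intros\<close>)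

definition reindex :: "('m \<Rightarrow> 'd) \<Rightarrow> real^'d \<Rightarrow> real^'m" where
  "reindex \<sigma> x = (\<chi> j. x $ \<sigma> j)"

lemma reindex_inverse:
  assumes "bij \<sigma>"
  shows "reindex (inv \<sigma>) (reindex \<sigma> x) = x" "reindex \<sigma> (reindex (inv \<sigma>) y) = y"
  using assms by (simp_all add: reindex_def vec_eq_iff bij_is_surj bij_is_inj surj_f_inv_f)

lemma linear_reindex: "linear (reindex \<sigma>)"
  by (rule linearI) (simp_all add: reindex_def vec_eq_iff)

lemma inner_reindex:
  assumes "bij \<sigma>"
  shows "reindex \<sigma> x \<bullet> reindex \<sigma> y = x \<bullet> y"
  unfolding inner_vec_def reindex_def using sum.reindex_bij_betw[OF assms, of "\<lambda>i. x $ i \<bullet> y $ i"] by simp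

text \<open>Lebesgue measure is determined by the volumes of boxes, and renaming coordinates only
  permutes the edge lengths of a box.\<close>

lemma distr_reindex:
  fixes \<sigma> :: "'m::finite \<Rightarrow> 'd::finite"
  assumes "bij \<sigma>"
  shows "distr lborel borel (reindex \<sigma>) = lborel"
proof (rule lborel_eqI[symmetric])
  have c: "continuous_on UNIV (reindex \<sigma>)"
    by (rule linear_imp_continuous_on[OF linear_reindex])
  then have m: "reindex \<sigma> \<in> borel_measurable lborel"
    using borel_measurable_continuous_onI by auto
  fix l u :: "real^'m" assume lu: "\<And>b. b \<in> Basis \<Longrightarrow> l \<bullet> b \<le> u \<bullet> b"
  have vi: "reindex \<sigma> -` box l u = box (reindex (inv \<sigma>) l) (reindex (inv \<sigma>) u)"
    using assms by (auto simp: mem_box_cart reindex_def bij_is_surj surj_f_inv_f)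
      (metis assms bij_inv_eq_iff)+
  have lu': "l $ j \<le> u $ j" for j using lu[of "axis j 1"] by (simp add: axis_in_Basis_iff cart_eq_inner_axis)
  have P: "(\<Prod>b\<in>Basis. x \<bullet> b) = (\<Prod>i\<in>UNIV. x $ i)" for x :: "real^'k::finite"
  proof -
    have B: "Basis = (\<lambda>i. axis i (1::real)) ` (UNIV :: 'k set)" by (auto simp: Basis_vec_def)
    have "inj (\<lambda>i. axis i (1::real) :: real^'k)" by (auto simp: inj_def axis_eq_axis)
    then show ?thesis unfolding B by (subst prod.reindex) (simp_all add: cart_eq_inner_axis)
  qed
  have "emeasure (distr lborel borel (reindex \<sigma>)) (box l u)
    = emeasure lborel (box (reindex (inv \<sigma>) l) (reindex (inv \<sigma>) u))"
    using m by (simp add: emeasure_distr vi)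
  also have "\<dots> = (\<Prod>b\<in>Basis. (reindex (inv \<sigma>) u - reindex (inv \<sigma>) l) \<bullet> b)"
    using lu' by (intro emeasure_lborel_box) (auto simp: Basis_vec_def inner_axis reindex_def)
  also have "\<dots> = (\<Prod>b\<in>Basis. (u - l) \<bullet> b)"
    unfolding P using prod.reindex_bij_betw[OF bij_imp_bij_inv[OF assms], of "\<lambda>j. (u - l) $ j"]
    by (simp add: reindex_def)
  finally show "emeasure (distr lborel borel (reindex \<sigma>)) (box l u) = (\<Prod>b\<in>Basis. (u - l) \<bullet> b)" .
qed simp

lemma integral_reindex_image:
  fixes f :: "real^'m::finite \<Rightarrow> real" and \<sigma> :: "'m \<Rightarrow> 'd::finite"
  assumes "bij \<sigma>" "compact S" "continuous_on (reindex \<sigma> ` S) f"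
  shows "integral (reindex \<sigma> ` S) f = integral S (\<lambda>x. f (reindex \<sigma> x))"
proof (rule integral_measure_preserving_image[OF distr_reindex[OF assms(1)] _ _ assms(2,3)])
  show "continuous_on UNIV (reindex \<sigma>)"
    by (rule linear_imp_continuous_on[OF linear_reindex])
  show "inj (reindex \<sigma>)" using reindex_inverse(1)[OF assms(1)] by (rule inj_on_inverseI)
qed

lemma integral_linear_image_real:
  fixes f :: "real^'m::{finite,wellorder} \<Rightarrow> real"
  assumes g: "linear g" and S: "compact S" and f: "continuous_on (g ` S) f"
  shows "integral (g ` S) f = \<bar>det (matrix g)\<bar> * integral S (\<lambda>x. f (g x))"
proof -
  have cS: "compact (g ` S)"
    using S g by (intro compact_continuous_image linear_imp_continuous_on)
  have "f absolutely_integrable_on (g ` S)"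
    using continuous_imp_integrable_on_compact[OF cS f] continuous_imp_integrable_on_compact[OF cS continuous_on_norm[OF f]]
    by (simp add: absolutely_integrable_on_def)
  \<comment> \<open>The change of variables is applied to vector-valued functions; scalars enter as
    vectors with one component.\<close>
  then have "(\<lambda>x. vec (f x) :: real^1) absolutely_integrable_on (g ` S)"
    by (simp add: absolutely_integrable_on_1_iff)
  then have "integral (g ` S) (\<lambda>x. vec (f x) :: real^1) = \<bar>det (matrix g)\<bar> *\<^sub>R integral S ((\<lambda>x. vec (f x)) \<circ> g)"
    by (intro integral_change_of_variables_linear[OF g]) auto
  then have "vec (integral (g ` S) f) = (vec (\<bar>det (matrix g)\<bar> * integral S (\<lambda>x. f (g x))) :: real^1)"
    by (simp add: integral_on_1_eq o_def vec_eq_iff)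
  then show ?thesis by (simp add: vec_eq_iff)
qed

text \<open>The matrix I + a n^T, with determinant 1 + n . a. It is the linear part of the map from
  a right prism onto an oblique one.\<close>

definition rank_one_update :: "real^'d::finite \<Rightarrow> real^'d \<Rightarrow> real^'d \<Rightarrow> real^'d" where
  "rank_one_update n a x = x + (n \<bullet> x) *\<^sub>R a"

lemma linear_rank_one_update: "linear (rank_one_update n a)"
  by (rule linearI) (simp_all add: rank_one_update_def inner_add_right algebra_simps)

lemma matrix_rank_one_update:
  "matrix (rank_one_update n a) $ i $ j = (if i = j then 1 else 0) + n $ j * a $ i"
  by (simp add: matrix_def rank_one_update_def axis_def inner_axis[unfolded axis_def])

lemma det_rank_one_update_2: "det (matrix (rank_one_update n (a :: real^2))) = 1 + n \<bullet> a"
  by (simp add: det_2 matrix_rank_one_update inner_vec_def sum_2 algebra_simps)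

lemma det_rank_one_update_3: "det (matrix (rank_one_update n (a :: real^3))) = 1 + n \<bullet> a"
  by (simp add: det_3 matrix_rank_one_update inner_vec_def sum_3 algebra_simps)

text \<open>The change of variables theorem of the library needs a well-ordered index type; reindexing
  by the numeral types \<open>2\<close> and \<open>3\<close> removes this restriction.\<close>

lemma integral_rank_one_update_transfer:
  fixes f :: "real^'d::finite \<Rightarrow> real" and \<sigma> :: "'m::{finite,wellorder} \<Rightarrow> 'd"
  assumes \<sigma>: "bij \<sigma>" and det: "\<And>n a :: real^'m::{finite,wellorder}. det (matrix (rank_one_update n a)) = 1 + n \<bullet> a"
    and S: "compact S" and f: "continuous_on (rank_one_update n a ` S) f"
  shows "integral (rank_one_update n a ` S) f = \<bar>1 + n \<bullet> a\<bar> * integral S (\<lambda>x. f (rank_one_update n a x))"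
proof -
  let ?T = "reindex \<sigma>" and ?T' = "reindex (inv \<sigma>)"
  let ?g = "rank_one_update n a" and ?g' = "rank_one_update (?T n) (?T a)"
  have inv: "bij (inv \<sigma>)" using \<sigma> by (rule bij_imp_bij_inv)
  have com: "?T (?g x) = ?g' (?T x)" for x
    by (simp add: rank_one_update_def linear_add[OF linear_reindex] linear_scale[OF linear_reindex] inner_reindex[OF \<sigma>])
  have com': "?g x = ?T' (?g' (?T x))" for x
    by (simp add: com[symmetric] reindex_inverse[OF \<sigma>])
  have cT: "compact (?T ` S)"
    using S linear_reindex by (intro compact_continuous_image linear_imp_continuous_on)
  have cg: "compact (?g' ` ?T ` S)"
    by (rule compact_continuous_image[OF linear_imp_continuous_on[OF linear_rank_one_update] cT])
  have im: "?g ` S = ?T' ` ?g' ` ?T ` S"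
    by (simp add: image_image com'[symmetric])
  have cf: "continuous_on (?g' ` ?T ` S) (\<lambda>x. f (?T' x))"
    using f unfolding im by (rule continuous_on_compose2[OF _ linear_imp_continuous_on[OF linear_reindex]]) simp
  have cf2: "continuous_on (?T ` S) (\<lambda>x. f (?T' (?g' x)))"
    by (rule continuous_on_compose2[OF cf linear_imp_continuous_on[OF linear_rank_one_update]]) simp
  have "integral (?g ` S) f = integral (?g' ` ?T ` S) (\<lambda>x. f (?T' x))"
    unfolding im by (rule integral_reindex_image[OF inv cg]) (use f im in simp)
  also have "\<dots> = \<bar>1 + ?T n \<bullet> ?T a\<bar> * integral (?T ` S) (\<lambda>x. f (?T' (?g' x)))"
    using integral_linear_image_real[OF linear_rank_one_update cT cf] by (simp add: det)
  also have "integral (?T ` S) (\<lambda>x. f (?T' (?g' x))) = integral S (\<lambda>x. f (?T' (?g' (?T x))))"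
    by (rule integral_reindex_image[OF \<sigma> S cf2])
  finally show ?thesis by (simp add: com'[symmetric] inner_reindex[OF \<sigma>])
qed

lemma integral_rank_one_update:
  fixes f :: "real^'d::finite \<Rightarrow> real"
  assumes d: "CARD('d) \<in> {2, 3}"
    and S: "compact S" and f: "continuous_on (rank_one_update n a ` S) f"
  shows "integral (rank_one_update n a ` S) f = \<bar>1 + n \<bullet> a\<bar> * integral S (\<lambda>x. f (rank_one_update n a x))"
proof -
  consider "CARD('d) = CARD(2)" | "CARD('d) = CARD(3)" using d by auto
  then show ?thesis
  proof cases
    case 1
    then obtain \<sigma> :: "2 \<Rightarrow> 'd" where "bij \<sigma>"
      using finite_same_card_bij[of "UNIV :: 2 set" "UNIV :: 'd set"] by auto
    from integral_rank_one_update_transfer[OF this det_rank_one_update_2 S f] show ?thesis .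
  next
    case 2
    then obtain \<sigma> :: "3 \<Rightarrow> 'd" where "bij \<sigma>"
      using finite_same_card_bij[of "UNIV :: 3 set" "UNIV :: 'd set"] by auto
    from integral_rank_one_update_transfer[OF this det_rank_one_update_3 S f] show ?thesis .
  qed
qed

section \<open>Divergence theorem on polytopal cells\<close>

lemma polytopal_compact:
  assumes "polytopal j S"
  shows "compact S"
  using assms unfolding polytopal_def by (metis compact_Union polytope_imp_compact)

lemma polytopal_nonempty:
  assumes "polytopal j S" "j \<ge> 0"
  shows "S \<noteq> {}"
proof -
  obtain P where P: "P \<noteq> {}" "\<forall>p\<in>P. aff_dim p = j" "S = \<Union>P"
    using assms(1) unfolding polytopal_def by auto
  then obtain p where "p \<in> P" "aff_dim p = j" by auto
  then have "p \<noteq> {}" using assms(2) by auto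
  then show ?thesis using P \<open>p \<in> P\<close> by auto
qed

lemma affine_hull_eq_hyperplane:
  fixes p :: "'a::euclidean_space set"
  assumes "n \<noteq> 0" "\<And>x. x \<in> p \<Longrightarrow> n \<bullet> x = c" "aff_dim p = int DIM('a) - 1" "p \<noteq> {}"
  shows "affine hull p = {x. n \<bullet> x = c}"
proof (rule affine_dim_equal)
  show "affine hull p \<subseteq> {x. n \<bullet> x = c}"
    using assms(2) by (intro hull_minimal affine_hyperplane) auto
  show "aff_dim (affine hull p) = aff_dim {x. n \<bullet> x = c}"
    using assms by simp
qed (use assms affine_hyperplane in auto)

lemma affine_hull_polytopal_face:
  fixes e :: "(real^'d) set"
  assumes "n \<noteq> 0" "\<And>x. x \<in> e \<Longrightarrow> n \<bullet> x = c" "polytopal (int CARD('d) - 1) e"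
  shows "affine hull e = {x. n \<bullet> x = c}"
proof -
  obtain P where P: "P \<noteq> {}" "\<forall>p\<in>P. polytope p \<and> aff_dim p = int CARD('d) - 1" "e = \<Union>P"
    using assms(3) unfolding polytopal_def by auto
  then obtain p where p: "p \<in> P" "aff_dim p = int CARD('d) - 1" by auto
  then have "p \<noteq> {}" by auto
  then have "affine hull p = {x. n \<bullet> x = c}"
    using p P assms by (intro affine_hull_eq_hyperplane) auto
  moreover have "affine hull p \<subseteq> affine hull e" using p P by (intro hull_mono) auto
  moreover have "affine hull e \<subseteq> {x. n \<bullet> x = c}"
    using assms(2) by (intro hull_minimal affine_hyperplane) auto
  ultimately show ?thesis by auto
qed

text \<open>Parallel lines through a set of codimension at least two stay in the affine hull of that
  set and one further point, which is at most a hyperplane.\<close>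

lemma negligible_line_bundle:
  fixes F :: "'a::euclidean_space set"
  assumes "aff_dim F \<le> int DIM('a) - 2"
  shows "negligible {y + s *\<^sub>R u | y s. y \<in> F}"
proof (cases "F = {}")
  case False
  then obtain y0 where y0: "y0 \<in> F" by auto
  let ?A = "affine hull (insert (y0 + u) F)"
  have "aff_dim ?A \<le> int DIM('a) - 1"
    using assms by (simp add: aff_dim_insert)
  then have "interior ?A = {}"
    using aff_dim_nonempty_interior[of ?A] by force
  then have "negligible ?A"
    by (simp add: negligible_convex_interior affine_imp_convex)
  moreover have "{y + s *\<^sub>R u | y s. y \<in> F} \<subseteq> ?A"
  proof clarify
    fix y s assume "y \<in> F"
    then have "y \<in> ?A" "y0 + u \<in> ?A" "y0 \<in> ?A" using y0 by (auto intro: hull_inc)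
    then have "y + s *\<^sub>R ((y0 + u) - y0) \<in> ?A"
      using mem_affine_3_minus[OF affine_affine_hull] by blast
    then show "y + s *\<^sub>R u \<in> ?A" by simp
  qed
  ultimately show ?thesis by (rule negligible_subset)
qed simp

text \<open>A face may be a nonconvex union of polytopes. All pieces span the same hyperplane, so a
  point that is relatively interior to one piece is so to the face; the rest of the face lies in the
  finitely many facets of the pieces.\<close>

lemma negligible_face_boundary_lines:
  fixes e :: "(real^'d) set"
  assumes n: "n \<noteq> 0" and c: "\<And>x. x \<in> e \<Longrightarrow> n \<bullet> x = c" and e: "polytopal (int CARD('d) - 1) e"
  shows "negligible {y + s *\<^sub>R u | y s. y \<in> e - rel_interior e}"
proof -
  obtain P where P: "finite P" "\<forall>p\<in>P. polytope p \<and> aff_dim p = int CARD('d) - 1" "e = \<Union>P"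
    using e unfolding polytopal_def by auto
  define FF where "FF = (\<Union>p\<in>P. {F. F facet_of p})"
  have "finite FF" using P unfolding FF_def by (auto intro: finite_polytope_facets)
  moreover have "negligible {y + s *\<^sub>R u | y s. y \<in> F}" if "F \<in> FF" for F
    using that P by (intro negligible_line_bundle) (auto simp: FF_def facet_of_def)
  ultimately have neg: "negligible (\<Union>F\<in>FF. {y + s *\<^sub>R u | y s. y \<in> F})"
    by (intro negligible_Union) auto
  have "y \<in> \<Union>FF" if y: "y \<in> e" "y \<notin> rel_interior e" for y
  proof -
    obtain p where p: "p \<in> P" "y \<in> p" using y P by auto
    have "affine hull p = {x. n \<bullet> x = c}"
      using p P c n by (intro affine_hull_eq_hyperplane) auto
    then have "affine hull p = affine hull e" using affine_hull_polytopal_face[OF n c e] by simp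
    then have "rel_interior p \<subseteq> rel_interior e" using p P by (intro subset_rel_interior) auto
    then have "y \<in> rel_frontier p"
      using y p closure_subset by (auto simp: rel_frontier_def)
    also have "rel_frontier p = \<Union>{F. F facet_of p}"
      using p P by (intro rel_frontier_of_polyhedron) (auto simp: polytope_imp_polyhedron)
    finally show ?thesis using p by (auto simp: FF_def)
  qed
  then have "{y + s *\<^sub>R u | y s. y \<in> e - rel_interior e} \<subseteq> (\<Union>F\<in>FF. {y + s *\<^sub>R u | y s. y \<in> F})"
    by blast
  with neg show ?thesis by (rule negligible_subset)
qed

text \<open>These are the points x for which the segment from x to x + w meets e; hence the minus
  sign.\<close>

definition oblique_prism :: "real^'d \<Rightarrow> (real^'d) set \<Rightarrow> (real^'d) set" where
  "oblique_prism w e = {y - s *\<^sub>R w | y s. y \<in> e \<and> 0 \<le> s \<and> s \<le> 1}"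

text \<open>Along a line that meets the boundary only in relative interior points of faces, the
  indicator of the cell jumps exactly at the crossing points; adding the jumps back gives a
  locally constant function on the line.\<close>

lemma indicator_cell_shift:
  fixes K :: "(real^'d) set"
  assumes K: "polytopal_cell K Fs N"
  shows "\<exists>Z. negligible Z \<and> (\<forall>x. x \<notin> Z \<longrightarrow>
    indicat_real K x - indicat_real K (x + u) =
      (\<Sum>e\<in>Fs. sgn (N e \<bullet> u) * indicat_real (oblique_prism u e) x))"
proof -
  have fin: "finite Fs" and fr: "\<Union>Fs = frontier K"
    and pe: "\<And>e. e \<in> Fs \<Longrightarrow> polytopal (int CARD('d) - 1) e"
    and on: "\<And>e. e \<in> Fs \<Longrightarrow> outward_unit_normal K e (N e)"
    and disj: "\<And>e e'. e \<in> Fs \<Longrightarrow> e' \<in> Fs \<Longrightarrow> e \<noteq> e' \<Longrightarrow> rel_interior e \<inter> rel_interior e' = {}"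
    using K unfolding polytopal_cell_def by auto
  have "\<forall>e\<in>Fs. \<exists>c. \<forall>x\<in>e. N e \<bullet> x = c" using on unfolding outward_unit_normal_def by blast
  then obtain c where c: "\<And>e x. e \<in> Fs \<Longrightarrow> x \<in> e \<Longrightarrow> N e \<bullet> x = c e" by metis
  have N0: "N e \<noteq> 0" if "e \<in> Fs" for e using on[OF that] unfolding outward_unit_normal_def by auto
  \<comment> \<open>Excluded are the lines through relative boundaries of faces, and the x for which
    x or x + u lies on the plane of a face. Crossings at the parameters 0 and 1 thus do not
    occur.\<close>
  define Z where "Z = (\<Union>e\<in>Fs. {y + s *\<^sub>R u | y s. y \<in> e - rel_interior e} \<union> {x. N e \<bullet> x = c e}
     \<union> {x. N e \<bullet> x = c e - N e \<bullet> u})"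
  have "negligible Z"
    unfolding Z_def
  proof (rule negligible_Union)
    fix A assume "A \<in> (\<lambda>e. {y + s *\<^sub>R u | y s. y \<in> e - rel_interior e} \<union> {x. N e \<bullet> x = c e}
     \<union> {x. N e \<bullet> x = c e - N e \<bullet> u}) ` Fs"
    then show "negligible A"
      using negligible_face_boundary_lines[OF N0 c pe] N0 by (auto intro!: negligible_hyperplane)
  qed (use fin in simp)
  moreover have "indicat_real K x - indicat_real K (x + u) =
      (\<Sum>e\<in>Fs. sgn (N e \<bullet> u) * indicat_real (oblique_prism u e) x)" if x: "x \<notin> Z" for x
  proof -
    define l where "l s = x + s *\<^sub>R u" for s
    have ri: "l s \<in> rel_interior e" if "e \<in> Fs" "l s \<in> e" for e s
    proof (rule ccontr)
      assume "l s \<notin> rel_interior e"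
      moreover have "x = l s + (- s) *\<^sub>R u" by (simp add: l_def)
      ultimately have "x \<in> Z" using that unfolding Z_def by blast
      then show False using x by simp
    qed
    define C where "C = {e\<in>Fs. \<exists>s. l s \<in> e}"
    define S where "S e = (c e - N e \<bullet> x) / (N e \<bullet> u)" for e
    \<comment> \<open>As x lies off the plane of e, a line through x that meets e crosses it
      transversally and only once.\<close>
    have Nu: "N e \<bullet> u \<noteq> 0" and lS: "l s \<in> e \<longleftrightarrow> s = S e" if e: "e \<in> C" for e s
    proof -
      have eF: "e \<in> Fs" using e by (simp add: C_def)
      have key: "N e \<bullet> x + s * (N e \<bullet> u) = c e" if "l s \<in> e" for s
        using c[OF eF that] by (simp add: l_def inner_add_right)
      have xc: "N e \<bullet> x \<noteq> c e" using x eF unfolding Z_def by auto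
      obtain s0 where s0: "l s0 \<in> e" using e by (auto simp: C_def)
      show nz: "N e \<bullet> u \<noteq> 0" using key[OF s0] xc by auto
      have "s = S e" if "l s \<in> e" for s using key[OF that] nz by (simp add: S_def field_simps)
      then show "l s \<in> e \<longleftrightarrow> s = S e" using s0 by metis
    qed
    \<comment> \<open>The cell contains its boundary, so the indicator is 1 at a crossing. An exit
      takes effect strictly after \<open>S e\<close>, an entry already at \<open>S e\<close>; hence
      one strict and one weak inequality.\<close>
    define H where "H e s = (if N e \<bullet> u > 0 then (if s > S e then 1 else 0) else (if s \<ge> S e then -1 else (0::real)))" for e s
    define \<Phi> where "\<Phi> s = indicat_real K (l s) + (\<Sum>e\<in>C. H e s)" for s
    have finC: "finite C" using fin by (simp add: C_def)
    have Hev: "\<forall>\<^sub>F s in nhds s0. H e s = H e s0" if "s0 \<noteq> S e" for e s0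
    proof (cases "s0 < S e")
      case True
      have "\<forall>\<^sub>F s in nhds s0. s < S e" using True by (rule order_tendstoD(2)[OF filterlim_ident])
      then show ?thesis by eventually_elim (use True in \<open>auto simp: H_def\<close>)
    next
      case False
      have "\<forall>\<^sub>F s in nhds s0. s > S e" using False that by (intro order_tendstoD(1)[OF filterlim_ident]) auto
      then show ?thesis by eventually_elim (use False that in \<open>auto simp: H_def\<close>)
    qed
    have tl: "(l \<longlongrightarrow> l s0) (nhds s0)" for s0
      unfolding l_def by (intro tendsto_intros filterlim_ident)
    have loc: "\<forall>\<^sub>F s in nhds s0. \<Phi> s = \<Phi> s0" for s0
    proof (cases "l s0 \<in> frontier K")
      case False
      have "\<forall>\<^sub>F s in nhds s0. \<forall>e\<in>C. H e s = H e s0"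
      proof (rule eventually_ball_finite[OF finC], rule ballI, rule Hev)
        fix e assume "e \<in> C"
        with False fr lS[OF this, of s0] show "s0 \<noteq> S e" by (auto simp: C_def)
      qed
      moreover have "\<forall>\<^sub>F s in nhds s0. indicat_real K (l s) = indicat_real K (l s0)"
      proof (cases "l s0 \<in> K")
        case True
        then have "l s0 \<in> interior K" using False closure_subset by (auto simp: frontier_def)
        then have "\<forall>\<^sub>F s in nhds s0. l s \<in> interior K" using topological_tendstoD[OF tl open_interior] by blast
        then show ?thesis by eventually_elim (use True interior_subset in \<open>auto simp: indicator_def\<close>)
      next
        case 2: False
        then have "l s0 \<in> - closure K" using False interior_subset by (auto simp: frontier_def)
        then have "\<forall>\<^sub>F s in nhds s0. l s \<in> - closure K" using topological_tendstoD[OF tl, of "- closure K"] by auto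
        then show ?thesis by eventually_elim (use 2 closure_subset in \<open>auto simp: indicator_def\<close>)
      qed
      ultimately show ?thesis by eventually_elim (simp add: \<Phi>_def)
    next
      case True
      then obtain e where e: "e \<in> Fs" "l s0 \<in> e" using fr by auto
      then have eC: "e \<in> C" by (auto simp: C_def)
      have s0: "s0 = S e" using lS[OF eC] e by auto
      have "\<forall>\<^sub>F s in nhds s0. \<forall>e'\<in>C - {e}. H e' s = H e' s0"
      proof (rule eventually_ball_finite, use finC in simp, rule ballI, rule Hev)
        fix e' assume e': "e' \<in> C - {e}"
        \<comment> \<open>No two faces are crossed at the same parameter: outside Z every hit is in
          a relative interior, and these are disjoint.\<close>
        show "s0 \<noteq> S e'"
        proof
          assume "s0 = S e'"
          then have "l s0 \<in> e'" using lS[of e' s0] e' by auto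
          then have "l s0 \<in> rel_interior e \<inter> rel_interior e'" using ri e e' by (auto simp: C_def)
          then show False using disj[of e e'] e e' by (auto simp: C_def)
        qed
      qed
      moreover obtain r where r: "r > 0" "K \<inter> ball (l s0) r = {y \<in> ball (l s0) r. N e \<bullet> (y - l s0) \<le> 0}"
        using on[OF e(1)] ri[OF e] unfolding outward_unit_normal_def by blast
      have "\<forall>\<^sub>F s in nhds s0. l s \<in> ball (l s0) r"
        using topological_tendstoD[OF tl open_ball, of s0 "l s0" r] r by simp
      then have "\<forall>\<^sub>F s in nhds s0. indicat_real K (l s) + H e s = indicat_real K (l s0) + H e s0"
      proof eventually_elim
        case (elim s)
        have lK: "l s' \<in> K \<longleftrightarrow> (s' - s0) * (N e \<bullet> u) \<le> 0" if "l s' \<in> ball (l s0) r" for s'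
        proof -
          have "l s' \<in> K \<longleftrightarrow> N e \<bullet> (l s' - l s0) \<le> 0" using that r(2) by blast
          also have "l s' - l s0 = (s' - s0) *\<^sub>R u" by (simp add: l_def algebra_simps)
          finally show ?thesis by simp
        qed
        have "l s0 \<in> K" using lK[of s0] r by simp
        then show ?case using lK[OF elim] Nu[OF eC] unfolding H_def s0
          by (auto simp: indicator_def mult_le_0_iff)
      qed
      ultimately show ?thesis
        unfolding \<Phi>_def sum.remove[OF finC eC, of "\<lambda>e. H e _"]
        by eventually_elim simp
    qed
    have "(\<Phi> has_real_derivative 0) (at s)" for s
      using loc[of s] DERIV_cong_ev[of s s \<Phi> "\<lambda>_. \<Phi> s" 0 0] by simp
    then have "\<Phi> 0 = \<Phi> 1" using DERIV_isconst_all by metis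
    then have "indicat_real K x - indicat_real K (x + u) = (\<Sum>e\<in>C. H e 1 - H e 0)"
      by (simp add: \<Phi>_def l_def sum_subtractf)
    also have "\<dots> = (\<Sum>e\<in>C. sgn (N e \<bullet> u) * indicat_real (oblique_prism u e) x)"
    proof (rule sum.cong[OF refl])
      fix e assume e: "e \<in> C"
      then have eF: "e \<in> Fs" by (simp add: C_def)
      have nz: "S e \<noteq> 0" "S e \<noteq> 1"
        using x eF Nu[OF e] unfolding Z_def S_def by (auto simp: field_simps)
      have "x \<in> oblique_prism u e \<longleftrightarrow> (\<exists>s. l s \<in> e \<and> 0 \<le> s \<and> s \<le> 1)"
      proof
        assume "x \<in> oblique_prism u e"
        then obtain y s where "x = y - s *\<^sub>R u" "y \<in> e" "0 \<le> s" "s \<le> 1" unfolding oblique_prism_def by blast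
        then show "\<exists>s. l s \<in> e \<and> 0 \<le> s \<and> s \<le> 1" by (intro exI[of _ s]) (simp add: l_def)
      next
        assume "\<exists>s. l s \<in> e \<and> 0 \<le> s \<and> s \<le> 1"
        then obtain s where "l s \<in> e" "0 \<le> s" "s \<le> 1" by blast
        moreover have "x = l s - s *\<^sub>R u" by (simp add: l_def)
        ultimately show "x \<in> oblique_prism u e" unfolding oblique_prism_def by blast
      qed
      then have "x \<in> oblique_prism u e \<longleftrightarrow> 0 \<le> S e \<and> S e \<le> 1" using lS[OF e] by auto
      then show "H e 1 - H e 0 = sgn (N e \<bullet> u) * indicat_real (oblique_prism u e) x"
        using nz Nu[OF e] by (auto simp: H_def indicator_def sgn_if)
    qed
    also have "\<dots> = (\<Sum>e\<in>Fs. sgn (N e \<bullet> u) * indicat_real (oblique_prism u e) x)"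
    proof (rule sum.mono_neutral_left[OF fin])
      show "\<forall>e\<in>Fs - C. sgn (N e \<bullet> u) * indicat_real (oblique_prism u e) x = 0"
      proof
        fix e assume e: "e \<in> Fs - C"
        have "x \<notin> oblique_prism u e"
        proof
          assume "x \<in> oblique_prism u e"
          then obtain y s where "x = y - s *\<^sub>R u" "y \<in> e" unfolding oblique_prism_def by blast
          then have "l s \<in> e" by (simp add: l_def)
          then show False using e by (auto simp: C_def)
        qed
        then show "sgn (N e \<bullet> u) * indicat_real (oblique_prism u e) x = 0" by simp
      qed
    qed (auto simp: C_def)
    finally show ?thesis .
  qed
  ultimately show ?thesis by blast
qed

section \<open>Integrals over oblique prisms and over the shifted cell\<close>

lemma compact_prism:
  assumes "compact e"
  shows "compact (prism n e)"
proof -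
  have "prism n e = (\<lambda>(y, t). y + t *\<^sub>R n) ` (e \<times> {0..1})"
    by (auto simp: prism_def image_iff) blast
  then show ?thesis using assms
    by (auto intro!: compact_continuous_image compact_Times continuous_intros simp: split_def)
qed

text \<open>The map sending x to x - (n . x - c)(n + w) fixes the plane n . x = c and takes y + r n
  to y - r w for y in that plane.\<close>

lemma oblique_prism_eq_image:
  assumes "norm n = 1" "\<And>x. x \<in> e \<Longrightarrow> n \<bullet> x = c"
  shows "oblique_prism w e = (+) (c *\<^sub>R (n + w)) ` rank_one_update n (- (n + w)) ` prism n e"
proof -
  have nn: "n \<bullet> n = 1" using assms(1) by (simp add: norm_eq_1)
  have *: "c *\<^sub>R (n + w) + rank_one_update n (- (n + w)) (y + r *\<^sub>R n) = y - r *\<^sub>R w"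
    if "y \<in> e" for y r
    using that assms(2) nn by (simp add: rank_one_update_def inner_add_right algebra_simps)
  show ?thesis
  proof (intro equalityI subsetI)
    fix x assume "x \<in> oblique_prism w e"
    then obtain y r where "x = y - r *\<^sub>R w" "y \<in> e" "0 \<le> r" "r \<le> 1" by (auto simp: oblique_prism_def)
    moreover from this have "y + r *\<^sub>R n \<in> prism n e" by (auto simp: prism_def)
    ultimately show "x \<in> (+) (c *\<^sub>R (n + w)) ` rank_one_update n (- (n + w)) ` prism n e"
      using *[of y r] by (metis imageI)
  next
    fix x assume "x \<in> (+) (c *\<^sub>R (n + w)) ` rank_one_update n (- (n + w)) ` prism n e"
    then obtain y r where "y \<in> e" "0 \<le> r" "r \<le> 1"
      "x = c *\<^sub>R (n + w) + rank_one_update n (- (n + w)) (y + r *\<^sub>R n)"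
      by (auto simp: prism_def)
    then show "x \<in> oblique_prism w e" using * by (auto simp: oblique_prism_def)
  qed
qed

text \<open>The Jacobian is 1 - n . (n + w) = - n . w. If n . w = 0, the oblique prism is contained
  in the plane of the face and both sides vanish.\<close>

lemma
  fixes f :: "real^'d::finite \<Rightarrow> real"
  assumes d: "CARD('d) \<in> {2, 3}" and n: "norm n = 1" and c: "\<And>x. x \<in> e \<Longrightarrow> n \<bullet> x = c"
    and e: "compact e" and f: "continuous_on UNIV f"
  shows compact_oblique_prism: "compact (oblique_prism w e)"
    and integral_oblique_prism: "integral (oblique_prism w e) f =
      \<bar>n \<bullet> w\<bar> * integral (prism n e) (\<lambda>x. f (x - (n \<bullet> x - c) *\<^sub>R (n + w)))"
proof -
  let ?g = "rank_one_update n (- (n + w))" and ?k = "c *\<^sub>R (n + w)"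
  have nn: "n \<bullet> n = 1" using n by (simp add: norm_eq_1)
  have P: "compact (prism n e)" using e by (rule compact_prism)
  have eq: "oblique_prism w e = (+) ?k ` ?g ` prism n e"
    using n c by (rule oblique_prism_eq_image)
  have gP: "compact (?g ` prism n e)"
    by (rule compact_continuous_image[OF linear_imp_continuous_on[OF linear_rank_one_update] P])
  have f1: "continuous_on A (\<lambda>x. f (?k + x))" for A
    by (rule continuous_on_compose2[OF f]) (auto intro!: continuous_intros)
  show "compact (oblique_prism w e)"
    unfolding eq by (rule compact_translation[OF gP])
  have "integral (oblique_prism w e) f = integral (?g ` prism n e) (\<lambda>x. f (?k + x))"
    unfolding eq
    by (rule integral_translate_image[OF gP]) (use f continuous_on_subset in blast)
  also have "\<dots> = \<bar>1 + n \<bullet> (- (n + w))\<bar> * integral (prism n e) (\<lambda>x. f (?k + ?g x))"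
    by (rule integral_rank_one_update[OF d P f1])
  also have "\<bar>1 + n \<bullet> (- (n + w))\<bar> = \<bar>n \<bullet> w\<bar>" by (simp add: inner_add_right inner_diff_right nn)
  also have "(\<lambda>x. f (?k + ?g x)) = (\<lambda>x. f (x - (n \<bullet> x - c) *\<^sub>R (n + w)))"
    by (simp add: rank_one_update_def algebra_simps)
  finally show "integral (oblique_prism w e) f =
      \<bar>n \<bullet> w\<bar> * integral (prism n e) (\<lambda>x. f (x - (n \<bullet> x - c) *\<^sub>R (n + w)))" .
qed

lemma closest_point_hyperplane:
  fixes n :: "'a::euclidean_space"
  assumes "norm n = 1"
  shows "closest_point {x. n \<bullet> x = c} x = x - (n \<bullet> x - c) *\<^sub>R n"
proof (rule closest_point_unique[symmetric])
  have nn: "n \<bullet> n = 1" using assms by (simp add: norm_eq_1)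
  show "x - (n \<bullet> x - c) *\<^sub>R n \<in> {x. n \<bullet> x = c}" by (simp add: inner_diff_right nn)
  show "\<forall>z\<in>{x. n \<bullet> x = c}. dist x (x - (n \<bullet> x - c) *\<^sub>R n) \<le> dist x z"
  proof clarify
    fix z assume "c = n \<bullet> z"
    then have "\<bar>n \<bullet> x - c\<bar> = \<bar>n \<bullet> (x - z)\<bar>" by (simp add: inner_diff_right)
    also have "\<dots> \<le> norm (x - z)" using Cauchy_Schwarz_ineq2[of n "x - z"] assms by simp
    finally show "dist x (x - (n \<bullet> x - n \<bullet> z) *\<^sub>R n) \<le> dist x z" using assms \<open>c = n \<bullet> z\<close>
      by (simp add: dist_norm)
  qed
qed (auto intro: convex_hyperplane closed_hyperplane)

text \<open>The indicator identity integrated against g, with the shift of the cell moved to the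
  argument of g. The sign of N e . w and the Jacobian combine to the factor N e . w, which survives
  division by the length of w in the limit.\<close>

lemma integral_cell_shift:
  fixes K :: "(real^'d) set" and g :: "real^'d \<Rightarrow> real"
  assumes d: "CARD('d) \<in> {2, 3}" and K: "polytopal_cell K Fs N"
    and c: "\<And>e x. e \<in> Fs \<Longrightarrow> x \<in> e \<Longrightarrow> N e \<bullet> x = c e" and g: "continuous_on UNIV g"
  shows "integral K (\<lambda>x. g x - g (x - w)) =
    (\<Sum>e\<in>Fs. (N e \<bullet> w) * integral (prism (N e) e) (\<lambda>x. g (x - (N e \<bullet> x - c e) *\<^sub>R (N e + w))))"
proof -
  have fin: "finite Fs" and Kp: "polytopal (int CARD('d)) K"
    and pe: "\<And>e. e \<in> Fs \<Longrightarrow> polytopal (int CARD('d) - 1) e"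
    and on: "\<And>e. e \<in> Fs \<Longrightarrow> outward_unit_normal K e (N e)"
    using K unfolding polytopal_cell_def by auto
  have n1: "norm (N e) = 1" if "e \<in> Fs" for e using on[OF that] unfolding outward_unit_normal_def by auto
  have gS: "continuous_on S g" for S using g continuous_on_subset by blast
  have gs: "continuous_on S (\<lambda>x. g (x - w))" for S
    by (rule continuous_on_compose2[OF g]) (auto intro!: continuous_intros)
  have cK: "compact K" using Kp by (rule polytopal_compact)
  have ind: "((\<lambda>x. indicat_real S x * g x) has_integral integral S g) UNIV" if "compact S" for S
  proof -
    have "(\<lambda>x. indicat_real S x * g x) = (\<lambda>x. if x \<in> S then g x else 0)" by (auto simp: indicator_def)
    then show ?thesis
      using continuous_imp_integrable_on_compact(2)[OF that gS]
      by (simp only: has_integral_restrict_UNIV) (rule integrable_integral)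
  qed
  let ?Kw = "(+) (- w) ` K"
  have iw: "indicat_real ?Kw x = indicat_real K (x + w)" for x
  proof -
    have "x \<in> ?Kw \<longleftrightarrow> x + w \<in> K" by (auto intro: image_eqI[of _ _ "x + w"])
    then show ?thesis by (simp add: indicator_def)
  qed
  have "((\<lambda>x. indicat_real K x * g x - indicat_real ?Kw x * g x) has_integral integral K g - integral ?Kw g) UNIV"
    by (intro has_integral_diff ind cK compact_translation)
  also have "integral ?Kw g = integral K (\<lambda>x. g (x - w))"
    using integral_translate_image[OF cK gS, of "- w"] by simp
  also have "integral K g - integral K (\<lambda>x. g (x - w)) = integral K (\<lambda>x. g x - g (x - w))"
    by (rule Henstock_Kurzweil_Integration.integral_diff[symmetric])
      (auto intro!: continuous_imp_integrable_on_compact(2) cK gS gs)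
  finally have L: "((\<lambda>x. indicat_real K x * g x - indicat_real ?Kw x * g x) has_integral
    integral K (\<lambda>x. g x - g (x - w))) UNIV" .
  obtain Z where Z: "negligible Z" "\<And>x. x \<notin> Z \<Longrightarrow>
    indicat_real K x - indicat_real K (x + w) =
      (\<Sum>e\<in>Fs. sgn (N e \<bullet> w) * indicat_real (oblique_prism w e) x)"
    using indicator_cell_shift[OF K, of w] by blast
  have "((\<lambda>x. \<Sum>e\<in>Fs. sgn (N e \<bullet> w) * (indicat_real (oblique_prism w e) x * g x)) has_integral
    (\<Sum>e\<in>Fs. sgn (N e \<bullet> w) * integral (oblique_prism w e) g)) UNIV"
    using compact_oblique_prism[OF d n1 c polytopal_compact[OF pe] g]
    by (intro has_integral_sum fin has_integral_mult_right ind) auto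
  then have "((\<lambda>x. indicat_real K x * g x - indicat_real ?Kw x * g x) has_integral
    (\<Sum>e\<in>Fs. sgn (N e \<bullet> w) * integral (oblique_prism w e) g)) UNIV"
  proof (rule has_integral_spike[OF Z(1), rotated])
    fix x assume "x \<in> UNIV - Z"
    then have "(indicat_real K x - indicat_real K (x + w)) * g x =
      (\<Sum>e\<in>Fs. sgn (N e \<bullet> w) * indicat_real (oblique_prism w e) x) * g x" using Z(2) by simp
    then show "indicat_real K x * g x - indicat_real ?Kw x * g x =
      (\<Sum>e\<in>Fs. sgn (N e \<bullet> w) * (indicat_real (oblique_prism w e) x * g x))"
      unfolding iw by (simp add: sum_distrib_right left_diff_distrib mult.assoc)
  qed
  with L have "integral K (\<lambda>x. g x - g (x - w)) = (\<Sum>e\<in>Fs. sgn (N e \<bullet> w) * integral (oblique_prism w e) g)"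
    by (rule has_integral_unique)
  also have "\<dots> = (\<Sum>e\<in>Fs. (N e \<bullet> w) * integral (prism (N e) e) (\<lambda>x. g (x - (N e \<bullet> x - c e) *\<^sub>R (N e + w))))"
  proof (rule sum.cong[OF refl])
    fix e assume e: "e \<in> Fs"
    have "integral (oblique_prism w e) g =
      \<bar>N e \<bullet> w\<bar> * integral (prism (N e) e) (\<lambda>x. g (x - (N e \<bullet> x - c e) *\<^sub>R (N e + w)))"
      using d n1[OF e] c[OF e] polytopal_compact[OF pe[OF e]] g by (rule integral_oblique_prism)
    moreover have "sgn (N e \<bullet> w) * (\<bar>N e \<bullet> w\<bar> * I) = (N e \<bullet> w) * I" for I
      by (simp add: sgn_mult_abs mult.assoc[symmetric])
    ultimately show "sgn (N e \<bullet> w) * integral (oblique_prism w e) g =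
      (N e \<bullet> w) * integral (prism (N e) e) (\<lambda>x. g (x - (N e \<bullet> x - c e) *\<^sub>R (N e + w)))"
      by simp
  qed
  finally show ?thesis .
qed

lemma bounded_on_segment_image:
  fixes h :: "'a::euclidean_space \<Rightarrow> real \<Rightarrow> real"
  assumes "compact S" "continuous_on (S \<times> {0..1}) (\<lambda>(x, t). h x t)"
  shows "\<exists>B. \<forall>x\<in>S. \<forall>t\<in>{0..1}. \<bar>h x t\<bar> \<le> B"
proof -
  have "bounded ((\<lambda>(x, t). h x t) ` (S \<times> {0..1}))"
    using assms by (intro compact_imp_bounded compact_continuous_image compact_Times) auto
  then obtain B where "B > 0" "\<forall>y\<in>(\<lambda>(x, t). h x t) ` (S \<times> {0..1}). norm y \<le> B"
    by (auto simp: bounded_pos)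
  then show ?thesis by auto
qed

theorem divergence_theorem_cell:
  fixes K :: "(real^'d) set" and g :: "real^'d \<Rightarrow> real"
  assumes d: "CARD('d) \<in> {2, 3}" and K: "polytopal_cell K Fs N"
    and G: "\<And>x. (g has_derivative (\<lambda>h. G x \<bullet> h)) (at x)" "continuous_on UNIV G"
  shows "integral K (\<lambda>x. G x \<bullet> u) = (\<Sum>e\<in>Fs. (N e \<bullet> u) * face_integral (N e) e g)"
proof -
  have Kp: "polytopal (int CARD('d)) K"
    and pe: "\<And>e. e \<in> Fs \<Longrightarrow> polytopal (int CARD('d) - 1) e"
    and on: "\<And>e. e \<in> Fs \<Longrightarrow> outward_unit_normal K e (N e)"
    using K unfolding polytopal_cell_def by auto
  have "\<forall>e\<in>Fs. \<exists>c. \<forall>x\<in>e. N e \<bullet> x = c" using on unfolding outward_unit_normal_def by blast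
  then obtain c where c: "\<And>e x. e \<in> Fs \<Longrightarrow> x \<in> e \<Longrightarrow> N e \<bullet> x = c e" by metis
  have n1: "norm (N e) = 1" if "e \<in> Fs" for e using on[OF that] unfolding outward_unit_normal_def by auto
  have cg: "continuous_on UNIV g"
    using G(1) has_derivative_continuous by (intro continuous_at_imp_continuous_on) blast
  have cK: "compact K" using Kp by (rule polytopal_compact)
  \<comment> \<open>A sequence of step lengths in (0, 1], because dominated convergence is applied
    to sequences.\<close>
  define t where "t k = 1 / real (Suc k)" for k
  have t: "0 < t k" "t k \<le> 1" for k by (auto simp: t_def)
  have t0: "t \<longlonglongrightarrow> 0" unfolding t_def using LIMSEQ_Suc[OF lim_1_over_n] by simp
  have tnz: "t k \<noteq> 0" for k using t(1)[of k] by simp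
  have tat: "filterlim t (at 0) sequentially"
    unfolding filterlim_at using t0 tnz by (simp add: always_eventually)
  have line: "((\<lambda>s. g (x - s *\<^sub>R u)) has_real_derivative - (G (x - s *\<^sub>R u) \<bullet> u)) (at s)" for x s
  proof -
    have "((\<lambda>s. g (x - s *\<^sub>R u)) has_derivative (\<lambda>h. G (x - s *\<^sub>R u) \<bullet> (- (h *\<^sub>R u)))) (at s)"
      by (rule has_derivative_compose[OF _ G(1)]) (auto intro!: derivative_eq_intros)
    moreover have "(\<lambda>h. G (x - s *\<^sub>R u) \<bullet> (- (h *\<^sub>R u))) = (*) (- (G (x - s *\<^sub>R u) \<bullet> u))"
      by (auto simp: fun_eq_iff)
    ultimately show ?thesis by (simp add: has_field_derivative_def)
  qed
  have lhs: "(\<lambda>k. integral K (\<lambda>x. (g x - g (x - t k *\<^sub>R u)) / t k)) \<longlonglongrightarrow> integral K (\<lambda>x. G x \<bullet> u)"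
  proof -
    have cont: "continuous_on (K \<times> {0..1}) (\<lambda>(x, s). G (x - s *\<^sub>R u) \<bullet> u)"
      unfolding split_def by (intro continuous_intros continuous_on_compose2[OF G(2)]) auto
    obtain B where B: "\<forall>x\<in>K. \<forall>s\<in>{0..1}. \<bar>G (x - s *\<^sub>R u) \<bullet> u\<bar> \<le> B"
      using bounded_on_segment_image[OF cK cont] by blast
    show ?thesis
    proof (rule dominated_convergence(2)[where h = "\<lambda>_. B"])
      show "(\<lambda>x. (g x - g (x - t k *\<^sub>R u)) / t k) integrable_on K" for k
        using t[of k] by (intro continuous_imp_integrable_on_compact cK continuous_intros
          continuous_on_compose2[OF cg]) auto
      show "(\<lambda>_. B) integrable_on K" by (intro continuous_imp_integrable_on_compact cK continuous_intros)
    next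
      fix k x assume x: "x \<in> K"
      \<comment> \<open>By the mean value theorem the difference quotient is a value of the
        derivative at some s between 0 and t k, so the bound \<open>B\<close> over [0, 1] serves
        every k.\<close>
      obtain s where s: "0 < s" "s < t k" "g (x - t k *\<^sub>R u) - g (x - 0 *\<^sub>R u) = (t k - 0) * - (G (x - s *\<^sub>R u) \<bullet> u)"
        using MVT2[of 0 "t k" "\<lambda>s. g (x - s *\<^sub>R u)" "\<lambda>s. - (G (x - s *\<^sub>R u) \<bullet> u)"] line t by blast
      then have "(g x - g (x - t k *\<^sub>R u)) / t k = G (x - s *\<^sub>R u) \<bullet> u"
        using t[of k] by (simp add: field_simps)
      then show "norm ((g x - g (x - t k *\<^sub>R u)) / t k) \<le> B" using B x s t[of k] by simp
    next
      fix x assume "x \<in> K"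
      have "((\<lambda>s. (g (x - s *\<^sub>R u) - g (x - 0 *\<^sub>R u)) / (s - 0)) \<longlongrightarrow> - (G (x - 0 *\<^sub>R u) \<bullet> u)) (at 0)"
        by (rule line[of x 0, unfolded has_field_derivative_iff])
      from filterlim_compose[OF this tat]
      have "(\<lambda>k. (g (x - t k *\<^sub>R u) - g (x - 0 *\<^sub>R u)) / (t k - 0)) \<longlonglongrightarrow> - (G (x - 0 *\<^sub>R u) \<bullet> u)" .
      then have "((\<lambda>k. - ((g (x - t k *\<^sub>R u) - g x) / t k)) \<longlonglongrightarrow> - (- (G x \<bullet> u)))"
        by (intro tendsto_minus) simp
      then show "(\<lambda>k. (g x - g (x - t k *\<^sub>R u)) / t k) \<longlonglongrightarrow> G x \<bullet> u"
        by (simp add: minus_divide_left)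
    qed
  qed
  have face: "(\<lambda>k. integral (prism (N e) e) (\<lambda>x. g (x - (N e \<bullet> x - c e) *\<^sub>R (N e + t k *\<^sub>R u))))
    \<longlonglongrightarrow> face_integral (N e) e g" if e: "e \<in> Fs" for e
  proof -
    have P: "compact (prism (N e) e)" using pe[OF e] by (intro compact_prism polytopal_compact)
    have cont: "continuous_on (prism (N e) e \<times> {0..1}) (\<lambda>(x, s). g (x - (N e \<bullet> x - c e) *\<^sub>R (N e + s *\<^sub>R u)))"
      unfolding split_def by (intro continuous_on_compose2[OF cg] continuous_intros) auto
    obtain B where B: "\<forall>x\<in>prism (N e) e. \<forall>s\<in>{0..1}.
      \<bar>g (x - (N e \<bullet> x - c e) *\<^sub>R (N e + s *\<^sub>R u))\<bar> \<le> B"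
      using bounded_on_segment_image[OF P cont] by blast
    have "affine hull e = {x. N e \<bullet> x = c e}"
      using n1[OF e] by (intro affine_hull_polytopal_face c[OF e] pe[OF e]) auto
    then have cp: "closest_point (affine hull e) x = x - (N e \<bullet> x - c e) *\<^sub>R N e" for x
      using closest_point_hyperplane[OF n1[OF e]] by simp
    show ?thesis
      unfolding face_integral_def cp
    proof (rule dominated_convergence(2)[where h = "\<lambda>_. B"])
      show "(\<lambda>x. g (x - (N e \<bullet> x - c e) *\<^sub>R (N e + t k *\<^sub>R u))) integrable_on prism (N e) e" for k
        by (intro continuous_imp_integrable_on_compact P continuous_on_compose2[OF cg] continuous_intros) auto
      show "(\<lambda>_. B) integrable_on prism (N e) e" by (intro continuous_imp_integrable_on_compact P continuous_intros)
      show "norm (g (x - (N e \<bullet> x - c e) *\<^sub>R (N e + t k *\<^sub>R u))) \<le> B" if "x \<in> prism (N e) e" for k x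
        using B that t[of k] by simp
      fix x
      \<comment> \<open>The evaluation point tends to the orthogonal projection of x onto the plane
        of e, the closest point that \<open>face_integral\<close> uses.\<close>
      have "isCont g (x - (N e \<bullet> x - c e) *\<^sub>R N e)" using cg continuous_on_eq_continuous_at open_UNIV by blast
      moreover have "(\<lambda>k. x - (N e \<bullet> x - c e) *\<^sub>R (N e + t k *\<^sub>R u)) \<longlonglongrightarrow> x - (N e \<bullet> x - c e) *\<^sub>R (N e + 0 *\<^sub>R u)"
        by (intro tendsto_intros t0)
      ultimately show "(\<lambda>k. g (x - (N e \<bullet> x - c e) *\<^sub>R (N e + t k *\<^sub>R u))) \<longlonglongrightarrow> g (x - (N e \<bullet> x - c e) *\<^sub>R N e)"
        by (auto intro: isCont_tendsto_compose)
    qed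
  qed
  have "integral K (\<lambda>x. (g x - g (x - t k *\<^sub>R u)) / t k) =
    (\<Sum>e\<in>Fs. (N e \<bullet> u) * integral (prism (N e) e) (\<lambda>x. g (x - (N e \<bullet> x - c e) *\<^sub>R (N e + t k *\<^sub>R u))))" for k
    using integral_cell_shift[OF d K c cg, of "t k *\<^sub>R u"] t[of k]
    by (simp add: sum_distrib_left[symmetric] mult.assoc)
  then have "(\<lambda>k. integral K (\<lambda>x. (g x - g (x - t k *\<^sub>R u)) / t k)) \<longlonglongrightarrow> (\<Sum>e\<in>Fs. (N e \<bullet> u) * face_integral (N e) e g)"
    by (simp only:) (intro tendsto_intros face)
  with lhs show ?thesis by (rule LIMSEQ_unique)
qed

section \<open>Continuous gradients of polynomials\<close>

definition has_continuous_gradient :: "(real^'d::finite \<Rightarrow> real) \<Rightarrow> bool" where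
  "has_continuous_gradient g \<longleftrightarrow>
    (\<exists>G. continuous_on UNIV G \<and> (\<forall>x. (g has_derivative (\<lambda>h. G x \<bullet> h)) (at x)))"

lemma has_continuous_gradient_imp_continuous:
  assumes "has_continuous_gradient g"
  shows "continuous_on S g"
  using assms has_derivative_continuous unfolding has_continuous_gradient_def
  by (intro continuous_at_imp_continuous_on) blast

lemma has_continuous_gradient_const: "has_continuous_gradient (\<lambda>x :: real^'d::finite. c)"
proof -
  have *: "((\<lambda>x. c) has_derivative (\<lambda>h. 0 \<bullet> h)) (at x)" for x :: "real^'d"
    by (rule has_derivative_eq_rhs[OF has_derivative_const]) (simp add: fun_eq_iff)
  show ?thesis
    unfolding has_continuous_gradient_def
    by (rule exI[of _ "\<lambda>x. 0"]) (intro conjI allI continuous_on_const *)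
qed

lemma has_continuous_gradient_component: "has_continuous_gradient (\<lambda>x :: real^'d::finite. x $ i)"
proof -
  have "((\<lambda>x. x $ i) has_derivative (\<lambda>h. axis i 1 \<bullet> h)) (at x)" for x :: "real^'d"
    using bounded_linear_imp_has_derivative[OF bounded_linear_vec_nth[of i]]
    by (simp add: inner_axis')
  then show ?thesis
    unfolding has_continuous_gradient_def by (intro exI[of _ "\<lambda>x. axis i 1"]) auto
qed

lemma has_continuous_gradient_add:
  assumes "has_continuous_gradient f" "has_continuous_gradient g"
  shows "has_continuous_gradient (\<lambda>x. f x + g x)"
proof -
  obtain F G where "continuous_on UNIV F" "\<And>x. (f has_derivative (\<lambda>h. F x \<bullet> h)) (at x)"
    "continuous_on UNIV G" "\<And>x. (g has_derivative (\<lambda>h. G x \<bullet> h)) (at x)"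
    using assms unfolding has_continuous_gradient_def by blast
  then have "continuous_on UNIV (\<lambda>x. F x + G x)"
    "\<And>x. ((\<lambda>x. f x + g x) has_derivative (\<lambda>h. (F x + G x) \<bullet> h)) (at x)"
    by (auto simp: inner_add_left intro!: continuous_intros has_derivative_add)
  then show ?thesis unfolding has_continuous_gradient_def by blast
qed

lemma has_continuous_gradient_mult:
  assumes "has_continuous_gradient f" "has_continuous_gradient g"
  shows "has_continuous_gradient (\<lambda>x. f x * g x)"
proof -
  obtain F G where FG: "continuous_on UNIV F" "\<And>x. (f has_derivative (\<lambda>h. F x \<bullet> h)) (at x)"
    "continuous_on UNIV G" "\<And>x. (g has_derivative (\<lambda>h. G x \<bullet> h)) (at x)"
    using assms unfolding has_continuous_gradient_def by blast
  have "((\<lambda>x. f x * g x) has_derivative (\<lambda>h. (f x *\<^sub>R G x + g x *\<^sub>R F x) \<bullet> h)) (at x)" for x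
    using has_derivative_mult[OF FG(2) FG(4), of x] by (simp add: inner_add_left mult.commute)
  moreover have "continuous_on UNIV (\<lambda>x. f x *\<^sub>R G x + g x *\<^sub>R F x)"
    using FG assms by (intro continuous_intros has_continuous_gradient_imp_continuous) auto
  ultimately show ?thesis unfolding has_continuous_gradient_def by blast
qed

lemma has_continuous_gradient_sum:
  assumes "\<And>a. a \<in> A \<Longrightarrow> has_continuous_gradient (f a)"
  shows "has_continuous_gradient (\<lambda>x. \<Sum>a\<in>A. f a x)"
  using assms
  by (induction A rule: infinite_finite_induct)
    (auto intro: has_continuous_gradient_const has_continuous_gradient_add)

lemma has_continuous_gradient_prod:
  assumes "\<And>a. a \<in> A \<Longrightarrow> has_continuous_gradient (f a)"
  shows "has_continuous_gradient (\<lambda>x. \<Prod>a\<in>A. f a x)"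
  using assms
  by (induction A rule: infinite_finite_induct)
    (auto intro: has_continuous_gradient_const has_continuous_gradient_mult)

lemma has_continuous_gradient_power:
  assumes "has_continuous_gradient f"
  shows "has_continuous_gradient (\<lambda>x. f x ^ m)"
  using assms
  by (induction m) (auto intro: has_continuous_gradient_const has_continuous_gradient_mult)

lemma poly_deg_has_continuous_gradient:
  assumes "poly_deg k g"
  shows "has_continuous_gradient g"
proof -
  obtain c where "g = (\<lambda>x. \<Sum>a\<in>{a. (\<Sum>i\<in>UNIV. a i) \<le> k}. c a * (\<Prod>i\<in>UNIV. (x $ i) ^ a i))"
    using assms unfolding poly_deg_def by (auto simp: fun_eq_iff)
  then show ?thesis
    by (auto intro!: has_continuous_gradient_sum has_continuous_gradient_mult
        has_continuous_gradient_const has_continuous_gradient_prod has_continuous_gradient_power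
        has_continuous_gradient_component)
qed

section \<open>Positive volumes and face areas\<close>

lemma aff_dim_full_interior:
  fixes p :: "'a::euclidean_space set"
  assumes "convex p" "aff_dim p = int DIM('a)"
  shows "interior p \<noteq> {}"
proof
  assume "interior p = {}"
  then obtain a b where a: "a \<noteq> 0" "p \<subseteq> {x. a \<bullet> x = b}"
    using empty_interior_subset_hyperplane[OF assms(1)] by metis
  then have "aff_dim p \<le> int DIM('a) - 1" using aff_dim_subset[OF a(2)] by simp
  then show False using assms(2) by simp
qed

lemma measure_pos_of_convex_subset:
  fixes S :: "'a::euclidean_space set"
  assumes "compact S" "convex T" "interior T \<noteq> {}" "T \<subseteq> S"
  shows "measure lebesgue S > 0"
proof -
  have "\<not> negligible T" using assms negligible_convex_interior by blast
  then have "\<not> negligible S" using assms(4) negligible_subset by blast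
  then show ?thesis
    using negligible_iff_measure0[OF lmeasurable_compact[OF assms(1)]]
    by (simp add: zero_less_measure_iff less_le)
qed

lemma cell_volume_pos:
  fixes K :: "(real^'d) set"
  assumes "polytopal (int CARD('d)) K"
  shows "cell_volume K > 0"
proof -
  obtain P where P: "P \<noteq> {}" "\<forall>p\<in>P. polytope p \<and> aff_dim p = int CARD('d)" "K = \<Union>P"
    using assms unfolding polytopal_def by auto
  then obtain p where p: "p \<in> P" "polytope p" "aff_dim p = int CARD('d)" by auto
  show ?thesis unfolding cell_volume_def
    using p P aff_dim_full_interior[of p] polytope_imp_convex[of p]
    by (intro measure_pos_of_convex_subset[of K p] polytopal_compact[OF assms]) auto
qed

text \<open>It suffices to look at the prism over one convex piece: it is convex, so it has positive
  measure unless it lies in a hyperplane, and it extends in all directions of the plane of the piece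
  and along n.\<close>

lemma face_area_pos:
  fixes e :: "(real^'d) set"
  assumes e: "polytopal (int CARD('d) - 1) e" and n: "norm n = 1" and c: "\<And>x. x \<in> e \<Longrightarrow> n \<bullet> x = c"
  shows "face_area n e > 0"
proof -
  obtain P where P: "P \<noteq> {}" "\<forall>p\<in>P. polytope p \<and> aff_dim p = int CARD('d) - 1" "e = \<Union>P"
    using e unfolding polytopal_def by auto
  then obtain p where p: "p \<in> P" "polytope p" "aff_dim p = int CARD('d) - 1" by auto
  then have "p \<noteq> {}" by auto
  then obtain x0 where x0: "x0 \<in> p" by auto
  have n0: "n \<noteq> 0" using n by auto
  have hull: "affine hull p = {x. n \<bullet> x = c}"
    using p P c n0 x0 by (intro affine_hull_eq_hyperplane) auto
  have conv: "convex (prism n p)"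
  proof (rule convexI)
    fix x y :: "real^'d" and u v :: real
    assume x: "x \<in> prism n p" and y: "y \<in> prism n p" and uv: "0 \<le> u" "0 \<le> v" "u + v = 1"
    obtain a s where a: "x = a + s *\<^sub>R n" "a \<in> p" "0 \<le> s" "s \<le> 1" using x by (auto simp: prism_def)
    obtain b t where b: "y = b + t *\<^sub>R n" "b \<in> p" "0 \<le> t" "t \<le> 1" using y by (auto simp: prism_def)
    have "u *\<^sub>R x + v *\<^sub>R y = (u *\<^sub>R a + v *\<^sub>R b) + (u * s + v * t) *\<^sub>R n"
      by (simp add: a b algebra_simps)
    moreover have "u *\<^sub>R a + v *\<^sub>R b \<in> p" using polytope_imp_convex[OF p(2)] a b uv by (auto dest: convexD)
    moreover have "u * s + v * t \<le> 1" using a b uv by (intro convex_bound_le) auto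
    moreover have "0 \<le> u * s + v * t" using a b uv by simp
    ultimately show "u *\<^sub>R x + v *\<^sub>R y \<in> prism n p" unfolding prism_def by blast
  qed
  have "interior (prism n p) \<noteq> {}"
  proof
    assume "interior (prism n p) = {}"
    then obtain a b where a: "a \<noteq> 0" "prism n p \<subseteq> {x. a \<bullet> x = b}"
      using empty_interior_subset_hyperplane[OF conv] by metis
    have in1: "y + t *\<^sub>R n \<in> prism n p" if "y \<in> p" "0 \<le> t" "t \<le> 1" for y t
      using that by (auto simp: prism_def)
    have pb: "a \<bullet> y = b" if "y \<in> p" for y using in1[OF that, of 0] a(2) by auto
    have "a \<bullet> (x0 + 1 *\<^sub>R n) = b" using in1[OF x0, of 1] a(2) by auto
    then have an: "a \<bullet> n = 0" using pb[OF x0] by (simp add: inner_add_right)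
    have "affine hull p \<subseteq> {x. a \<bullet> x = b}" using pb by (intro hull_minimal affine_hyperplane) auto
    \<comment> \<open>Since a is orthogonal to n, moving from x0 along a stays in the plane of p, on
      which a . x is constant; this forces a = 0.\<close>
    moreover have "x0 + a \<in> affine hull p"
      using hull_inc[OF x0, of affine] an by (simp add: hull inner_add_right inner_commute)
    ultimately have "a \<bullet> a = 0" using pb[OF x0] by (auto simp: inner_add_right)
    then show False using a(1) by simp
  qed
  then show ?thesis
    unfolding face_area_def using p P
    by (intro measure_pos_of_convex_subset[OF _ conv] compact_prism polytopal_compact[OF e])
      (auto simp: prism_def)
qed

section \<open>The cell average update\<close>

lemma norm_emb:
  assumes "inj \<iota>"
  shows "norm (emb \<iota> n) = norm n"
proof -
  have "emb \<iota> n \<bullet> emb \<iota> n = (\<Sum>i\<in>UNIV. \<Sum>j\<in>UNIV. if j = i then n $ i * n $ j else 0)"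
    unfolding emb_def inner_sum_left inner_sum_right
    using assms by (intro sum.cong refl) (auto simp: inner_axis_axis inj_eq)
  also have "\<dots> = n \<bullet> n" by (simp add: inner_vec_def)
  finally show ?thesis by (simp add: norm_eq_sqrt_inner)
qed

lemma inner_emb: "v \<bullet> emb \<iota> n = (\<Sum>i\<in>UNIV. n $ i * v $ \<iota> i)"
  by (simp add: emb_def inner_sum_right inner_axis)

lemma linear_emb: "linear (emb \<iota>)"
  by (rule linearI) (simp_all add: emb_def scaleR_left_distrib sum.distrib scaleR_sum_right)

text \<open>The groups are merged into one index set, an \<open>option\<close> over a sum type with
  \<open>None\<close> for the single point \<open>z\<close>, to which the finite Jensen inequality
  applies.\<close>

lemma jensen_three_groups:
  fixes a :: "'i \<Rightarrow> real" and b :: "'j \<Rightarrow> real" and x :: "'i \<Rightarrow> 'v::real_vector"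
  assumes fin: "finite I" "finite J" and f: "convex_on C f"
    and w: "\<And>i. i \<in> I \<Longrightarrow> a i \<ge> 0" "\<And>j. j \<in> J \<Longrightarrow> b j \<ge> 0" "c \<ge> 0" "sum a I + sum b J + c = 1"
    and C: "\<And>i. i \<in> I \<Longrightarrow> x i \<in> C" "\<And>j. j \<in> J \<Longrightarrow> y j \<in> C" "z \<in> C"
  shows "(\<Sum>i\<in>I. a i *\<^sub>R x i) + (\<Sum>j\<in>J. b j *\<^sub>R y j) + c *\<^sub>R z \<in> C"
    and "f ((\<Sum>i\<in>I. a i *\<^sub>R x i) + (\<Sum>j\<in>J. b j *\<^sub>R y j) + c *\<^sub>R z) \<le>
      (\<Sum>i\<in>I. a i * f (x i)) + (\<Sum>j\<in>J. b j * f (y j)) + c * f z"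
proof -
  define S where "S = insert None (Some ` (I <+> J))"
  define w' where "w' = case_option c (case_sum a b)"
  define p where "p = case_option z (case_sum x y)"
  have S: "finite S" "S \<noteq> {}" using fin by (auto simp: S_def)
  have sumS: "(\<Sum>s\<in>S. h s) = (\<Sum>i\<in>I. h (Some (Inl i))) + (\<Sum>j\<in>J. h (Some (Inr j))) + h None"
    for h :: "('i + 'j) option \<Rightarrow> 'u::ab_group_add"
    using fin by (simp add: S_def sum.reindex sum.Plus add.commute)
  have w'1: "(\<Sum>s\<in>S. w' s) = 1" and w'0: "\<And>s. s \<in> S \<Longrightarrow> 0 \<le> w' s" and pC: "\<And>s. s \<in> S \<Longrightarrow> p s \<in> C"
    using w C unfolding sumS by (auto simp: w'_def p_def S_def)
  have "(\<Sum>s\<in>S. w' s *\<^sub>R p s) \<in> C"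
    using f S w'1 w'0 pC by (intro convex_sum) (auto simp: convex_on_def)
  moreover have "f (\<Sum>s\<in>S. w' s *\<^sub>R p s) \<le> (\<Sum>s\<in>S. w' s * f (p s))"
    using S f w'1 w'0 pC by (rule convex_on_sum)
  ultimately show "(\<Sum>i\<in>I. a i *\<^sub>R x i) + (\<Sum>j\<in>J. b j *\<^sub>R y j) + c *\<^sub>R z \<in> C"
    "f ((\<Sum>i\<in>I. a i *\<^sub>R x i) + (\<Sum>j\<in>J. b j *\<^sub>R y j) + c *\<^sub>R z) \<le>
      (\<Sum>i\<in>I. a i * f (x i)) + (\<Sum>j\<in>J. b j * f (y j)) + c * f z"
    unfolding sumS by (simp_all add: w'_def p_def)
qed

text \<open>For the HLL part this is the jump relation across the left wave. The source coefficient
  in \<open>num_flux\<close> is \<open>am\<close> times the one in \<open>T_minus\<close>, so the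
  correction fits into the same relation.\<close>

lemma num_flux_eq:
  assumes "am < ap"
  shows "num_flux \<gamma> Um Up n am ap = flux_dir \<gamma> n Um + am *\<^sub>R (T_minus \<gamma> Um Up n am ap - Um)"
proof -
  define C where "C = ap - am"
  have C: "C \<noteq> 0" "ap = C + am" using assms by (auto simp: C_def)
  have "hll_flux \<gamma> Um Up n am ap = flux_dir \<gamma> n Um + am *\<^sub>R (hll_state \<gamma> Um Up n am ap - Um)"
  proof -
    let ?H = "hll_state \<gamma> Um Up n am ap"
    have H: "C *\<^sub>R ?H = ap *\<^sub>R Up - am *\<^sub>R Um - flux_dir \<gamma> n Up + flux_dir \<gamma> n Um"
      using C(1) by (simp add: hll_state_def C_def[symmetric])
    have "C *\<^sub>R (flux_dir \<gamma> n Um + am *\<^sub>R (?H - Um)) =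
      C *\<^sub>R flux_dir \<gamma> n Um - (C * am) *\<^sub>R Um + am *\<^sub>R (C *\<^sub>R ?H)"
      by (simp add: algebra_simps)
    also note H
    also have "C *\<^sub>R flux_dir \<gamma> n Um - (C * am) *\<^sub>R Um
      + am *\<^sub>R (ap *\<^sub>R Up - am *\<^sub>R Um - flux_dir \<gamma> n Up + flux_dir \<gamma> n Um) = ap *\<^sub>R flux_dir \<gamma> n Um - am *\<^sub>R flux_dir \<gamma> n Up + (ap * am) *\<^sub>R (Up - Um)"
      unfolding C_def by (simp add: algebra_simps)
    finally have "(ap *\<^sub>R flux_dir \<gamma> n Um - am *\<^sub>R flux_dir \<gamma> n Up + (ap * am) *\<^sub>R (Up - Um)) /\<^sub>R C
      = (C *\<^sub>R (flux_dir \<gamma> n Um + am *\<^sub>R (hll_state \<gamma> Um Up n am ap - Um))) /\<^sub>R C" by simp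
    then show ?thesis using C(1) unfolding hll_flux_def C_def[symmetric] by simp
  qed
  then show ?thesis
    unfolding num_flux_def T_minus_def by (simp add: algebra_simps)
qed

lemma hll_qflux_eq:
  assumes "am < ap"
  shows "hll_qflux \<gamma> f Um Up n am ap = qn \<gamma> f n Um + am * (hll_entropy \<gamma> f Um Up n am ap - eta \<gamma> f Um)"
  using assms unfolding hll_qflux_def hll_entropy_def by (simp add: field_simps)

text \<open>Face nodes depend on the face alone, so an exterior trace is the interior trace of the
  neighbour at the same index, unless it is prescribed.\<close>

lemma trace_ext_admissible:
  assumes adm: "states_admissible D" and K: "K \<in> cells D" and \<nu>: "\<nu> \<in> bindex D K"
  shows "trace_ext D K \<nu> \<in> admissible"
proof (cases "neighbours D K (fst \<nu>) = {}")
  case True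
  then show ?thesis using adm K \<nu> by (auto simp: trace_ext_def states_admissible_def)
next
  case False
  define K' where "K' = (SOME K'. K' \<in> neighbours D K (fst \<nu>))"
  have "K' \<in> neighbours D K (fst \<nu>)" unfolding K'_def using False by (rule some_in_eq[THEN iffD2])
  then have "K' \<in> cells D" "\<nu> \<in> bindex D K'"
    using \<nu> by (auto simp: neighbours_def bindex_def)
  then have "trace_in D K' \<nu> \<in> admissible" using adm by (auto simp: states_admissible_def)
  then show ?thesis using False by (simp add: trace_ext_def trace_in_def K'_def)
qed

lemma cell_coefficients:
  fixes D :: "('d::finite) dg_scheme"
  assumes m: "conforming_mesh D" and fq: "face_quadratures k D" and \<tau>: "tstep D > 0" and K: "K \<in> cells D"
    and d: "CARD('d) \<ge> 2"
  shows "finite (bindex D K)" and "bindex D K \<noteq> {}" and "lam D K > 0"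
    and "\<And>\<nu>. \<nu> \<in> bindex D K \<Longrightarrow> bcoef D K \<nu> > 0"
    and "\<And>e. e \<in> faces D K \<Longrightarrow> face_area (normal D K e) e > 0"
proof -
  have cell: "polytopal_cell K (faces D K) (normal D K)" using m K by (simp add: conforming_mesh_def)
  then have Kp: "polytopal (int CARD('d)) K" and fin: "finite (faces D K)" and fr: "\<Union>(faces D K) = frontier K"
    and pe: "\<And>e. e \<in> faces D K \<Longrightarrow> polytopal (int CARD('d) - 1) e"
    and on: "\<And>e. e \<in> faces D K \<Longrightarrow> outward_unit_normal K e (normal D K e)"
    unfolding polytopal_cell_def by auto
  show "finite (bindex D K)" using fin by (simp add: bindex_def)
  have wsum: "(\<Sum>q\<in>{1..fnum D e}. fweight D e q) = 1"
    and wpos: "\<And>q. q \<in> {1..fnum D e} \<Longrightarrow> fweight D e q > 0" if "e \<in> faces D K" for e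
    using fq K that unfolding face_quadratures_def by blast+
  \<comment> \<open>A nonempty bounded cell has a nonempty boundary, hence a face, and face weights
    that sum to 1 force a quadrature point on it.\<close>
  have "K \<noteq> {}" using polytopal_nonempty[OF Kp] by simp
  moreover have "K \<noteq> UNIV" using polytopal_compact[OF Kp] compact_imp_bounded not_bounded_UNIV by blast
  ultimately have "frontier K \<noteq> {}" by (simp add: frontier_eq_empty)
  then obtain e where e: "e \<in> faces D K" using fr by blast
  then have "{1..fnum D e} \<noteq> {}" using wsum[OF e] by force
  then have "(e, 1) \<in> bindex D K" using e by (auto simp: bindex_def)
  then show "bindex D K \<noteq> {}" by auto
  show "lam D K > 0" using \<tau> cell_volume_pos[OF Kp] by (simp add: lam_def)
  show A: "face_area (normal D K e) e > 0" if e: "e \<in> faces D K" for e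
  proof -
    obtain c where "\<forall>x\<in>e. normal D K e \<bullet> x = c" "norm (normal D K e) = 1"
      using on[OF e] unfolding outward_unit_normal_def by blast
    then show ?thesis using face_area_pos[OF pe[OF e]] by blast
  qed
  show "bcoef D K \<nu> > 0" if "\<nu> \<in> bindex D K" for \<nu>
    using that A wpos by (auto simp: bindex_def bcoef_def intro!: mult_pos_pos)
qed

lemma norm_bnormal:
  assumes "conforming_mesh D" "coordinate_numbering (coord D)" "K \<in> cells D" "\<nu> \<in> bindex D K"
  shows "norm (bnormal D K \<nu>) = 1"
proof -
  have "fst \<nu> \<in> faces D K" using assms(4) by (auto simp: bindex_def)
  then have "norm (normal D K (fst \<nu>)) = 1"
    using assms(1,3) unfolding conforming_mesh_def polytopal_cell_def outward_unit_normal_def by blast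
  then show ?thesis using assms(2) by (simp add: bnormal_def norm_emb coordinate_numbering_def)
qed

text \<open>Normals are constant on faces, so exactness applies to each component separately. The
  result is ordered by components, ready for \<open>divergence_theorem_cell\<close> in each
  coordinate direction.\<close>

lemma sum_bindex_face_quadrature:
  fixes D :: "('d::finite) dg_scheme"
  assumes m: "conforming_mesh D" and fq: "face_quadratures k D" and K: "K \<in> cells D"
    and d: "CARD('d) \<ge> 2" and g: "\<And>i. poly_deg k (g i)" and \<tau>: "tstep D > 0"
  shows "(\<Sum>\<nu>\<in>bindex D K. bcoef D K \<nu> * (\<Sum>i\<in>UNIV. normal D K (fst \<nu>) $ i * g i (bnode D \<nu>))) =
    (\<Sum>i\<in>UNIV. \<Sum>e\<in>faces D K. (normal D K e \<bullet> axis i 1) * face_integral (normal D K e) e (g i))"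
proof -
  have fin: "finite (faces D K)" using m K by (simp add: conforming_mesh_def polytopal_cell_def)
  have "(\<Sum>\<nu>\<in>bindex D K. bcoef D K \<nu> * (\<Sum>i\<in>UNIV. normal D K (fst \<nu>) $ i * g i (bnode D \<nu>))) =
    (\<Sum>e\<in>faces D K. \<Sum>q\<in>{1..fnum D e}. face_area (normal D K e) e * fweight D e q *
      (\<Sum>i\<in>UNIV. normal D K e $ i * g i (fnode D e q)))"
    unfolding bindex_def using fin by (subst sum.Sigma) (auto simp: bcoef_def bnode_def split_def)
  also have "\<dots> = (\<Sum>e\<in>faces D K. \<Sum>i\<in>UNIV. normal D K e $ i * face_integral (normal D K e) e (g i))"
  proof (rule sum.cong[OF refl])
    fix e assume e: "e \<in> faces D K"
    define A where "A = face_area (normal D K e) e"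
    have A: "A > 0" using cell_coefficients(5)[OF m fq \<tau> K d e] by (simp add: A_def)
    have "face_integral (normal D K e) e (g i) / A = (\<Sum>q\<in>{1..fnum D e}. fweight D e q * g i (fnode D e q))" for i
      using fq K e g[of i] unfolding face_quadratures_def A_def by blast
    then have F: "face_integral (normal D K e) e (g i) = A * (\<Sum>q\<in>{1..fnum D e}. fweight D e q * g i (fnode D e q))" for i
      using A by (simp add: field_simps)
    have "(\<Sum>q\<in>{1..fnum D e}. A * fweight D e q * (\<Sum>i\<in>UNIV. normal D K e $ i * g i (fnode D e q))) =
      (\<Sum>q\<in>{1..fnum D e}. \<Sum>i\<in>UNIV. normal D K e $ i * (A * (fweight D e q * g i (fnode D e q))))"
      by (simp add: sum_distrib_left mult_ac)
    also have "\<dots> = (\<Sum>i\<in>UNIV. \<Sum>q\<in>{1..fnum D e}. normal D K e $ i * (A * (fweight D e q * g i (fnode D e q))))"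
      by (rule sum.swap)
    finally show "(\<Sum>q\<in>{1..fnum D e}. face_area (normal D K e) e * fweight D e q *
      (\<Sum>i\<in>UNIV. normal D K e $ i * g i (fnode D e q))) =
      (\<Sum>i\<in>UNIV. normal D K e $ i * face_integral (normal D K e) e (g i))"
      unfolding F A_def[symmetric] by (simp add: sum_distrib_left)
  qed
  also have "\<dots> = (\<Sum>i\<in>UNIV. \<Sum>e\<in>faces D K. normal D K e $ i * face_integral (normal D K e) e (g i))"
    by (rule sum.swap)
  finally show ?thesis by (simp add: inner_axis)
qed

text \<open>The coefficient is concentrated at the zero exponent. Finiteness of the set of exponents
  matters, since \<open>sum\<close> over an infinite set is 0 by default.\<close>

lemma poly_deg_const: "poly_deg k (\<lambda>x :: real^'d::finite. c)"
proof -
  let ?A = "{a :: 'd \<Rightarrow> nat. (\<Sum>i\<in>UNIV. a i) \<le> k}"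
  have "?A \<subseteq> (\<Pi>\<^sub>E i\<in>UNIV. {..k})"
  proof
    fix a :: "'d \<Rightarrow> nat" assume "a \<in> ?A"
    then have "a i \<le> k" for i using member_le_sum[of i UNIV a] by simp
    then show "a \<in> (\<Pi>\<^sub>E i\<in>UNIV. {..k})" by auto
  qed
  then have fin: "finite ?A" by (rule finite_subset) (intro finite_PiE; simp)
  have "(\<Sum>a\<in>?A. (if a = (\<lambda>_. 0) then c else 0) * (\<Prod>i\<in>UNIV. (x $ i) ^ a i)) = c" for x :: "real^'d"
  proof -
    have "(\<Sum>a\<in>?A. (if a = (\<lambda>_. 0) then c else 0) * (\<Prod>i\<in>UNIV. (x $ i) ^ a i)) =
      (\<Sum>a\<in>?A. if a = (\<lambda>_. 0) then c else 0)"
      by (rule sum.cong) auto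
    also have "\<dots> = c" using fin by (simp add: sum.delta)
    finally show ?thesis .
  qed
  then show ?thesis unfolding poly_deg_def by (intro exI[of _ "\<lambda>a. if a = (\<lambda>_. 0) then c else 0"]) simp
qed

text \<open>The coordinate vector fields are constant: their divergence is zero and their face
  quadrature is exact.\<close>

lemma sum_bcoef_bnormal:
  fixes D :: "('d::finite) dg_scheme"
  assumes m: "conforming_mesh D" and fq: "face_quadratures k D" and K: "K \<in> cells D"
    and d: "CARD('d) \<in> {2, 3}" and \<tau>: "tstep D > 0"
  shows "(\<Sum>\<nu>\<in>bindex D K. bcoef D K \<nu> *\<^sub>R bnormal D K \<nu>) = 0"
proof -
  have cell: "polytopal_cell K (faces D K) (normal D K)" using m K by (simp add: conforming_mesh_def)
  have d2: "CARD('d) \<ge> 2" using d by auto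
  have "(\<Sum>\<nu>\<in>bindex D K. bcoef D K \<nu> *\<^sub>R normal D K (fst \<nu>)) $ j = 0" for j
  proof -
    let ?g = "\<lambda>i (x::real^'d). if i = j then 1 else (0::real)"
    have p: "poly_deg k (?g i)" for i using poly_deg_const[of k] by (cases "i = j") auto
    have z: "(\<Sum>e\<in>faces D K. (normal D K e \<bullet> axis i 1) * face_integral (normal D K e) e (?g i)) = 0" for i
    proof -
      have "(?g i has_derivative (\<lambda>h. 0 \<bullet> h)) (at x)" for x
        by (rule has_derivative_eq_rhs[OF has_derivative_const]) (simp add: fun_eq_iff)
      from divergence_theorem_cell[OF d cell this continuous_on_const, of "axis i 1"]
      show ?thesis by simp
    qed
    have "(\<Sum>\<nu>\<in>bindex D K. bcoef D K \<nu> *\<^sub>R normal D K (fst \<nu>)) $ j =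
      (\<Sum>\<nu>\<in>bindex D K. bcoef D K \<nu> * (\<Sum>i\<in>UNIV. normal D K (fst \<nu>) $ i * ?g i (bnode D \<nu>)))"
      by (simp add: sum_component if_distrib[of "(*) _"] sum.delta cong: if_cong)
    also have "\<dots> = 0"
      using sum_bindex_face_quadrature[OF m fq K d2 p \<tau>] by (simp only: z) simp
    finally show ?thesis .
  qed
  then have "(\<Sum>\<nu>\<in>bindex D K. bcoef D K \<nu> *\<^sub>R normal D K (fst \<nu>)) = 0" by (simp add: vec_eq_iff)
  then have "emb (coord D) (\<Sum>\<nu>\<in>bindex D K. bcoef D K \<nu> *\<^sub>R normal D K (fst \<nu>)) = 0"
    by (simp add: linear_0[OF linear_emb])
  then show ?thesis
    by (simp add: linear_sum[OF linear_emb] linear_scale[OF linear_emb] bnormal_def)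
qed

text \<open>On a planar face the normal component of the field is again a polynomial of degree at
  most k, so its quadrature is exact. Only components numbered by \<open>coord\<close> enter, in the
  divergence as well as in the product with the embedded normal, so d = 2 and d = 3 are treated
  alike.\<close>

lemma sum_bcoef_normal_field:
  fixes D :: "('d::finite) dg_scheme"
  assumes m: "conforming_mesh D" and fq: "face_quadratures k D" and K: "K \<in> cells D"
    and d: "CARD('d) \<in> {2, 3}" and \<tau>: "tstep D > 0"
    and pol: "state_poly k (sol D K)" and ldf: "locally_div_free D"
  shows "(\<Sum>\<nu>\<in>bindex D K. bcoef D K \<nu> * (mag (trace_in D K \<nu>) \<bullet> bnormal D K \<nu>)) = 0"
proof -
  have cell: "polytopal_cell K (faces D K) (normal D K)" using m K by (simp add: conforming_mesh_def)
  then have cK: "compact K" using polytopal_compact by (auto simp: polytopal_cell_def)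
  have d2: "CARD('d) \<ge> 2" using d by auto
  define g where "g i x = mag (sol D K x) $ coord D i" for i x
  have p: "poly_deg k (g i)" for i
  proof -
    let ?b = "(0, 0, axis (coord D i) 1, 0) :: state"
    have "?b \<in> Basis" by (simp add: Basis_prod_def axis_in_Basis_iff zero_prod_def image_iff)
    moreover have "g i = (\<lambda>x. sol D K x \<bullet> ?b)"
      by (simp add: g_def mag_def inner_prod_def inner_axis fun_eq_iff)
    ultimately show ?thesis using pol by (auto simp: state_poly_def)
  qed
  have "\<forall>i. \<exists>G. continuous_on UNIV G \<and> (\<forall>x. (g i has_derivative (\<lambda>h. G x \<bullet> h)) (at x))"
    using poly_deg_has_continuous_gradient[OF p] unfolding has_continuous_gradient_def by blast
  from choice[OF this] obtain G where G: "\<And>i. continuous_on UNIV (G i)" "\<And>i x. (g i has_derivative (\<lambda>h. G i x \<bullet> h)) (at x)"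
    by blast
  have div: "(\<Sum>i\<in>UNIV. G i x \<bullet> axis i 1) = 0" if "x \<in> K" for x
  proof -
    have fd: "frechet_derivative (g i) (at x) = (\<lambda>h. G i x \<bullet> h)" for i
      using frechet_derivative_at[OF G(2)] by simp
    have gi: "g i = (\<lambda>y. mag (sol D K y) $ coord D i)" for i by (simp add: g_def fun_eq_iff)
    have "(\<Sum>i\<in>UNIV. frechet_derivative (g i) (at x) (axis i 1)) = 0"
      using ldf K that unfolding locally_div_free_def gi by blast
    then show ?thesis by (simp add: fd)
  qed
  have "(\<Sum>\<nu>\<in>bindex D K. bcoef D K \<nu> * (mag (trace_in D K \<nu>) \<bullet> bnormal D K \<nu>)) =
    (\<Sum>\<nu>\<in>bindex D K. bcoef D K \<nu> * (\<Sum>i\<in>UNIV. normal D K (fst \<nu>) $ i * g i (bnode D \<nu>)))"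
    by (simp add: bnormal_def inner_emb g_def trace_in_def)
  also have "\<dots> = (\<Sum>i\<in>UNIV. \<Sum>e\<in>faces D K. (normal D K e \<bullet> axis i 1) * face_integral (normal D K e) e (g i))"
    by (rule sum_bindex_face_quadrature[OF m fq K d2 p \<tau>])
  also have "\<dots> = (\<Sum>i\<in>UNIV. integral K (\<lambda>x. G i x \<bullet> axis i 1))"
    using divergence_theorem_cell[OF d cell G(2) G(1)] by simp
  also have "\<dots> = integral K (\<lambda>x. \<Sum>i\<in>UNIV. G i x \<bullet> axis i 1)"
    by (rule integral_sum[symmetric])
      (auto intro!: continuous_imp_integrable_on_compact(2) cK continuous_intros continuous_on_subset[OF G(1)])
  also have "\<dots> = integral K (\<lambda>x. 0)" using div by (rule Henstock_Kurzweil_Integration.integral_cong)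
  finally show ?thesis by simp
qed

lemma cell_avg_quadrature:
  fixes D :: "('d::finite) dg_scheme"
  assumes m: "conforming_mesh D" and cq: "cell_quadratures k D" and K: "K \<in> cells D"
    and pol: "state_poly k (sol D K)"
  shows "cell_avg K (sol D K) = (\<Sum>\<alpha>\<in>{1..inum D K}. iweight D K \<alpha> *\<^sub>R sol D K (inode D K \<alpha>))
    + (\<Sum>\<nu>\<in>bindex D K. bweight D K \<nu> *\<^sub>R trace_in D K \<nu>)"
proof (rule euclidean_eqI)
  fix b :: state assume b: "b \<in> Basis"
  have "polytopal (int CARD('d)) K" using m K unfolding conforming_mesh_def polytopal_cell_def by blast
  then have cK: "compact K" by (rule polytopal_compact)
  have "continuous_on K (\<lambda>x. sol D K x \<bullet> b')" if "b' \<in> Basis" for b'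
    using pol that unfolding state_poly_def
    by (blast intro: has_continuous_gradient_imp_continuous poly_deg_has_continuous_gradient)
  then have "continuous_on K (sol D K)" using continuous_on_componentwise[of K "sol D K"] by blast
  then have "sol D K integrable_on K" by (rule continuous_imp_integrable_on_compact(2)[OF cK])
  then have "cell_avg K (sol D K) \<bullet> b = cell_avg K (\<lambda>x. sol D K x \<bullet> b)"
    using integral_component_eq[of "sol D K" K b] unfolding cell_avg_def inner_scaleR_left by simp
  also have "\<dots> = (\<Sum>\<alpha>\<in>{1..inum D K}. iweight D K \<alpha> * (sol D K (inode D K \<alpha>) \<bullet> b)) +
        (\<Sum>\<nu>\<in>bindex D K. bweight D K \<nu> * (sol D K (bnode D \<nu>) \<bullet> b))"
    using cq K pol b unfolding cell_quadratures_def state_poly_def by blast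
  finally show "cell_avg K (sol D K) \<bullet> b = ((\<Sum>\<alpha>\<in>{1..inum D K}. iweight D K \<alpha> *\<^sub>R sol D K (inode D K \<alpha>))
    + (\<Sum>\<nu>\<in>bindex D K. bweight D K \<nu> *\<^sub>R trace_in D K \<nu>)) \<bullet> b"
    by (simp add: inner_add_left inner_sum_left trace_in_def)
qed

theorem theorem3p6:
  fixes \<gamma> :: real
    and M k :: nat
    and f :: "nat \<Rightarrow> real \<Rightarrow> real"
    and D :: "('d::finite) dg_scheme"
  assumes "\<gamma> > 1"
    and "CARD('d) \<in> {2, 3}"
    and "coordinate_numbering (coord D)"
    and "\<forall>r\<in>{1..M}. entropy_generator \<gamma> (f r)"
    and "conforming_mesh D"
    and "\<forall>K\<in>cells D. state_poly k (sol D K)"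
    and "locally_div_free D"
    and "face_quadratures k D"
    and "cell_quadratures k D"
    and "states_admissible D"
    and "wave_speeds D"
    and "tstep D > 0"
    and "\<forall>K\<in>cells D. \<forall>\<nu>\<in>bindex D K.
      speed_m D K \<nu> \<le> am0 \<gamma> (trace_in D K \<nu>) (trace_ext D K \<nu>) (bnormal D K \<nu>) \<and>
      speed_p D K \<nu> \<ge> ap0 \<gamma> (trace_in D K \<nu>) (trace_ext D K \<nu>) (bnormal D K \<nu>)"
    and "\<forall>K\<in>cells D. \<forall>\<nu>\<in>bindex D K.
      lam D K * bcoef D K \<nu> * (alpha_PP \<gamma> D K \<nu> - speed_m D K \<nu>) < bweight D K \<nu>"
    and "\<forall>r\<in>{1..M}. \<forall>K\<in>cells D. \<forall>\<nu>\<in>bindex D K.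
      eta \<gamma> (f r) (at_point D K \<nu> (T_minus \<gamma>)) \<le> at_point D K \<nu> (hll_entropy \<gamma> (f r)) \<and>
      eta \<gamma> (f r) (at_point D K \<nu> (T_plus \<gamma>)) \<le> at_point D K \<nu> (hll_entropy \<gamma> (f r))"
    and "\<forall>r\<in>{1..M}. \<forall>K\<in>cells D. eta \<gamma> (f r) (Xi \<gamma> D K) \<le> Xi_entropy \<gamma> (f r) D K"
  shows "\<forall>K\<in>cells D.
    cell_update \<gamma> D K \<in> admissible \<and>
    (\<forall>r\<in>{1..M}. eta \<gamma> (f r) (cell_update \<gamma> D K) \<le> entropy_budget \<gamma> (f r) D K)"
proof (intro ballI conjI)
  note g = assms(1) and d = assms(2) and num = assms(3) and f = assms(4) and m = assms(5) and pol = assms(6)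
    and ldf = assms(7) and fq = assms(8) and cq = assms(9) and adm = assms(10) and ws = assms(11)
    and \<tau> = assms(12) and sp = assms(13) and cfl = assms(14) and ET = assms(15) and EX = assms(16)
  fix K assume K: "K \<in> cells D"
  have d2: "CARD('d) \<ge> 2" using d by auto
  let ?I = "{1..inum D K}" and ?J = "bindex D K"
  define T where "T \<nu> = at_point D K \<nu> (T_minus \<gamma>)" for \<nu>
  define w where "w \<nu> = lam D K * bcoef D K \<nu> * (- speed_m D K \<nu>)" for \<nu>
  note cf = cell_coefficients[OF m fq \<tau> K d2]
  have tr: "trace_in D K \<nu> \<in> admissible" if "\<nu> \<in> ?J" for \<nu>
    using adm K that unfolding states_admissible_def by blast
  have n1: "norm (bnormal D K \<nu>) = 1" if "\<nu> \<in> ?J" for \<nu>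
    by (rule norm_bnormal[OF m num K that])
  have a: "speed_m D K \<nu> < 0" "0 < speed_p D K \<nu>" if "\<nu> \<in> ?J" for \<nu>
    using ws K that unfolding wave_speeds_def by blast+
  have Tadm: "T \<nu> \<in> admissible" if \<nu>: "\<nu> \<in> ?J" for \<nu>
    unfolding T_def at_point_def using sp K \<nu>
    by (intro T_minus_admissible g tr trace_ext_admissible[OF adm] n1 a) blast+
  \<comment> \<open>This is the time step restriction divided by \<lambda> c, which is
    positive.\<close>
  have \<beta>: "beta D K \<nu> > alpha_PP \<gamma> D K \<nu>" if \<nu>: "\<nu> \<in> ?J" for \<nu>
  proof -
    have "lam D K * bcoef D K \<nu> > 0" using cf(3) cf(4)[OF \<nu>] by simp
    moreover have "(alpha_PP \<gamma> D K \<nu> - speed_m D K \<nu>) * (lam D K * bcoef D K \<nu>) < bweight D K \<nu>"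
      using cfl K \<nu> by (simp add: mult.commute)
    ultimately have "alpha_PP \<gamma> D K \<nu> - speed_m D K \<nu> < bweight D K \<nu> / (lam D K * bcoef D K \<nu>)"
      by (simp add: less_divide_eq)
    then show ?thesis by (simp add: beta_def)
  qed
  have cn: "(\<Sum>\<nu>\<in>?J. bcoef D K \<nu> *\<^sub>R bnormal D K \<nu>) = 0"
    by (rule sum_bcoef_bnormal[OF m fq K d \<tau>])
  have cB: "(\<Sum>\<nu>\<in>?J. bcoef D K \<nu> * (mag (trace_in D K \<nu>) \<bullet> bnormal D K \<nu>)) = 0"
    using sum_bcoef_normal_field[OF m fq K d \<tau> _ ldf] pol K by blast
  note \<Xi> = interior_state_admissible[OF g cf(1,2,4) tr n1 cn cB \<beta>[unfolded alpha_PP_def perimeter_def]]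
  have DK: "DK D K > 0" using \<Xi>(1) by (simp add: DK_def)
  have Xi: "Xi \<gamma> D K \<in> admissible" using \<Xi>(2) by (simp add: Xi_def DK_def)
  \<comment> \<open>The boundary weight splits into \<open>w\<close>, carried by T, and the share of
    \<Xi>; with the interior weights the total is therefore 1.\<close>
  have lb: "lam D K * (bcoef D K \<nu> * beta D K \<nu>) = bweight D K \<nu> - w \<nu>" if "\<nu> \<in> ?J" for \<nu>
    using cf(3) cf(4)[OF that] by (simp add: beta_def w_def field_simps)
  have lD: "lam D K * DK D K = (\<Sum>\<nu>\<in>?J. bweight D K \<nu>) - (\<Sum>\<nu>\<in>?J. w \<nu>)"
    unfolding DK_def sum_distrib_left sum_subtractf[symmetric] using lb by (rule sum.cong[OF refl])
  have am: "speed_m D K \<nu> < speed_p D K \<nu>" if "\<nu> \<in> ?J" for \<nu> using a[OF that] by linarith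
  have upd: "cell_update \<gamma> D K = (\<Sum>\<alpha>\<in>?I. iweight D K \<alpha> *\<^sub>R sol D K (inode D K \<alpha>))
    + (\<Sum>\<nu>\<in>?J. w \<nu> *\<^sub>R T \<nu>) + (lam D K * DK D K) *\<^sub>R Xi \<gamma> D K"
  proof -
    let ?F = "\<lambda>\<nu>. flux_dir \<gamma> (bnormal D K \<nu>) (trace_in D K \<nu>)"
    have "(lam D K * DK D K) *\<^sub>R Xi \<gamma> D K =
      lam D K *\<^sub>R (\<Sum>\<nu>\<in>?J. bcoef D K \<nu> *\<^sub>R (beta D K \<nu> *\<^sub>R trace_in D K \<nu> - ?F \<nu>))"
      using DK by (simp add: Xi_def)
    also have "\<dots> = (\<Sum>\<nu>\<in>?J. lam D K *\<^sub>R (bcoef D K \<nu> *\<^sub>R (beta D K \<nu> *\<^sub>R trace_in D K \<nu> - ?F \<nu>)))"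
      by (rule scaleR_sum_right)
    \<comment> \<open>The physical fluxes in \<Xi> are those contained in the numerical fluxes, so
      trading one for the other leaves only states.\<close>
    also have "\<dots> = (\<Sum>\<nu>\<in>?J. bweight D K \<nu> *\<^sub>R trace_in D K \<nu> - w \<nu> *\<^sub>R T \<nu>
      - lam D K *\<^sub>R (bcoef D K \<nu> *\<^sub>R at_point D K \<nu> (num_flux \<gamma>)))"
    proof (rule sum.cong[OF refl])
      fix \<nu> assume \<nu>: "\<nu> \<in> ?J"
      have nf: "at_point D K \<nu> (num_flux \<gamma>) = ?F \<nu> + speed_m D K \<nu> *\<^sub>R (T \<nu> - trace_in D K \<nu>)"
        using num_flux_eq[OF am[OF \<nu>]] by (simp add: at_point_def T_def)
      have "lam D K *\<^sub>R (bcoef D K \<nu> *\<^sub>R at_point D K \<nu> (num_flux \<gamma>)) =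
        lam D K *\<^sub>R (bcoef D K \<nu> *\<^sub>R ?F \<nu>) - w \<nu> *\<^sub>R T \<nu> + w \<nu> *\<^sub>R trace_in D K \<nu>"
        unfolding nf by (simp add: w_def algebra_simps)
      moreover have "lam D K *\<^sub>R (bcoef D K \<nu> *\<^sub>R (beta D K \<nu> *\<^sub>R trace_in D K \<nu> - ?F \<nu>)) =
        (lam D K * (bcoef D K \<nu> * beta D K \<nu>)) *\<^sub>R trace_in D K \<nu> - lam D K *\<^sub>R (bcoef D K \<nu> *\<^sub>R ?F \<nu>)"
        by (simp add: scaleR_diff_right)
      ultimately show "lam D K *\<^sub>R (bcoef D K \<nu> *\<^sub>R (beta D K \<nu> *\<^sub>R trace_in D K \<nu> - ?F \<nu>)) =
        bweight D K \<nu> *\<^sub>R trace_in D K \<nu> - w \<nu> *\<^sub>R T \<nu>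
        - lam D K *\<^sub>R (bcoef D K \<nu> *\<^sub>R at_point D K \<nu> (num_flux \<gamma>))"
        unfolding lb[OF \<nu>] by (simp add: scaleR_diff_left)
    qed
    finally show ?thesis
      using cell_avg_quadrature[OF m cq K] pol K
      by (simp add: cell_update_def sum_subtractf scaleR_sum_right)
  qed
  have wn: "w \<nu> \<ge> 0" if "\<nu> \<in> ?J" for \<nu>
    using cf(3) cf(4)[OF that] a[OF that] by (simp add: w_def mult_nonneg_nonpos)
  have iw: "iweight D K \<alpha> \<ge> 0" if "\<alpha> \<in> ?I" for \<alpha>
    using cq K that unfolding cell_quadratures_def by (meson less_imp_le)
  have one: "(\<Sum>\<alpha>\<in>?I. iweight D K \<alpha>) + (\<Sum>\<nu>\<in>?J. w \<nu>) + lam D K * DK D K = 1"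
    using cq K unfolding lD cell_quadratures_def by simp
  have ia: "sol D K (inode D K \<alpha>) \<in> admissible" if "\<alpha> \<in> ?I" for \<alpha>
    using adm K that unfolding states_admissible_def by blast
  have lD0: "lam D K * DK D K \<ge> 0" using cf(3) DK by simp
  note J = jensen_three_groups[OF finite_atLeastAtMost cf(1) _ iw wn lD0 one ia Tadm Xi]
  \<comment> \<open>Membership is independent of the entropies, so the zero function serves as the
    convex function; this also covers M = 0.\<close>
  have "convex_on admissible (\<lambda>_. 0)" using convex_admissible by (simp add: convex_on_def)
  from J(1)[OF this] show "cell_update \<gamma> D K \<in> admissible" unfolding upd .
  fix r assume r: "r \<in> {1..M}"
  let ?eta = "eta \<gamma> (f r)"
  have "?eta (cell_update \<gamma> D K) \<le> (\<Sum>\<alpha>\<in>?I. iweight D K \<alpha> * ?eta (sol D K (inode D K \<alpha>)))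
    + (\<Sum>\<nu>\<in>?J. w \<nu> * ?eta (T \<nu>)) + lam D K * DK D K * ?eta (Xi \<gamma> D K)"
    unfolding upd using f r by (intro J(2) convex_on_eta[OF g]) blast
  \<comment> \<open>The assumed entropy inequalities for T and \<Xi> enter here, multiplied by
    nonnegative weights.\<close>
  also have "\<dots> \<le> (\<Sum>\<alpha>\<in>?I. iweight D K \<alpha> * ?eta (sol D K (inode D K \<alpha>)))
    + (\<Sum>\<nu>\<in>?J. w \<nu> * at_point D K \<nu> (hll_entropy \<gamma> (f r))) + lam D K * DK D K * Xi_entropy \<gamma> (f r) D K"
    using ET EX r K wn lD0 unfolding T_def
    by (intro add_mono order_refl sum_mono mult_left_mono) blast+
  \<comment> \<open>The computation of \<open>upd\<close> with states and fluxes replaced by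
    entropies and entropy fluxes; \<open>hll_entropy\<close> takes the place of T and
    \<open>Xi_entropy\<close> that of \<Xi>.\<close>
  also have "\<dots> = entropy_budget \<gamma> (f r) D K"
  proof -
    let ?q = "\<lambda>\<nu>. qn \<gamma> (f r) (bnormal D K \<nu>) (trace_in D K \<nu>)"
    have "lam D K * DK D K * Xi_entropy \<gamma> (f r) D K =
      lam D K * (\<Sum>\<nu>\<in>?J. bcoef D K \<nu> * (beta D K \<nu> * ?eta (trace_in D K \<nu>) - ?q \<nu>))"
      using DK by (simp add: Xi_entropy_def)
    also have "\<dots> = (\<Sum>\<nu>\<in>?J. lam D K * (bcoef D K \<nu> * (beta D K \<nu> * ?eta (trace_in D K \<nu>) - ?q \<nu>)))"
      by (rule sum_distrib_left)
    also have "\<dots> = (\<Sum>\<nu>\<in>?J. bweight D K \<nu> * ?eta (trace_in D K \<nu>)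
      - w \<nu> * at_point D K \<nu> (hll_entropy \<gamma> (f r)) - lam D K * (bcoef D K \<nu> * at_point D K \<nu> (hll_qflux \<gamma> (f r))))"
    proof (rule sum.cong[OF refl])
      fix \<nu> assume \<nu>: "\<nu> \<in> ?J"
      have q: "at_point D K \<nu> (hll_qflux \<gamma> (f r)) =
        ?q \<nu> + speed_m D K \<nu> * (at_point D K \<nu> (hll_entropy \<gamma> (f r)) - ?eta (trace_in D K \<nu>))"
        using hll_qflux_eq[OF am[OF \<nu>]] by (simp add: at_point_def)
      have "lam D K * (bcoef D K \<nu> * (beta D K \<nu> * ?eta (trace_in D K \<nu>) - ?q \<nu>)) =
        lam D K * (bcoef D K \<nu> * beta D K \<nu>) * ?eta (trace_in D K \<nu>) - lam D K * (bcoef D K \<nu> * ?q \<nu>)"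
        by (simp add: algebra_simps)
      then show "lam D K * (bcoef D K \<nu> * (beta D K \<nu> * ?eta (trace_in D K \<nu>) - ?q \<nu>)) =
        bweight D K \<nu> * ?eta (trace_in D K \<nu>) - w \<nu> * at_point D K \<nu> (hll_entropy \<gamma> (f r))
        - lam D K * (bcoef D K \<nu> * at_point D K \<nu> (hll_qflux \<gamma> (f r)))"
        unfolding lb[OF \<nu>] q by (simp add: w_def algebra_simps)
    qed
    finally show ?thesis by (simp add: entropy_budget_def sum_subtractf sum_distrib_left)
  qed
  finally show "?eta (cell_update \<gamma> D K) \<le> entropy_budget \<gamma> (f r) D K" .
qed

end
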